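(* Let $A\ast_C B$ be an amalgamated product, where $A$ and $B$ are finitely generated groups and $C$ is a finite subgroup of both $A$ and $B$. Let $S_C$ be the set of all non-trivial elements of $C$. Let $S_A$ and $S_B$ be finite generating sets of $A$ and $B$, respectively, that contain $S_C$. If the marked groups $(A,S_A)$ and $(B,S_B)$ are of type $\mathsf{R}$, then the marked group $(A\ast_C B, S_A\cup S_B)$ is of type $\mathsf{R}$.
   Context: For a metric space $X$ and a real number $r\ge 0$, the Rips complex $R_r(X)$ is the simplicial complex whose simplices are the non-empty finite subsets of $X$ of diameter $\le r$. A marked group is a pair $(G,S)$, where $G$ is a finitely generated group and $S$ is a finite generating set of $G$. The group $G$ is equipped with the word metric $d_S$: $d_S(g,g)=0$ and, for $g\neq h$, $d_S(g,h)$ is the least $k\in\mathbb{N}$ such that $g^{-1}h=s_1\cdots s_k$ for some $s_1,\ldots,s_k\in S\cup S^{-1}$. Write $R_r(G,S)$ for the Rips complex $R_r(G,d_S)$. A marked group $(G,S)$ is of type $\mathsf{R}$ if there exists a real number $r_0\ge 0$ such that for all real $r\ge r_0$ the Rips complex $R_r(G,S)$ is contractible. In the amalgamated product, $A$ and $B$ are regarded as subgroups of $A\ast_C B$ via the canonical embeddings, so $S_A\cup S_B$ is a finite generating set of $A\ast_C B$. *)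

theory Defs
  imports "HOL-Analysis.Analysis" "HOL-Algebra.Generated_Groups"
begin

section \<open>Simplicial complexes and their geometric realisation\<close>

text \<open>An abstract simplicial complex is given by its set of simplices, which are non-empty finite
  sets of vertices.  A point of the realisation is given by its barycentric coordinates,
  a function on all vertices that vanishes outside of some simplex.\<close>

definition geometric_simplex :: "'v set \<Rightarrow> ('v \<Rightarrow> real) set" where
  "geometric_simplex \<sigma> =
     {\<alpha>. (\<forall>v. 0 \<le> \<alpha> v) \<and> (\<forall>v. v \<notin> \<sigma> \<longrightarrow> \<alpha> v = 0) \<and> (\<Sum>v\<in>\<sigma>. \<alpha> v) = 1}"

text \<open>The realisation carries the weak (coherent) topology.  The topology that a single (finite)
  simplex inherits from the product topology is its Euclidean topology.\<close>

definition geometric_realization :: "'v set set \<Rightarrow> ('v \<Rightarrow> real) topology" where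
  "geometric_realization K =
     topology (\<lambda>U. U \<subseteq> (\<Union>\<sigma>\<in>K. geometric_simplex \<sigma>) \<and>
       (\<forall>\<sigma>\<in>K. openin (subtopology (powertop_real UNIV) (geometric_simplex \<sigma>))
                     (U \<inter> geometric_simplex \<sigma>)))"

lemma openin_geometric_realization:
  "openin (geometric_realization K) U \<longleftrightarrow>
     U \<subseteq> (\<Union>\<sigma>\<in>K. geometric_simplex \<sigma>) \<and>
     (\<forall>\<sigma>\<in>K. openin (subtopology (powertop_real UNIV) (geometric_simplex \<sigma>))
                   (U \<inter> geometric_simplex \<sigma>))"
proof -
  let ?P = "\<lambda>U. U \<subseteq> (\<Union>\<sigma>\<in>K. geometric_simplex \<sigma>) \<and>
     (\<forall>\<sigma>\<in>K. openin (subtopology (powertop_real UNIV) (geometric_simplex \<sigma>))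
                   (U \<inter> geometric_simplex \<sigma>))"
  have "istopology ?P"
    unfolding istopology_def
  proof (intro conjI allI impI)
    fix S T assume ST: "?P S" "?P T"
    have eq: "S \<inter> T \<inter> X = (S \<inter> X) \<inter> (T \<inter> X)" for X by blast
    show "S \<inter> T \<subseteq> (\<Union>\<sigma>\<in>K. geometric_simplex \<sigma>)" using ST by blast
    show "\<forall>\<sigma>\<in>K. openin (subtopology (powertop_real UNIV) (geometric_simplex \<sigma>))
                   (S \<inter> T \<inter> geometric_simplex \<sigma>)"
      unfolding eq using ST by (blast intro: openin_Int)
  next
    fix \<K> assume K: "\<forall>U\<in>\<K>. ?P U"
    show "\<Union>\<K> \<subseteq> (\<Union>\<sigma>\<in>K. geometric_simplex \<sigma>)" using K by blast
    have eq: "\<Union>\<K> \<inter> X = (\<Union>U\<in>\<K>. U \<inter> X)" for X by blast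
    show "\<forall>\<sigma>\<in>K. openin (subtopology (powertop_real UNIV) (geometric_simplex \<sigma>))
                   (\<Union>\<K> \<inter> geometric_simplex \<sigma>)"
      unfolding eq using K by (intro ballI openin_Union) blast
  qed
  then show ?thesis
    by (simp add: geometric_realization_def topology_inverse')
qed

lemma topspace_geometric_realization:
  "topspace (geometric_realization K) = (\<Union>\<sigma>\<in>K. geometric_simplex \<sigma>)"
proof
  show "topspace (geometric_realization K) \<subseteq> (\<Union>\<sigma>\<in>K. geometric_simplex \<sigma>)"
    using openin_geometric_realization openin_topspace by blast
  have "(\<Union>\<sigma>\<in>K. geometric_simplex \<sigma>) \<inter> geometric_simplex \<tau> = geometric_simplex \<tau>"
    if "\<tau> \<in> K" for \<tau> using that by blast
  then have "openin (geometric_realization K) (\<Union>\<sigma>\<in>K. geometric_simplex \<sigma>)"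
    unfolding openin_geometric_realization
    by (simp add: openin_subtopology_refl)
  then show "(\<Union>\<sigma>\<in>K. geometric_simplex \<sigma>) \<subseteq> topspace (geometric_realization K)"
    by (rule openin_subset)
qed

section \<open>Rips complexes\<close>

definition diameter_wrt :: "('a \<Rightarrow> 'a \<Rightarrow> real) \<Rightarrow> 'a set \<Rightarrow> real" where
  "diameter_wrt d \<sigma> = (SUP (x, y)\<in>\<sigma> \<times> \<sigma>. d x y)"

definition rips_complex :: "'a set \<Rightarrow> ('a \<Rightarrow> 'a \<Rightarrow> real) \<Rightarrow> real \<Rightarrow> 'a set set" where
  "rips_complex X d r = {\<sigma>. \<sigma> \<noteq> {} \<and> finite \<sigma> \<and> \<sigma> \<subseteq> X \<and> diameter_wrt d \<sigma> \<le> r}"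

lemma rips_complex_iff:
  "\<sigma> \<in> rips_complex X d r \<longleftrightarrow>
     \<sigma> \<noteq> {} \<and> finite \<sigma> \<and> \<sigma> \<subseteq> X \<and> (\<forall>x\<in>\<sigma>. \<forall>y\<in>\<sigma>. d x y \<le> r)"
proof -
  have "diameter_wrt d \<sigma> \<le> r \<longleftrightarrow> (\<forall>x\<in>\<sigma>. \<forall>y\<in>\<sigma>. d x y \<le> r)" if "finite \<sigma>" "\<sigma> \<noteq> {}"
  proof -
    have "bdd_above ((\<lambda>(x, y). d x y) ` (\<sigma> \<times> \<sigma>))" using that by simp
    then show ?thesis
      unfolding diameter_wrt_def using that by (subst cSUP_le_iff) auto
  qed
  then show ?thesis by (auto simp: rips_complex_def)
qed

section \<open>Marked groups, word metrics and type R\<close>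

definition marked_group :: "('a, 'm) monoid_scheme \<Rightarrow> 'a set \<Rightarrow> bool" where
  "marked_group G S \<longleftrightarrow> group G \<and> finite S \<and> S \<subseteq> carrier G \<and> generate G S = carrier G"

definition word_metric :: "('a, 'm) monoid_scheme \<Rightarrow> 'a set \<Rightarrow> 'a \<Rightarrow> 'a \<Rightarrow> real" where
  "word_metric G S g h =
     (if g = h then 0
      else real (LEAST k. \<exists>ws. length ws = k \<and> set ws \<subseteq> S \<union> (\<lambda>s. inv\<^bsub>G\<^esub> s) ` S \<and>
                   inv\<^bsub>G\<^esub> g \<otimes>\<^bsub>G\<^esub> h = foldr (\<lambda>x y. x \<otimes>\<^bsub>G\<^esub> y) ws \<one>\<^bsub>G\<^esub>))"

definition type_R :: "('a, 'm) monoid_scheme \<Rightarrow> 'a set \<Rightarrow> bool" where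
  "type_R G S \<longleftrightarrow> marked_group G S \<and>
     (\<exists>r0\<ge>0. \<forall>r\<ge>r0.
        contractible_space
          (geometric_realization (rips_complex (carrier G) (word_metric G S) r)))"

section \<open>Amalgamated products\<close>

text \<open>The pushout of groups \<open>A \<leftarrow> C \<rightarrow> B\<close> along \<open>\<phi>\<close> and \<open>\<psi>\<close>, as the quotient of the monoid of words
  in the disjoint union of \<open>A\<close> and \<open>B\<close> by the congruence generated by the multiplication tables
  of the two groups and by the identifications of \<open>\<phi> c\<close> with \<open>\<psi> c\<close>.\<close>

definition amalgam_words ::
  "('a, 'm) monoid_scheme \<Rightarrow> ('b, 'n) monoid_scheme \<Rightarrow> ('a + 'b) list set" where
  "amalgam_words A B = lists (carrier A <+> carrier B)"

inductive amalgam_eq ::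
  "('a, 'm) monoid_scheme \<Rightarrow> ('b, 'n) monoid_scheme \<Rightarrow> ('c, 'k) monoid_scheme \<Rightarrow>
   ('c \<Rightarrow> 'a) \<Rightarrow> ('c \<Rightarrow> 'b) \<Rightarrow> ('a + 'b) list \<Rightarrow> ('a + 'b) list \<Rightarrow> bool"
  for A B C \<phi> \<psi> where
  refl: "u \<in> amalgam_words A B \<Longrightarrow> amalgam_eq A B C \<phi> \<psi> u u"
| sym: "amalgam_eq A B C \<phi> \<psi> u v \<Longrightarrow> amalgam_eq A B C \<phi> \<psi> v u"
| trans: "amalgam_eq A B C \<phi> \<psi> u v \<Longrightarrow> amalgam_eq A B C \<phi> \<psi> v w \<Longrightarrow> amalgam_eq A B C \<phi> \<psi> u w"
| append: "amalgam_eq A B C \<phi> \<psi> u v \<Longrightarrow> amalgam_eq A B C \<phi> \<psi> u' v' \<Longrightarrow>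
           amalgam_eq A B C \<phi> \<psi> (u @ u') (v @ v')"
| mult_left: "a \<in> carrier A \<Longrightarrow> a' \<in> carrier A \<Longrightarrow>
           amalgam_eq A B C \<phi> \<psi> [Inl a, Inl a'] [Inl (a \<otimes>\<^bsub>A\<^esub> a')]"
| one_left: "amalgam_eq A B C \<phi> \<psi> [Inl \<one>\<^bsub>A\<^esub>] []"
| mult_right: "b \<in> carrier B \<Longrightarrow> b' \<in> carrier B \<Longrightarrow>
           amalgam_eq A B C \<phi> \<psi> [Inr b, Inr b'] [Inr (b \<otimes>\<^bsub>B\<^esub> b')]"
| one_right: "amalgam_eq A B C \<phi> \<psi> [Inr \<one>\<^bsub>B\<^esub>] []"
| glue: "c \<in> carrier C \<Longrightarrow> amalgam_eq A B C \<phi> \<psi> [Inl (\<phi> c)] [Inr (\<psi> c)]"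

definition amalgam_class ::
  "('a, 'm) monoid_scheme \<Rightarrow> ('b, 'n) monoid_scheme \<Rightarrow> ('c, 'k) monoid_scheme \<Rightarrow>
   ('c \<Rightarrow> 'a) \<Rightarrow> ('c \<Rightarrow> 'b) \<Rightarrow> ('a + 'b) list \<Rightarrow> ('a + 'b) list set" where
  "amalgam_class A B C \<phi> \<psi> u = {v. amalgam_eq A B C \<phi> \<psi> u v}"

definition amalgam ::
  "('a, 'm) monoid_scheme \<Rightarrow> ('b, 'n) monoid_scheme \<Rightarrow> ('c, 'k) monoid_scheme \<Rightarrow>
   ('c \<Rightarrow> 'a) \<Rightarrow> ('c \<Rightarrow> 'b) \<Rightarrow> ('a + 'b) list set monoid" where
  "amalgam A B C \<phi> \<psi> =
     \<lparr>carrier = amalgam_class A B C \<phi> \<psi> ` amalgam_words A B,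
      mult = (\<lambda>X Y. {w. \<exists>u\<in>X. \<exists>v\<in>Y. amalgam_eq A B C \<phi> \<psi> (u @ v) w}),
      one = amalgam_class A B C \<phi> \<psi> []\<rparr>"

definition amalgam_left ::
  "('a, 'm) monoid_scheme \<Rightarrow> ('b, 'n) monoid_scheme \<Rightarrow> ('c, 'k) monoid_scheme \<Rightarrow>
   ('c \<Rightarrow> 'a) \<Rightarrow> ('c \<Rightarrow> 'b) \<Rightarrow> 'a \<Rightarrow> ('a + 'b) list set" where
  "amalgam_left A B C \<phi> \<psi> a = amalgam_class A B C \<phi> \<psi> [Inl a]"

definition amalgam_right ::
  "('a, 'm) monoid_scheme \<Rightarrow> ('b, 'n) monoid_scheme \<Rightarrow> ('c, 'k) monoid_scheme \<Rightarrow>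
   ('c \<Rightarrow> 'a) \<Rightarrow> ('c \<Rightarrow> 'b) \<Rightarrow> 'b \<Rightarrow> ('a + 'b) list set" where
  "amalgam_right A B C \<phi> \<psi> b = amalgam_class A B C \<phi> \<psi> [Inr b]"

subsection \<open>The amalgamated product is the pushout in the category of groups\<close>

locale amalgam_data =
  A: group A + B: group B + C: group C
  for A :: "('a, 'm) monoid_scheme" and B :: "('b, 'n) monoid_scheme"
    and C :: "('c, 'k) monoid_scheme" +
  fixes \<phi> :: "'c \<Rightarrow> 'a" and \<psi> :: "'c \<Rightarrow> 'b"
  assumes phi_hom: "\<phi> \<in> hom C A" and psi_hom: "\<psi> \<in> hom C B"
begin

abbreviation "W \<equiv> amalgam_words A B"
abbreviation "weq \<equiv> amalgam_eq A B C \<phi> \<psi>"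
abbreviation "cl \<equiv> amalgam_class A B C \<phi> \<psi>"
abbreviation "P \<equiv> amalgam A B C \<phi> \<psi>"
abbreviation "\<iota>A \<equiv> amalgam_left A B C \<phi> \<psi>"
abbreviation "\<iota>B \<equiv> amalgam_right A B C \<phi> \<psi>"

lemma eq_words: "weq u v \<Longrightarrow> u \<in> W \<and> v \<in> W"
proof (induction rule: amalgam_eq.induct)
  case (glue c)
  then show ?case using hom_in_carrier[OF phi_hom] hom_in_carrier[OF psi_hom]
    by (auto simp: amalgam_words_def)
qed (auto simp: amalgam_words_def)

lemma cl_eq: 
  assumes "u \<in> W" shows "cl u = cl v \<longleftrightarrow> weq u v"
proof
  assume "cl u = cl v"
  moreover have "u \<in> cl u" using assms by (simp add: amalgam_class_def amalgam_eq.refl)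
  ultimately have "weq v u" by (simp add: amalgam_class_def)
  then show "weq u v" by (rule amalgam_eq.sym)
next
  assume uv: "weq u v"
  have "weq u w \<longleftrightarrow> weq v w" for w
    using amalgam_eq.trans[OF uv, of w] amalgam_eq.trans[OF amalgam_eq.sym[OF uv], of w] by blast
  then show "cl u = cl v" by (simp add: amalgam_class_def)
qed

lemma cl_mult:
  assumes "u \<in> W" "v \<in> W" shows "cl u \<otimes>\<^bsub>P\<^esub> cl v = cl (u @ v)"
proof -
  have "(\<exists>u'. weq u u' \<and> (\<exists>v'. weq v v' \<and> weq (u' @ v') w)) \<longleftrightarrow> weq (u @ v) w" for w
  proof
    assume "\<exists>u'. weq u u' \<and> (\<exists>v'. weq v v' \<and> weq (u' @ v') w)"
    then obtain u' v' where "weq u u'" "weq v v'" "weq (u' @ v') w" by blast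
    then show "weq (u @ v) w" by (metis amalgam_eq.trans amalgam_eq.append)
  next
    assume "weq (u @ v) w"
    then show "\<exists>u'. weq u u' \<and> (\<exists>v'. weq v v' \<and> weq (u' @ v') w)"
      using assms amalgam_eq.refl by blast
  qed
  then show ?thesis by (simp add: amalgam_class_def amalgam_def)
qed

lemma carrier_P: "carrier P = cl ` W" and one_P: "\<one>\<^bsub>P\<^esub> = cl []"
  by (simp_all add: amalgam_def)

lemma words_simps [simp]: "[] \<in> W" "u @ v \<in> W \<longleftrightarrow> u \<in> W \<and> v \<in> W"
  "Inl a # u \<in> W \<longleftrightarrow> a \<in> carrier A \<and> u \<in> W" "Inr b # u \<in> W \<longleftrightarrow> b \<in> carrier B \<and> u \<in> W"
  by (auto simp: amalgam_words_def)

lemma words_cases: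
  assumes "x # u \<in> W"
  obtains a where "x = Inl a" "a \<in> carrier A" "u \<in> W" | b where "x = Inr b" "b \<in> carrier B" "u \<in> W"
  using assms by (auto simp: amalgam_words_def)

lemma left_inverse:
  assumes "u \<in> W" shows "\<exists>v\<in>W. weq (v @ u) []"
  using assms
proof (induction u)
  case Nil
  then show ?case by (auto intro!: bexI[of _ "[]"] amalgam_eq.refl)
next
  case (Cons x u)
  have step: "\<exists>w\<in>W. weq (w @ x # u) []"
    if y: "[y] \<in> W" and yx: "weq [y, x] []" and u: "u \<in> W" for y
  proof -
    obtain v where v: "v \<in> W" "weq (v @ u) []" using Cons.IH u by blast
    have "weq ([y, x] @ u) ([] @ u)" 
      by (rule amalgam_eq.append[OF yx amalgam_eq.refl[OF u]])
    then have "weq (v @ ([y, x] @ u)) (v @ ([] @ u))"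
      by (rule amalgam_eq.append[OF amalgam_eq.refl[OF v(1)]])
    then have "weq ((v @ [y]) @ x # u) []"
      using amalgam_eq.trans[OF _ v(2)] by simp
    moreover have "v @ [y] \<in> W" using v(1) y by simp
    ultimately show ?thesis by blast
  qed
  from Cons.prems show ?case
  proof (cases rule: words_cases)
    case (1 a)
    have "weq [Inl (inv\<^bsub>A\<^esub> a), Inl a] [Inl (inv\<^bsub>A\<^esub> a \<otimes>\<^bsub>A\<^esub> a)]"
      using 1 by (intro amalgam_eq.mult_left) auto
    then have "weq [Inl (inv\<^bsub>A\<^esub> a), Inl a] []"
      using 1 amalgam_eq.trans[OF _ amalgam_eq.one_left] by simp
    then show ?thesis using 1 step[of "Inl (inv\<^bsub>A\<^esub> a)"] by auto
  next
    case (2 b)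
    have "weq [Inr (inv\<^bsub>B\<^esub> b), Inr b] [Inr (inv\<^bsub>B\<^esub> b \<otimes>\<^bsub>B\<^esub> b)]"
      using 2 by (intro amalgam_eq.mult_right) auto
    then have "weq [Inr (inv\<^bsub>B\<^esub> b), Inr b] []"
      using 2 amalgam_eq.trans[OF _ amalgam_eq.one_right] by simp
    then show ?thesis using 2 step[of "Inr (inv\<^bsub>B\<^esub> b)"] by auto
  qed
qed

theorem group_amalgam: "group P"
proof (rule groupI)
  show "\<exists>y\<in>carrier P. y \<otimes>\<^bsub>P\<^esub> x = \<one>\<^bsub>P\<^esub>" if x: "x \<in> carrier P" for x
  proof -
    obtain u where u: "u \<in> W" "x = cl u" using x by (auto simp: carrier_P)
    obtain v where v: "v \<in> W" "weq (v @ u) []" using left_inverse u by blast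
    then have "cl v \<otimes>\<^bsub>P\<^esub> x = \<one>\<^bsub>P\<^esub>" using u by (simp add: cl_mult one_P cl_eq)
    then show ?thesis using v by (auto simp: carrier_P)
  qed
qed (auto simp: carrier_P one_P cl_mult)

lemma left_hom: "\<iota>A \<in> hom A P"
  by (auto simp: hom_def carrier_P amalgam_left_def cl_mult cl_eq
      intro!: amalgam_eq.sym[OF amalgam_eq.mult_left])

lemma right_hom: "\<iota>B \<in> hom B P"
  by (auto simp: hom_def carrier_P amalgam_right_def cl_mult cl_eq
      intro!: amalgam_eq.sym[OF amalgam_eq.mult_right])

lemma left_right_glue: "c \<in> carrier C \<Longrightarrow> \<iota>A (\<phi> c) = \<iota>B (\<psi> c)"
  using hom_in_carrier[OF phi_hom]
  by (auto simp: amalgam_left_def amalgam_right_def cl_eq intro: amalgam_eq.glue)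

lemma amalgam_generated:
  assumes "generate A S = carrier A" "generate B T = carrier B"
    and "S \<subseteq> carrier A" "T \<subseteq> carrier B"
  shows "generate P (\<iota>A ` S \<union> \<iota>B ` T) = carrier P"
proof -
  interpret P: group P by (rule group_amalgam)
  interpret hA: group_hom A P \<iota>A by unfold_locales (rule left_hom)
  interpret hB: group_hom B P \<iota>B by unfold_locales (rule right_hom)
  let ?U = "\<iota>A ` S \<union> \<iota>B ` T"
  have U: "?U \<subseteq> carrier P" using assms hA.hom_closed hB.hom_closed by blast
  have "\<iota>A ` carrier A = generate P (\<iota>A ` S)" "\<iota>B ` carrier B = generate P (\<iota>B ` T)"
    using hA.generate_img[of S] hB.generate_img[of T] assms by auto
  then have L: "\<iota>A ` carrier A \<subseteq> generate P ?U" "\<iota>B ` carrier B \<subseteq> generate P ?U"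
    using P.mono_generate[of "\<iota>A ` S" ?U] P.mono_generate[of "\<iota>B ` T" ?U] by simp_all
  have "cl u \<in> generate P ?U" if "u \<in> W" for u
    using that
  proof (induction u)
    case Nil
    then show ?case using generate.one[of P ?U] by (simp add: one_P)
  next
    case (Cons x u)
    from Cons.prems show ?case
    proof (cases rule: words_cases)
      case (1 a)
      then have "\<iota>A a \<otimes>\<^bsub>P\<^esub> cl u \<in> generate P ?U"
        using L Cons.IH by (intro generate.eng) auto
      then show ?thesis using 1 by (simp add: amalgam_left_def cl_mult)
    next
      case (2 b)
      then have "\<iota>B b \<otimes>\<^bsub>P\<^esub> cl u \<in> generate P ?U"
        using L Cons.IH by (intro generate.eng) auto
      then show ?thesis using 2 by (simp add: amalgam_right_def cl_mult)
    qed
  qed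
  then show ?thesis using P.generate_incl[OF U] by (auto simp: carrier_P)
qed

theorem amalgam_universal:
  fixes G (structure)
  assumes G: "group G" and f: "f \<in> hom A G" and g: "g \<in> hom B G"
    and fg: "\<And>c. c \<in> carrier C \<Longrightarrow> f (\<phi> c) = g (\<psi> c)"
  shows "\<exists>h\<in>hom P G. (\<forall>a\<in>carrier A. h (\<iota>A a) = f a) \<and> (\<forall>b\<in>carrier B. h (\<iota>B b) = g b) \<and>
           (\<forall>h'\<in>hom P G. (\<forall>a\<in>carrier A. h' (\<iota>A a) = f a) \<longrightarrow> (\<forall>b\<in>carrier B. h' (\<iota>B b) = g b)
              \<longrightarrow> (\<forall>x\<in>carrier P. h' x = h x))"
proof -
  interpret G: group G by fact
  interpret P: group P by (rule group_amalgam)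
  interpret hf: group_hom A G f by unfold_locales (rule f)
  interpret hg: group_hom B G g by unfold_locales (rule g)
  define ev where "ev u = foldr (\<lambda>x y. case_sum f g x \<otimes> y) u \<one>" for u
  have ev_closed: "ev u \<in> carrier G" if "u \<in> W" for u
    using that by (induction u) (auto simp: ev_def elim!: words_cases)
  have ev_append: "ev (u @ v) = ev u \<otimes> ev v" if "u \<in> W" "v \<in> W" for u v
    using that
  proof (induction u)
    case Nil
    then show ?case using ev_closed[of v] by (simp add: ev_def)
  next
    case (Cons x u)
    from Cons.prems(1) show ?case
      using Cons.IH Cons.prems(2) ev_closed[of u] ev_closed[of v]
      by (cases rule: words_cases) (auto simp: ev_def G.m_assoc)
  qed
  have ev_eq: "ev u = ev v" if "weq u v" for u v
    using that
  proof (induction rule: amalgam_eq.induct)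
    case (append u v u' v')
    then show ?case using eq_words by (simp add: ev_append)
  next
    case (glue c)
    then show ?case by (simp add: ev_def fg)
  qed (simp_all add: ev_def)
  define h where "h X = ev (SOME u. u \<in> X)" for X
  have h: "h (cl u) = ev u" if "u \<in> W" for u
  proof -
    have "u \<in> cl u" using that by (simp add: amalgam_class_def amalgam_eq.refl)
    then have "(SOME v. v \<in> cl u) \<in> cl u" by (rule someI)
    then show ?thesis unfolding h_def using ev_eq by (simp add: amalgam_class_def)
  qed
  show ?thesis
  proof (intro bexI conjI ballI impI)
    show "h \<in> hom P G" by (auto simp: hom_def carrier_P h cl_mult ev_closed ev_append)
    show "h (\<iota>A a) = f a" if "a \<in> carrier A" for a
      using that by (simp add: amalgam_left_def h ev_def)
    show "h (\<iota>B b) = g b" if "b \<in> carrier B" for b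
      using that by (simp add: amalgam_right_def h ev_def)
    fix h' x assume h': "h' \<in> hom P G" "\<forall>a\<in>carrier A. h' (\<iota>A a) = f a"
      "\<forall>b\<in>carrier B. h' (\<iota>B b) = g b" and x: "x \<in> carrier P"
    interpret h': group_hom P G h' by unfold_locales (rule h'(1))
    have "h' (cl u) = ev u" if "u \<in> W" for u
      using that
    proof (induction u)
      case Nil
      then show ?case using h'.hom_one by (simp add: one_P ev_def)
    next
      case (Cons x u)
      from Cons.prems show ?case
      proof (cases rule: words_cases)
        case (1 a)
        have "cl (x # u) = \<iota>A a \<otimes>\<^bsub>P\<^esub> cl u" using 1 by (simp add: amalgam_left_def cl_mult)
        moreover have "\<iota>A a \<in> carrier P" "cl u \<in> carrier P"
          using 1 by (auto simp: amalgam_left_def carrier_P)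
        ultimately show ?thesis using 1 Cons.IH h' by (simp add: ev_def)
      next
        case (2 b)
        have "cl (x # u) = \<iota>B b \<otimes>\<^bsub>P\<^esub> cl u" using 2 by (simp add: amalgam_right_def cl_mult)
        moreover have "\<iota>B b \<in> carrier P" "cl u \<in> carrier P"
          using 2 by (auto simp: amalgam_right_def carrier_P)
        ultimately show ?thesis using 2 Cons.IH h' by (simp add: ev_def)
      qed
    qed
    then show "h' x = h x" using x by (auto simp: carrier_P h)
  qed
qed

end

end

theory Submission
  imports Defs
begin

text \<open>The group \<open>G = A *\<^sub>C B\<close> is a tree of left cosets of \<open>A\<close> and \<open>B\<close>, which meet in left cosets of
  \<open>C\<close>.  As every non-trivial element of \<open>C\<close> is a generator of both factors, the cosets of \<open>C\<close> have
  diameter at most 1, and \<open>A\<close> and \<open>B\<close> are isometrically embedded.  Suppose that a coset \<open>g A\<close> is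
  glued to a subtree \<open>X\<close> of cosets along \<open>g C\<close>.  Every path from \<open>X\<close> to \<open>g A\<close> passes through \<open>g C\<close>, so
  a simplex of the Rips complex of \<open>X \<union> g A\<close> (for \<open>r \<ge> 1\<close>) that is contained neither in \<open>X\<close> nor in
  \<open>g A\<close> still spans a simplex together with a fixed point of \<open>g C\<close>.  Hence the Rips complex of
  \<open>X \<union> g A\<close> deforms onto the union of the Rips complexes of \<open>X\<close> and \<open>g A\<close>, whose intersection is
  the single simplex \<open>g C\<close>.  Maps on compact spaces only meet finitely many simplices, so they can be
  contracted in the Rips complex of some finite subtree, and extending a homotopy over one skeleton
  after the other yields a contraction of the Rips complex of \<open>G\<close>.\<close>

section \<open>The weak topology\<close>

text \<open>Contractions for different finite subtrees need not be compatible, so they do not glue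
  to a contraction of the union. The property \<open>compactly_null\<close> avoids this: it concerns
  one compact space at a time, and a map from such a space already lands in a finite stage. It
  becomes a contraction only once, in \<open>compactly_null_imp_contractible\<close>. Its test
  spaces have points of type \<open>real \<times> ('v \<Rightarrow> real)\<close> because the spaces
  to be tested are boundaries of prisms over simplices. Distinct group elements are at distance at
  least 1, while cosets of C have diameter at most 1. A path from \<open>X\<close> to
  \<open>g A\<close> can therefore be diverted to any fixed point of \<open>g C\<close> at no extra
  cost, and the gluing works at the same scale \<open>r\<close> on both sides, without enlarging it.
  The tree itself is never built. An element \<open>x\<close> is placed relative to the edge
  \<open>g C\<close> by the first letter of \<open>inv g \<otimes> x\<close>, which is what
  \<open>half\<close> records. That this letter is well defined comes from an action of the amalgam
  on normal forms.\<close>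

definition abstract_complex :: "'v set set \<Rightarrow> bool" where
  "abstract_complex K \<longleftrightarrow>
     (\<forall>\<sigma>\<in>K. finite \<sigma> \<and> \<sigma> \<noteq> {}) \<and> (\<forall>\<sigma>\<in>K. \<forall>\<tau>. \<tau> \<subseteq> \<sigma> \<longrightarrow> \<tau> \<noteq> {} \<longrightarrow> \<tau> \<in> K)"

definition realization_set :: "'v set set \<Rightarrow> ('v \<Rightarrow> real) set" where
  "realization_set K = (\<Union>\<sigma>\<in>K. geometric_simplex \<sigma>)"

lemma topology_eq_closedinI:
  assumes "\<And>C. closedin X C \<longleftrightarrow> closedin Y C" shows "X = Y"
proof -
  have "topspace X = topspace Y"
    using assms closedin_subset closedin_topspace by (metis subset_antisym)
  then show ?thesis using assms by (simp add: topology_eq openin_closedin_eq)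
qed

section \<open>Barycentric coordinates and supports\<close>

definition support :: "('v \<Rightarrow> real) \<Rightarrow> 'v set" where
  "support \<alpha> = {v. \<alpha> v \<noteq> 0}"

lemma abstract_complexD:
  assumes "abstract_complex K" "\<sigma> \<in> K"
  shows "finite \<sigma>" "\<sigma> \<noteq> {}" "\<And>\<tau>. \<tau> \<subseteq> \<sigma> \<Longrightarrow> \<tau> \<noteq> {} \<Longrightarrow> \<tau> \<in> K"
  using assms unfolding abstract_complex_def by blast+

lemma topspace_realization [simp]: "topspace (geometric_realization K) = realization_set K"
  by (simp add: topspace_geometric_realization realization_set_def)

lemma geometric_simplex_empty [simp]: "geometric_simplex {} = {}"
  by (simp add: geometric_simplex_def)

lemma geometric_simplex_subset_realization_set: "\<sigma> \<in> K \<Longrightarrow> geometric_simplex \<sigma> \<subseteq> realization_set K"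
  by (auto simp: realization_set_def)

lemma realization_mono: "L \<subseteq> K \<Longrightarrow> realization_set L \<subseteq> realization_set K"
  by (auto simp: realization_set_def)

lemma support_subset: "\<alpha> \<in> geometric_simplex \<sigma> \<Longrightarrow> support \<alpha> \<subseteq> \<sigma>"
  by (auto simp: geometric_simplex_def support_def)

lemma support_nonempty: "\<alpha> \<in> geometric_simplex \<sigma> \<Longrightarrow> support \<alpha> \<noteq> {}"
  by (fastforce simp: geometric_simplex_def support_def intro: sum.neutral)

text \<open>Both coordinate sums reduce to the sum over the support, so membership in a closed
  simplex depends only on where the support lies.\<close>

lemma geometric_simplex_superset:
  assumes "\<alpha> \<in> geometric_simplex \<sigma>" "finite \<tau>" "finite \<sigma>" "support \<alpha> \<subseteq> \<tau>"
  shows "\<alpha> \<in> geometric_simplex \<tau>"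
proof -
  have "(\<Sum>v\<in>\<sigma>. \<alpha> v) = (\<Sum>v\<in>support \<alpha>. \<alpha> v)"
    using assms(1,3) support_subset[OF assms(1)]
    by (intro sum.mono_neutral_right) (auto simp: support_def)
  also have "\<dots> = (\<Sum>v\<in>\<tau>. \<alpha> v)"
    using assms by (intro sum.mono_neutral_left) (auto simp: support_def)
  finally show ?thesis
    using assms by (auto simp: geometric_simplex_def support_def)
qed

lemma geometric_simplex_mono:
  "finite \<tau> \<Longrightarrow> \<sigma> \<subseteq> \<tau> \<Longrightarrow> geometric_simplex \<sigma> \<subseteq> geometric_simplex \<tau>"
  by (meson geometric_simplex_superset finite_subset order_trans subsetI support_subset)

lemma geometric_simplex_le1:
  assumes "\<alpha> \<in> geometric_simplex \<sigma>" "finite \<sigma>" shows "\<alpha> v \<le> 1"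
proof (cases "v \<in> \<sigma>")
  case True
  then have "\<alpha> v \<le> (\<Sum>v\<in>\<sigma>. \<alpha> v)"
    using assms by (intro member_le_sum) (auto simp: geometric_simplex_def)
  then show ?thesis using assms by (simp add: geometric_simplex_def)
qed (use assms in \<open>auto simp: geometric_simplex_def\<close>)

text \<open>The support is the simplex that has the point in its interior. It is a non-empty face of
  every simplex through the point and hence belongs to \<open>K\<close>.\<close>

lemma realization_support:
  assumes "abstract_complex K" "\<alpha> \<in> realization_set K"
  shows "support \<alpha> \<in> K" "\<alpha> \<in> geometric_simplex (support \<alpha>)"
proof -
  obtain \<sigma> where s: "\<sigma> \<in> K" "\<alpha> \<in> geometric_simplex \<sigma>" using assms by (auto simp: realization_set_def)
  have "finite \<sigma>" by (rule abstract_complexD[OF assms(1) s(1)])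
  show "support \<alpha> \<in> K"
    using abstract_complexD(3)[OF assms(1) s(1)] support_subset[OF s(2)] support_nonempty[OF s(2)]
    by blast
  then show "\<alpha> \<in> geometric_simplex (support \<alpha>)"
    using geometric_simplex_superset[OF s(2)] \<open>finite \<sigma>\<close> abstract_complexD(1)[OF assms(1)] by blast
qed

lemma finite_faces: "finite \<sigma> \<Longrightarrow> finite {\<tau>\<in>K. \<tau> \<subseteq> \<sigma>}"
  by (rule finite_subset[of _ "Pow \<sigma>"]) auto

text \<open>A simplex has only finitely many faces, so this is a finite union of closed sets. That
  is why subcomplexes are closed in the weak topology.\<close>

lemma realization_Int_simplex:
  assumes "abstract_complex K" "finite \<sigma>"
  shows "realization_set K \<inter> geometric_simplex \<sigma> = (\<Union>\<tau>\<in>{\<tau>\<in>K. \<tau> \<subseteq> \<sigma>}. geometric_simplex \<tau>)"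
proof
  show "realization_set K \<inter> geometric_simplex \<sigma> \<subseteq> (\<Union>\<tau>\<in>{\<tau>\<in>K. \<tau> \<subseteq> \<sigma>}. geometric_simplex \<tau>)"
    using realization_support[OF assms(1)] support_subset by fastforce
  show "(\<Union>\<tau>\<in>{\<tau>\<in>K. \<tau> \<subseteq> \<sigma>}. geometric_simplex \<tau>) \<subseteq> realization_set K \<inter> geometric_simplex \<sigma>"
    using geometric_simplex_mono[OF assms(2)] by (auto simp: realization_set_def)
qed

section \<open>Topology of simplices and subcomplexes\<close>

lemma continuous_on_coordinate [continuous_intros]:
  "continuous_on S (\<lambda>\<alpha>::'v \<Rightarrow> real. \<alpha> v)"
  by (rule continuous_on_product_then_coordinatewise[OF continuous_on_id])

lemma continuous_on_snd_coordinate [continuous_intros]: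
  "continuous_on S (\<lambda>z::'t::topological_space \<times> ('v \<Rightarrow> real). snd z v)"
  by (rule continuous_on_product_then_coordinatewise[OF continuous_on_snd[OF continuous_on_id]])

lemma compact_imp_closed_function:
  fixes S :: "('v \<Rightarrow> real) set"
  assumes "compact S" shows "closed S"
proof -
  have "Hausdorff_space (euclidean :: ('v \<Rightarrow> real) topology)"
    unfolding euclidean_product_topology[symmetric] by (simp add: Hausdorff_space_product_topology)
  then show ?thesis using assms compactin_imp_closedin[of euclidean S] by simp
qed

text \<open>The ambient product may have infinitely many factors, so compactness comes from
  Tychonoff: the simplex is a closed subset of a cube.\<close>

lemma compact_geometric_simplex:
  assumes "finite \<sigma>" shows "compact (geometric_simplex \<sigma>)"
proof -
  have "geometric_simplex \<sigma> =
      (\<Inter>v. {\<alpha>. 0 \<le> \<alpha> v}) \<inter> (\<Inter>v\<in>-\<sigma>. {\<alpha>. \<alpha> v = 0}) \<inter> {\<alpha>. (\<Sum>v\<in>\<sigma>. \<alpha> v) = 1}"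
    by (auto simp: geometric_simplex_def)
  then have cl: "closed (geometric_simplex \<sigma>)"
    by (simp add: closed_Int closed_INT closed_Collect_le closed_Collect_eq
        continuous_on_coordinate continuous_on_sum)
  have "compactin (powertop_real UNIV) (\<Pi>\<^sub>E i\<in>UNIV. {0..1})"
    by (subst compactin_PiE) auto
  then have "compact (\<Pi>\<^sub>E i\<in>(UNIV::'a set). {0..1::real})"
    by (simp add: euclidean_product_topology)
  moreover have "geometric_simplex \<sigma> \<subseteq> (\<Pi>\<^sub>E i\<in>UNIV. {0..1})"
    using geometric_simplex_le1[OF _ assms] by (auto simp: geometric_simplex_def)
  ultimately show ?thesis using cl by (metis compact_Int_closed inf.absorb_iff2)
qed

lemma closed_geometric_simplex: "finite \<sigma> \<Longrightarrow> closed (geometric_simplex \<sigma>)"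
  by (simp add: compact_geometric_simplex compact_imp_closed_function)

text \<open>Simplices are closed in the product topology, so closedness relative to a simplex is
  plain closedness. This form suits the finite unions over faces that occur below.\<close>

lemma closedin_realization:
  assumes "abstract_complex K"
  shows "closedin (geometric_realization K) C \<longleftrightarrow>
     C \<subseteq> realization_set K \<and> (\<forall>\<sigma>\<in>K. closed (C \<inter> geometric_simplex \<sigma>))"
proof -
  have *: "openin (subtopology (powertop_real UNIV) (geometric_simplex \<sigma>))
             ((realization_set K - C) \<inter> geometric_simplex \<sigma>) \<longleftrightarrow> closed (C \<inter> geometric_simplex \<sigma>)"
    if "\<sigma> \<in> K" for \<sigma>
  proof -
    have eq: "(realization_set K - C) \<inter> geometric_simplex \<sigma> = geometric_simplex \<sigma> - C \<inter> geometric_simplex \<sigma>"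
      using geometric_simplex_subset_realization_set[OF that] by auto
    have "closed (C \<inter> geometric_simplex \<sigma>) \<longleftrightarrow> closedin (top_of_set (geometric_simplex \<sigma>)) (C \<inter> geometric_simplex \<sigma>)"
      using closed_geometric_simplex[of \<sigma>] abstract_complexD(1)[OF assms that]
      by (metis closed_subset closedin_closed_trans inf_le2)
    then show ?thesis unfolding eq
      by (simp add: closedin_def euclidean_product_topology)
  qed
  show ?thesis
    unfolding closedin_def topspace_realization openin_geometric_realization
    using * by (auto simp: realization_set_def)
qed

lemma continuous_map_realization_iff:
  "continuous_map (geometric_realization K) Y f \<longleftrightarrow>
     (\<forall>\<sigma>\<in>K. continuous_map (top_of_set (geometric_simplex \<sigma>)) Y f)"
proof -
  have top: "subtopology (powertop_real UNIV) S = top_of_set S" for S :: "('a \<Rightarrow> real) set"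
    by (simp add: euclidean_product_topology)
  have eq: "{x \<in> realization_set K. f x \<in> U} \<inter> geometric_simplex \<sigma> = {x \<in> geometric_simplex \<sigma>. f x \<in> U}"
    if "\<sigma> \<in> K" for \<sigma> U
    using geometric_simplex_subset_realization_set[OF that] by auto
  have "{x \<in> realization_set K. f x \<in> U} \<subseteq> (\<Union>\<sigma>\<in>K. geometric_simplex \<sigma>)" for U
    by (auto simp: realization_set_def)
  then show ?thesis
    unfolding continuous_map topspace_realization openin_geometric_realization top
    using eq by (auto simp: realization_set_def image_subset_iff)
qed

lemma closed_realization_Int_simplex:
  assumes "abstract_complex K" "finite \<sigma>"
  shows "closed (realization_set K \<inter> geometric_simplex \<sigma>)"
  unfolding realization_Int_simplex[OF assms]
  by (rule closed_UN)
    (use assms in \<open>auto simp: finite_faces intro!: closed_geometric_simplex dest: abstract_complexD(1)\<close>)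

text \<open>A set that is closed in every simplex of \<open>L\<close> meets a simplex of
  \<open>K\<close> in finitely many closed pieces, one for each face in \<open>L\<close>; hence it
  is closed in the larger complex as well.\<close>

lemma subtopology_realization:
  assumes K: "abstract_complex K" and L: "abstract_complex L" "L \<subseteq> K"
  shows "geometric_realization L = subtopology (geometric_realization K) (realization_set L)"
    (is "?L = ?R")
proof -
  have LK: "realization_set L \<subseteq> realization_set K" using L by (simp add: realization_mono)
  have clL: "closedin (geometric_realization K) (realization_set L)"
    using closed_realization_Int_simplex[OF L(1)] abstract_complexD(1)[OF K] LK
    by (simp add: closedin_realization[OF K])
  have "closedin ?L C \<longleftrightarrow> closedin ?R C" for C
  proof
    assume C: "closedin ?L C"
    then have CL: "C \<subseteq> realization_set L" and Cs: "\<And>\<sigma>. \<sigma> \<in> L \<Longrightarrow> closed (C \<inter> geometric_simplex \<sigma>)"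
      by (auto simp: closedin_realization[OF L(1)])
    have "closed (C \<inter> geometric_simplex \<sigma>)" if "\<sigma> \<in> K" for \<sigma>
    proof -
      have fin: "finite \<sigma>" by (rule abstract_complexD[OF K that])
      have "C \<inter> geometric_simplex \<sigma> = C \<inter> (realization_set L \<inter> geometric_simplex \<sigma>)" using CL by auto
      also have "\<dots> = (\<Union>\<tau>\<in>{\<tau>\<in>L. \<tau> \<subseteq> \<sigma>}. C \<inter> geometric_simplex \<tau>)"
        unfolding realization_Int_simplex[OF L(1) fin] by auto
      also have "closed \<dots>"
        by (rule closed_UN) (use fin Cs in \<open>auto simp: finite_faces\<close>)
      finally show ?thesis .
    qed
    then have "closedin (geometric_realization K) C"
      using CL LK by (auto simp: closedin_realization[OF K])
    then show "closedin ?R C" using CL by (metis closedin_subtopology inf.absorb_iff1)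
  next
    assume "closedin ?R C"
    then have C: "closedin (geometric_realization K) C" "C \<subseteq> realization_set L"
      using clL closedin_closed_subtopology by blast+
    then show "closedin ?L C"
      using L(2) by (auto simp: closedin_realization[OF K] closedin_realization[OF L(1)])
  qed
  then show ?thesis by (rule topology_eq_closedinI)
qed

lemma subtopology_realization_simplex:
  assumes "abstract_complex K" "\<sigma> \<in> K"
  shows "subtopology (geometric_realization K) (geometric_simplex \<sigma>) = top_of_set (geometric_simplex \<sigma>)"
proof -
  note fin = abstract_complexD(1)[OF assms(1)]
  have "closedin (geometric_realization K) (geometric_simplex \<sigma>)"
    using geometric_simplex_subset_realization_set[OF assms(2)] closed_geometric_simplex fin assms
    by (auto simp: closedin_realization)
  moreover have "closed (geometric_simplex \<sigma>)" using closed_geometric_simplex fin assms by blast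
  moreover have "closedin (geometric_realization K) C \<longleftrightarrow> closed C" if "C \<subseteq> geometric_simplex \<sigma>" for C
  proof
    assume "closedin (geometric_realization K) C"
    then have "closed (C \<inter> geometric_simplex \<sigma>)" using assms by (simp add: closedin_realization)
    then show "closed C" using that by (simp add: inf.absorb1)
  next
    assume "closed C"
    then show "closedin (geometric_realization K) C"
      using geometric_simplex_subset_realization_set[OF assms(2)] closed_geometric_simplex fin assms that
      by (auto simp: closedin_realization)
  qed
  ultimately show ?thesis
    by (intro topology_eq_closedinI) (auto simp: closedin_closed_subtopology)
qed

text \<open>Continuous coordinates do not in general give continuity for the weak topology, but they
  do when the image stays in one simplex. The explicit maps into realizations below are checked
  simplex by simplex in this way.\<close>

lemma continuous_map_into_realization:
  fixes f :: "'t::topological_space \<Rightarrow> 'v \<Rightarrow> real"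
  assumes "abstract_complex K" "\<sigma> \<in> K" "continuous_on S f" "f \<in> S \<rightarrow> geometric_simplex \<sigma>"
  shows "continuous_map (top_of_set S) (geometric_realization K) f"
proof -
  have "continuous_map (top_of_set S) (top_of_set (geometric_simplex \<sigma>)) f"
    using assms by (simp add: continuous_map_in_subtopology image_subset_iff_funcset)
  then show ?thesis
    using subtopology_realization_simplex[OF assms(1,2)] by (metis continuous_map_in_subtopology)
qed

lemma continuous_map_realization_mono:
  assumes "abstract_complex K" "abstract_complex L" "L \<subseteq> K"
    and "continuous_map X (geometric_realization L) f"
  shows "continuous_map X (geometric_realization K) f"
  using assms(4) unfolding subtopology_realization[OF assms(1-3)]
  by (simp add: continuous_map_in_subtopology)

text \<open>By the tube lemma, the product of the weak topology with the unit interval is again the weak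
  topology with respect to the products of simplices with the interval.\<close>

lemma continuous_map_interval_realization:
  assumes K: "abstract_complex K"
    and h: "\<And>\<sigma>. \<sigma> \<in> K \<Longrightarrow> continuous_map (top_of_set ({0..1::real} \<times> geometric_simplex \<sigma>)) Y h"
  shows "continuous_map (prod_topology (top_of_set {0..1}) (geometric_realization K)) Y h"
proof -
  let ?I = "{0..1::real}"
  let ?X = "prod_topology (top_of_set ?I) (geometric_realization K)"
  have maps: "h z \<in> topspace Y" if z: "z \<in> ?I \<times> realization_set K" for z
  proof -
    obtain \<sigma> where "\<sigma> \<in> K" "z \<in> ?I \<times> geometric_simplex \<sigma>"
      using z unfolding realization_set_def by blast
    with h[of \<sigma>] show ?thesis by (auto simp: continuous_map_def)
  qed
  have "openin ?X {z \<in> ?I \<times> realization_set K. h z \<in> U}" if U: "openin Y U" for U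
  proof (subst openin_subopen, intro ballI)
    fix z assume "z \<in> {z \<in> ?I \<times> realization_set K. h z \<in> U}"
    then obtain t x where z: "z = (t, x)" "t \<in> ?I" "x \<in> realization_set K" "h (t, x) \<in> U" by auto
    have open_slice: "openin (top_of_set (?I \<times> geometric_simplex \<sigma>))
        {z \<in> ?I \<times> geometric_simplex \<sigma>. h z \<in> U}" if "\<sigma> \<in> K" for \<sigma>
      using h[OF that] U by (force simp: continuous_map)
    obtain \<sigma>0 where s0: "\<sigma>0 \<in> K" "x \<in> geometric_simplex \<sigma>0" using z by (auto simp: realization_set_def)
    have "continuous_map (top_of_set ?I) Y (h \<circ> (\<lambda>s. (s, x)))"
      by (rule continuous_map_compose[OF _ h[OF s0(1)]])
        (use s0 in \<open>auto simp: continuous_map_in_subtopology intro!: continuous_intros\<close>)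
    then have "openin (top_of_set ?I) {s \<in> ?I. h (s, x) \<in> U}"
      using U by (force simp: continuous_map)
    then obtain e where e: "e > 0" "\<And>s. s \<in> ?I \<Longrightarrow> dist s t < e \<Longrightarrow> h (s, x) \<in> U"
      using z unfolding openin_euclidean_subtopology_iff by auto
    \<comment> \<open>Halving the radius leaves a compact interval on which \<open>h (s, x)\<close>
      is still in \<open>U\<close>. Within a simplex, the points that fail for some \<open>s\<close>
      in \<open>J\<close> form a projection of a compact set, hence a closed set.\<close>
    define J where "J = ?I \<inter> cball t (e / 2)"
    have J: "compact J" "J \<subseteq> ?I" by (auto simp: J_def intro: closed_Int_compact)
    define V where "V = {y \<in> realization_set K. \<forall>s\<in>J. h (s, y) \<in> U}"
    have "closedin (geometric_realization K) (realization_set K - V)"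
      unfolding closedin_realization[OF K]
    proof (intro conjI ballI)
      fix \<sigma> assume s: "\<sigma> \<in> K"
      have fin: "finite \<sigma>" by (rule abstract_complexD[OF K s])
      let ?S = "geometric_simplex \<sigma>"
      have eq: "(realization_set K - V) \<inter> ?S =
          snd ` ((J \<times> ?S) \<inter> (?I \<times> ?S - {z \<in> ?I \<times> ?S. h z \<in> U}))" (is "?l = snd ` ?r")
      proof
        show "?l \<subseteq> snd ` ?r"
        proof
          fix y assume "y \<in> ?l"
          then obtain s where "s \<in> J" "h (s, y) \<notin> U" "y \<in> ?S" by (auto simp: V_def)
          then have "(s, y) \<in> ?r" using J(2) by auto
          then show "y \<in> snd ` ?r" by force
        qed
        show "snd ` ?r \<subseteq> ?l"
          using geometric_simplex_subset_realization_set[OF s] by (auto simp: V_def)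
      qed
      have "closedin (top_of_set (?I \<times> ?S)) (?I \<times> ?S - {z \<in> ?I \<times> ?S. h z \<in> U})"
        using open_slice[OF s] by (metis (no_types, lifting) openin_closedin_eq topspace_euclidean_subtopology)
      moreover have "closed (?I \<times> ?S)"
        using closed_geometric_simplex[OF fin] by (intro closed_Times) auto
      ultimately have "closed (?I \<times> ?S - {z \<in> ?I \<times> ?S. h z \<in> U})"
        using closedin_closed_trans by blast
      then have "compact ?r"
        using J(1) compact_geometric_simplex[OF fin] by (intro compact_Int_closed compact_Times)
      then have "compact (snd ` ?r)"
        by (rule compact_continuous_image[OF continuous_on_snd[OF continuous_on_id]])
      then show "closed ((realization_set K - V) \<inter> ?S)" unfolding eq by (rule compact_imp_closed_function)
    qed auto
    then have V: "openin (geometric_realization K) V"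
      by (auto simp: openin_closedin_eq V_def)
    have "openin (top_of_set ?I) (?I \<inter> ball t (e / 2))" by (simp add: openin_open_Int)
    then have "openin ?X ((?I \<inter> ball t (e / 2)) \<times> V)" using V by (simp add: openin_prod_Times_iff)
    moreover have "z \<in> (?I \<inter> ball t (e / 2)) \<times> V"
      using z e by (auto simp: V_def J_def dist_commute)
    moreover have "(?I \<inter> ball t (e / 2)) \<times> V \<subseteq> {z \<in> ?I \<times> realization_set K. h z \<in> U}"
      by (auto simp: V_def J_def)
    ultimately show "\<exists>T. openin ?X T \<and> z \<in> T \<and> T \<subseteq> {z \<in> ?I \<times> realization_set K. h z \<in> U}" by blast
  qed
  then show ?thesis using maps by (force simp: continuous_map)
qed

text \<open>Choose a point of \<open>C\<close> in every open simplex that meets \<open>C\<close>: every subset of the set of these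
  points is closed.\<close>

lemma compactin_realization_finite:
  assumes K: "abstract_complex K" and C: "compactin (geometric_realization K) C"
  obtains F where "finite F" "F \<subseteq> K" "C \<subseteq> realization_set F"
proof -
  define F where "F = support ` C"
  have CK: "C \<subseteq> realization_set K" using compactin_subset_topspace[OF C] by simp
  have FK: "F \<subseteq> K" using realization_support[OF K] CK by (auto simp: F_def)
  have CF: "C \<subseteq> realization_set F"
    using realization_support[OF K] CK by (force simp: F_def realization_set_def)
  define pt where "pt \<sigma> = (SOME \<alpha>. \<alpha> \<in> C \<and> support \<alpha> = \<sigma>)" for \<sigma>
  have pt: "pt \<sigma> \<in> C \<and> support (pt \<sigma>) = \<sigma>" if "\<sigma> \<in> F" for \<sigma>
  proof -
    have "\<exists>\<alpha>. \<alpha> \<in> C \<and> support \<alpha> = \<sigma>" using that by (auto simp: F_def)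
    then show ?thesis unfolding pt_def by (rule someI_ex)
  qed
  have closed: "closedin (geometric_realization K) (pt ` E)" if "E \<subseteq> F" for E
    unfolding closedin_realization[OF K]
  proof (intro conjI ballI)
    show "pt ` E \<subseteq> realization_set K" using pt that CK by blast
    fix \<sigma> assume s: "\<sigma> \<in> K"
    \<comment> \<open>The support of \<open>pt \<tau>\<close> is \<open>\<tau>\<close>, so a chosen
      point in this simplex comes from one of its finitely many faces.\<close>
    have "pt ` E \<inter> geometric_simplex \<sigma> \<subseteq> pt ` Pow \<sigma>"
      using pt that support_subset by blast
    then have "finite (pt ` E \<inter> geometric_simplex \<sigma>)"
      using abstract_complexD(1)[OF K s] by (meson finite_Pow_iff finite_imageI finite_subset)
    then show "closed (pt ` E \<inter> geometric_simplex \<sigma>)" by (intro compact_imp_closed_function finite_imp_compact)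
  qed
  \<comment> \<open>The member for \<open>\<sigma>\<close> contains no chosen point except
    \<open>pt \<sigma>\<close>, so a subcover of \<open>C\<close> has to mention every simplex of
    \<open>F\<close>.\<close>
  define \<U> where "\<U> = (\<lambda>\<sigma>. realization_set K - pt ` (F - {\<sigma>})) ` F"
  have "openin (geometric_realization K) U" if "U \<in> \<U>" for U
    using that openin_diff[OF openin_topspace closed[OF Diff_subset]] by (auto simp: \<U>_def)
  moreover have "C \<subseteq> \<Union>\<U>"
  proof
    fix x assume x: "x \<in> C"
    then have "support x \<in> F" by (simp add: F_def)
    moreover have "x \<notin> pt ` (F - {support x})" using pt by auto
    ultimately show "x \<in> \<Union>\<U>" using x CK by (auto simp: \<U>_def)
  qed
  ultimately obtain \<V> where V: "finite \<V>" "\<V> \<subseteq> \<U>" "C \<subseteq> \<Union>\<V>"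
    using C unfolding compactin_def by meson
  then obtain E where E: "E \<subseteq> F" "finite E" "\<V> = (\<lambda>\<sigma>. realization_set K - pt ` (F - {\<sigma>})) ` E"
    unfolding \<U>_def by (meson finite_subset_image)
  have "F \<subseteq> E"
  proof
    fix \<sigma> assume s: "\<sigma> \<in> F"
    then have "pt \<sigma> \<in> \<Union>\<V>" using pt V(3) by blast
    then obtain \<tau> where "\<tau> \<in> E" "pt \<sigma> \<notin> pt ` (F - {\<tau>})" using E by auto
    then show "\<sigma> \<in> E" using s by auto
  qed
  then have "finite F" using E finite_subset by blast
  then show ?thesis using that FK CF by blast
qed

section \<open>Homotopies relative to a subcomplex\<close>

lemma Hausdorff_space_function: "Hausdorff_space (euclidean :: ('v \<Rightarrow> real) topology)"
  unfolding euclidean_product_topology[symmetric] by (simp add: Hausdorff_space_product_topology)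

lemma prod_topology_top_of_set: "prod_topology (top_of_set S) (top_of_set T) = top_of_set (S \<times> T)"
  by (metis prod_topology_euclidean subtopology_Times)

text \<open>Maps on compact spaces suffice to fill the boundaries of prisms over simplices, and unlike
  contractibility this property passes to directed unions of complexes.\<close>

definition compactly_null :: "('v \<Rightarrow> real) topology \<Rightarrow> bool" where
  "compactly_null X \<longleftrightarrow>
     (\<forall>(Z :: (real \<times> ('v \<Rightarrow> real)) topology) f. compact_space Z \<longrightarrow> continuous_map Z X f \<longrightarrow>
        (\<exists>c. homotopic_with (\<lambda>_. True) Z X f (\<lambda>_. c)))"

definition prism :: "'v set \<Rightarrow> (real \<times> ('v \<Rightarrow> real)) set" where
  "prism \<sigma> = {0..1} \<times> geometric_simplex \<sigma>"

definition prism_boundary :: "'v set \<Rightarrow> (real \<times> ('v \<Rightarrow> real)) set" where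
  "prism_boundary \<sigma> = {z \<in> prism \<sigma>. fst z = 0 \<or> fst z = 1 \<or> (\<exists>v\<in>\<sigma>. snd z v = 0)}"

lemma compact_prism: "finite \<sigma> \<Longrightarrow> compact (prism \<sigma>)"
  unfolding prism_def by (intro compact_Times compact_geometric_simplex) auto

lemma compact_prism_boundary:
  assumes "finite \<sigma>" shows "compact (prism_boundary \<sigma>)"
proof -
  have eq: "prism_boundary \<sigma> =
      prism \<sigma> \<inter> ({z. fst z = 0} \<union> {z. fst z = 1} \<union> (\<Union>v\<in>\<sigma>. {z. snd z v = 0}))"
    by (auto simp: prism_boundary_def)
  show ?thesis
    unfolding eq using assms
    by (intro compact_Int_closed compact_prism closed_Un closed_UN closed_Collect_eq ballI
        continuous_intros) auto
qed

text \<open>The prism is a cone over its boundary: the function \<open>\<Lambda>\<close> is the gauge of the prism with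
  respect to its barycentre.\<close>

lemma prism_cone_quotient:
  fixes \<sigma> :: "'v set"
  assumes fin: "finite \<sigma>" and ne: "\<sigma> \<noteq> {}"
  shows "\<exists>Q :: real \<times> real \<times> ('v \<Rightarrow> real) \<Rightarrow> real \<times> ('v \<Rightarrow> real).
    quotient_map (top_of_set ({0..1} \<times> prism_boundary \<sigma>)) (top_of_set (prism \<sigma>)) Q \<and>
    (\<forall>z. Q (0, z) = z) \<and>
    (\<forall>s\<in>{0..1}. \<forall>s'\<in>{0..1}. \<forall>z\<in>prism_boundary \<sigma>. \<forall>z'\<in>prism_boundary \<sigma>.
       Q (s, z) = Q (s', z') \<longrightarrow> s = s' \<and> (s = 1 \<or> z = z'))"
proof -
  define n where "n = real (card \<sigma>)"
  have n: "n > 0" using assms by (simp add: n_def card_gt_0_iff)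
  define b where "b v = (if v \<in> \<sigma> then 1 / n else 0)" for v
  have sumb: "(\<Sum>v\<in>\<sigma>. b v) = 1" using n by (simp add: b_def n_def)
  \<comment> \<open>\<open>Q (s, z)\<close> moves \<open>z\<close> along the segment to the centre
    \<open>(1/2, b)\<close>, reached at \<open>s = 1\<close>.\<close>
  define Q :: "real \<times> real \<times> ('v \<Rightarrow> real) \<Rightarrow> real \<times> ('v \<Rightarrow> real)"
    where "Q w = ((1 - fst w) * fst (snd w) + fst w / 2,
                  \<lambda>v. (1 - fst w) * snd (snd w) v + fst w * b v)" for w
  \<comment> \<open>Each entry is 0 at the centre and is multiplied by \<open>1 - s\<close> along
    the segments towards it. On the prism it is at most 1, with equality exactly when
    \<open>fst z\<close> is 0 or 1, or when \<open>snd z v = 0\<close>, respectively.\<close>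
  let ?A = "\<lambda>z. insert \<bar>2 * fst z - 1\<bar> ((\<lambda>v. 1 - n * snd z v) ` \<sigma>)"
  define \<Lambda> :: "real \<times> ('v \<Rightarrow> real) \<Rightarrow> real" where "\<Lambda> z = Max (?A z)" for z
  have \<Lambda>_ge: "\<bar>2 * fst z - 1\<bar> \<le> \<Lambda> z" "v \<in> \<sigma> \<Longrightarrow> 1 - n * snd z v \<le> \<Lambda> z" for z v
    using fin unfolding \<Lambda>_def by (auto intro!: Max_ge)
  have \<Lambda>_in: "\<Lambda> z \<in> ?A z" for z
    unfolding \<Lambda>_def using fin by (intro Max_in) auto
  have \<Lambda>_le: "\<Lambda> z \<le> 1" if "z \<in> prism \<sigma>" for z
    using that fin n by (auto simp: \<Lambda>_def prism_def geometric_simplex_def)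
  have \<Lambda>_boundary: "\<Lambda> z = 1" if z: "z \<in> prism_boundary \<sigma>" for z
  proof (rule antisym)
    show "\<Lambda> z \<le> 1" using \<Lambda>_le z by (auto simp: prism_boundary_def)
    show "1 \<le> \<Lambda> z" using z \<Lambda>_ge(1)[of z] \<Lambda>_ge(2)[of _ z] by (force simp: prism_boundary_def)
  qed
  have \<Lambda>_Q: "\<Lambda> (Q (s, z)) = 1 - s" if "s \<in> {0..1}" "z \<in> prism_boundary \<sigma>" for s z
  proof -
    have "2 * fst (Q (s, z)) - 1 = (1 - s) * (2 * fst z - 1)"
      by (simp add: Q_def field_simps)
    then have 1: "\<bar>2 * fst (Q (s, z)) - 1\<bar> = (1 - s) * \<bar>2 * fst z - 1\<bar>"
      using that(1) by (simp add: abs_mult)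
    have 2: "1 - n * snd (Q (s, z)) v = (1 - s) * (1 - n * snd z v)" if "v \<in> \<sigma>" for v
      using that n by (simp add: Q_def b_def field_simps)
    have "?A (Q (s, z)) = (\<lambda>x. (1 - s) * x) ` ?A z"
      using 1 2 by (simp add: image_image)
    moreover have "mono (\<lambda>x. (1 - s) * x)" using that(1) by (auto intro!: monoI mult_left_mono)
    ultimately have "\<Lambda> (Q (s, z)) = (1 - s) * \<Lambda> z"
      unfolding \<Lambda>_def using mono_Max_commute[of "\<lambda>x. (1 - s) * x" "?A z"] fin by simp
    then show ?thesis using \<Lambda>_boundary that by simp
  qed
  have Q_prism: "Q (s, z) \<in> prism \<sigma>" if "s \<in> {0..1}" "z \<in> prism \<sigma>" for s z
  proof -
    obtain t \<alpha> where z: "z = (t, \<alpha>)" "t \<in> {0..1}" "\<alpha> \<in> geometric_simplex \<sigma>"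
      using \<open>z \<in> prism \<sigma>\<close> by (auto simp: prism_def)
    have "(1 - s) * t \<le> (1 - s) * 1" using that(1) z by (intro mult_left_mono) auto
    then have "(1 - s) * t + s / 2 \<in> {0..1}" using that(1) z by auto
    moreover have "(\<lambda>v. (1 - s) * \<alpha> v + s * b v) \<in> geometric_simplex \<sigma>"
      using z that(1) n sumb
      by (auto simp: geometric_simplex_def b_def sum.distrib simp flip: sum_distrib_left)
    ultimately show ?thesis by (simp add: Q_def prism_def z)
  qed
  have Q_surj: "\<exists>s\<in>{0..1}. \<exists>z\<in>prism_boundary \<sigma>. w = Q (s, z)" if w: "w \<in> prism \<sigma>" for w
  proof -
    obtain t \<alpha> where ta: "w = (t, \<alpha>)" "t \<in> {0..1}" "\<alpha> \<in> geometric_simplex \<sigma>"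
      using w by (auto simp: prism_def)
    have \<alpha>: "\<And>v. 0 \<le> \<alpha> v" "\<And>v. v \<notin> \<sigma> \<Longrightarrow> \<alpha> v = 0" "(\<Sum>v\<in>\<sigma>. \<alpha> v) = 1"
      using ta by (auto simp: geometric_simplex_def)
    define l where "l = \<Lambda> w"
    have l1: "l \<le> 1" using \<Lambda>_le[OF w] by (simp add: l_def)
    have l_t: "\<bar>2 * t - 1\<bar> \<le> l" and l_v: "\<And>v. v \<in> \<sigma> \<Longrightarrow> 1 - n * \<alpha> v \<le> l"
      using \<Lambda>_ge[where z = w] ta by (auto simp: l_def)
    have l0: "0 \<le> l" using l_t by linarith
    show ?thesis
    proof (cases "l = 0")
      case True
      then have t: "t = 1 / 2" using l_t by auto
      have nonneg: "\<And>v. v \<in> \<sigma> \<Longrightarrow> 0 \<le> \<alpha> v - b v"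
        using l_v True n by (simp add: b_def field_simps)
      have "(\<Sum>v\<in>\<sigma>. \<alpha> v - b v) = 0" using \<alpha> sumb by (simp add: sum_subtractf)
      then have "\<alpha> v = b v" for v
        using sum_nonneg_eq_0_iff[OF fin nonneg] \<alpha>(2)[of v] by (cases "v \<in> \<sigma>") (auto simp: b_def)
      then have "\<alpha> = b" by blast
      \<comment> \<open>All boundary points are sent to the centre at \<open>s = 1\<close>;
        \<open>(0, \<alpha>)\<close> is one that is at hand.\<close>
      then have "w = Q (1, (0, \<alpha>))" using t ta by (simp add: Q_def)
      moreover have "(0, \<alpha>) \<in> prism_boundary \<sigma>" using ta by (simp add: prism_boundary_def prism_def)
      ultimately show ?thesis by (intro bexI[of _ 1] bexI[of _ "(0, \<alpha>)"]) auto
    next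
      case False
      then have lpos: "l > 0" using l0 by simp
      \<comment> \<open>The displacement of \<open>w\<close> from the centre is stretched by
        \<open>1 / l\<close>; in particular \<open>\<alpha>'\<close> is
        \<open>b + (\<alpha> - b) / l\<close>. The largest entry of \<open>?A\<close> thereby
        becomes 1, which puts the point on the boundary.\<close>
      define t' where "t' = 1 / 2 + (t - 1 / 2) / l"
      define \<alpha>' where "\<alpha>' v = (\<alpha> v - (1 - l) * b v) / l" for v
      have "\<bar>(t - 1 / 2) / l\<bar> \<le> 1 / 2" using l_t lpos by (simp add: field_simps)
      then have t': "t' \<in> {0..1}" unfolding t'_def atLeastAtMost_iff abs_le_iff by linarith
      have "0 \<le> \<alpha>' v" for v
        using l_v[of v] \<alpha>(1)[of v] lpos n by (auto simp: \<alpha>'_def b_def field_simps)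
      moreover have "(\<Sum>v\<in>\<sigma>. \<alpha>' v) = 1"
        using lpos \<alpha> sumb
        by (simp add: \<alpha>'_def sum_subtractf flip: sum_divide_distrib sum_distrib_left)
      moreover have "\<alpha>' v = 0" if "v \<notin> \<sigma>" for v using that \<alpha> by (simp add: \<alpha>'_def b_def)
      ultimately have a': "\<alpha>' \<in> geometric_simplex \<sigma>" by (simp add: geometric_simplex_def)
      have "l = \<bar>2 * t - 1\<bar> \<or> (\<exists>v\<in>\<sigma>. l = 1 - n * \<alpha> v)"
        using \<Lambda>_in[of w] ta by (auto simp: l_def)
      then have "t' = 0 \<or> t' = 1 \<or> (\<exists>v\<in>\<sigma>. \<alpha>' v = 0)"
      proof
        assume "l = \<bar>2 * t - 1\<bar>"
        then have "l = 2 * t - 1 \<or> l = 1 - 2 * t" by linarith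
        then have "t - 1 / 2 = l / 2 \<or> t - 1 / 2 = - l / 2" by linarith
        then have "(t - 1 / 2) / l = 1 / 2 \<or> (t - 1 / 2) / l = - (1 / 2)"
          using lpos by (elim disjE) simp_all
        then have "t' = 0 \<or> t' = 1" unfolding t'_def by linarith
        then show ?thesis by blast
      next
        assume "\<exists>v\<in>\<sigma>. l = 1 - n * \<alpha> v"
        then obtain v where "v \<in> \<sigma>" "l = 1 - n * \<alpha> v" by blast
        then have "\<alpha>' v = 0" using n by (simp add: \<alpha>'_def b_def)
        then show ?thesis using \<open>v \<in> \<sigma>\<close> by blast
      qed
      then have "(t', \<alpha>') \<in> prism_boundary \<sigma>" using t' a' by (simp add: prism_boundary_def prism_def)
      moreover have "w = Q (1 - l, (t', \<alpha>'))"
        using lpos by (simp add: Q_def ta t'_def \<alpha>'_def field_simps)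
      ultimately show ?thesis using l0 l1 by (intro bexI[of _ "1 - l"] bexI[of _ "(t', \<alpha>')"]) auto
    qed
  qed
  have "quotient_map (top_of_set ({0..1} \<times> prism_boundary \<sigma>)) (top_of_set (prism \<sigma>)) Q"
  proof (rule T1_Spaces.continuous_imp_quotient_map)
    have coord: "continuous_on S (\<lambda>w::real \<times> real \<times> ('v \<Rightarrow> real). snd (snd w) v)" for S v
      by (rule continuous_on_product_then_coordinatewise) (intro continuous_intros)
    have "continuous_on ({0..1} \<times> prism_boundary \<sigma>) Q"
      unfolding Q_def
      by (intro continuous_on_Pair continuous_on_coordinatewise_then_product continuous_intros coord) auto
    then show "continuous_map (top_of_set ({0..1} \<times> prism_boundary \<sigma>)) (top_of_set (prism \<sigma>)) Q"
      using Q_prism by (auto simp: continuous_map_in_subtopology prism_boundary_def)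
    show "compact_space (top_of_set ({0..1::real} \<times> prism_boundary \<sigma>))"
      using compact_prism_boundary[OF fin] by (intro compact_space_subtopology) (simp add: compact_Times)
    have "Hausdorff_space (euclidean :: (real \<times> ('v \<Rightarrow> real)) topology)"
      using Hausdorff_space_function[where ?'v = 'v]
      unfolding prod_topology_euclidean[symmetric] Hausdorff_space_prod_topology by simp
    then show "Hausdorff_space (top_of_set (prism \<sigma>))" by (rule Hausdorff_space_subtopology)
    show "Q ` topspace (top_of_set ({0..1} \<times> prism_boundary \<sigma>)) = topspace (top_of_set (prism \<sigma>))"
      using Q_prism Q_surj by (fastforce simp: prism_boundary_def)
  qed
  moreover have "Q (0, z) = z" for z by (simp add: Q_def)
  moreover have "s = s' \<and> (s = 1 \<or> z = z')"
    if "s \<in> {0..1}" "s' \<in> {0..1}" "z \<in> prism_boundary \<sigma>" "z' \<in> prism_boundary \<sigma>" "Q (s, z) = Q (s', z')"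
    for s s' z z'
  proof -
    \<comment> \<open>The gauge recovers the parameter, and for \<open>s \<noteq> 1\<close> the
      factor \<open>1 - s\<close> cancels.\<close>
    have s: "s = s'" using \<Lambda>_Q[of s z] \<Lambda>_Q[of s' z'] that by simp
    have "z = z'" if "s \<noteq> 1"
    proof (rule prod_eqI)
      show "fst z = fst z'" using \<open>Q (s, z) = Q (s', z')\<close> s that by (simp add: Q_def)
      show "snd z = snd z'"
        using \<open>Q (s, z) = Q (s', z')\<close> s that by (auto simp: Q_def fun_eq_iff)
    qed
    then show ?thesis using s by blast
  qed
  ultimately show ?thesis by blast
qed

text \<open>A null-homotopy of \<open>f\<close> is a map on the cylinder over the prism boundary
  that is constant at the end 1. The fibres of \<open>Q\<close> are points except over the centre,
  so the homotopy descends to the prism, and \<open>Q (0, z) = z\<close> makes the result extend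
  \<open>f\<close>.\<close>

lemma prism_extension:
  fixes \<sigma> :: "'v set" and Y :: "('v \<Rightarrow> real) topology"
  assumes fin: "finite \<sigma>" and ne: "\<sigma> \<noteq> {}" and Y: "compactly_null Y"
    and f: "continuous_map (top_of_set (prism_boundary \<sigma>)) Y f"
  obtains g where "continuous_map (top_of_set (prism \<sigma>)) Y g"
    and "\<And>z. z \<in> prism_boundary \<sigma> \<Longrightarrow> g z = f z"
proof -
  let ?B = "prism_boundary \<sigma>"
  obtain Q where Q: "quotient_map (top_of_set ({0..1::real} \<times> ?B)) (top_of_set (prism \<sigma>)) Q"
    "\<forall>z. Q (0, z) = z"
    "\<forall>s\<in>{0..1}. \<forall>s'\<in>{0..1}. \<forall>z\<in>?B. \<forall>z'\<in>?B. Q (s, z) = Q (s', z') \<longrightarrow> s = s' \<and> (s = 1 \<or> z = z')"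
    using prism_cone_quotient[OF fin ne] by blast
  have "compact_space (top_of_set ?B)"
    using compact_prism_boundary[OF fin] by (intro compact_space_subtopology) simp
  then obtain c where "homotopic_with (\<lambda>_. True) (top_of_set ?B) Y f (\<lambda>_. c)"
    using Y f unfolding compactly_null_def by blast
  then obtain h where h: "continuous_map (prod_topology (top_of_set {0..1}) (top_of_set ?B)) Y h"
    "\<And>z. h (0::real, z) = f z" "\<And>z. h (1, z) = c"
    unfolding homotopic_with_def by blast
  have eq: "h w = h w'" if "w \<in> {0..1} \<times> ?B" "w' \<in> {0..1} \<times> ?B" "Q w = Q w'" for w w'
  proof -
    have "fst w = fst w' \<and> (fst w = 1 \<or> snd w = snd w')"
      using Q(3)[rule_format, of "fst w" "fst w'" "snd w" "snd w'"] that by (auto simp: mem_Times_iff)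
    then show ?thesis using h(3) by (metis prod.collapse)
  qed
  obtain g where g: "continuous_map (top_of_set (prism \<sigma>)) Y g"
    "\<And>w. w \<in> {0..1} \<times> ?B \<Longrightarrow> g (Q w) = h w"
    using quotient_map_lift_exists[OF Q(1), of Y h] h(1) eq
    unfolding prod_topology_top_of_set topspace_euclidean_subtopology by metis
  have "g z = f z" if "z \<in> ?B" for z
    using g(2)[of "(0, z)"] Q(2) h(2) that by simp
  then show ?thesis using that g by blast
qed

lemma continuous_map_prism_snd:
  assumes "continuous_map (top_of_set (geometric_simplex \<sigma>)) Y p" "S \<subseteq> UNIV \<times> geometric_simplex \<sigma>"
  shows "continuous_map (top_of_set S) Y (\<lambda>z. p (snd z))"
proof -
  have "continuous_map (top_of_set S) (top_of_set (geometric_simplex \<sigma>)) snd"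
    using assms(2) by (auto simp: continuous_map_in_subtopology intro: continuous_on_snd continuous_on_id)
  from continuous_map_compose[OF this assms(1)] show ?thesis by (simp add: o_def)
qed

text \<open>The homotopy is extended over one skeleton after the other: \<open>Hs n\<close> matters only on the
  simplices with at most \<open>n\<close> vertices.\<close>

proposition homotopy_rel_subcomplex:
  fixes K :: "'v set set" and Y :: "('v \<Rightarrow> real) topology"
  assumes K: "abstract_complex K" and L: "abstract_complex L" "L \<subseteq> K" and Y: "compactly_null Y"
    and p: "continuous_map (geometric_realization K) Y p"
    and q: "continuous_map (geometric_realization K) Y q"
    and pq: "\<And>x. x \<in> realization_set L \<Longrightarrow> p x = q x"
  obtains H where "continuous_map (prod_topology (top_of_set {0..1::real}) (geometric_realization K)) Y H"
    and "\<And>x. x \<in> realization_set K \<Longrightarrow> H (0, x) = p x"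
    and "\<And>x. x \<in> realization_set K \<Longrightarrow> H (1, x) = q x"
    and "\<And>t x. t \<in> {0..1} \<Longrightarrow> x \<in> realization_set L \<Longrightarrow> H (t, x) = p x"
proof -
  define P where "P n H \<longleftrightarrow>
      (\<forall>\<sigma>\<in>K. card \<sigma> \<le> n \<longrightarrow> continuous_map (top_of_set (prism \<sigma>)) Y H) \<and>
      (\<forall>x\<in>realization_set K. card (support x) \<le> n \<longrightarrow> H (0, x) = p x \<and> H (1, x) = q x \<and>
        (x \<in> realization_set L \<longrightarrow> (\<forall>t\<in>{0..1}. H (t, x) = p x)))"
    for n :: nat and H :: "real \<times> ('v \<Rightarrow> real) \<Rightarrow> 'v \<Rightarrow> real"
  \<comment> \<open>A later stage must leave the smaller supports alone; otherwise the stages would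
    have no limit.\<close>
  define R where "R n H H' \<longleftrightarrow> (\<forall>t x. card (support x) \<le> n \<longrightarrow> H' (t, x) = H (t, x))"
    for n :: nat and H H' :: "real \<times> ('v \<Rightarrow> real) \<Rightarrow> 'v \<Rightarrow> real"
  have psimplex: "continuous_map (top_of_set (geometric_simplex \<sigma>)) Y p"
    "continuous_map (top_of_set (geometric_simplex \<sigma>)) Y q" if "\<sigma> \<in> K" for \<sigma>
    using p q that by (auto simp: continuous_map_realization_iff)
  have face: "card (support x) \<le> n"
    if "card \<sigma> = Suc n" "x \<in> geometric_simplex \<sigma>" "finite \<sigma>" "support x \<noteq> \<sigma>"
    for x :: "'v \<Rightarrow> real" and \<sigma> n
  proof -
    have "support x \<subset> \<sigma>" using support_subset[OF that(2)] that(4) by blast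
    from psubset_card_mono[OF that(3) this] show ?thesis using that(1) by simp
  qed
  have step: "\<exists>g. continuous_map (top_of_set (prism \<sigma>)) Y g \<and>
        (\<forall>x\<in>geometric_simplex \<sigma>. g (0, x) = p x \<and> g (1, x) = q x) \<and>
        (\<forall>t\<in>{0..1}. \<forall>x\<in>geometric_simplex \<sigma>. support x \<noteq> \<sigma> \<longrightarrow> g (t, x) = H (t, x)) \<and>
        (\<sigma> \<in> L \<longrightarrow> (\<forall>z\<in>prism \<sigma>. g z = p (snd z)))"
    if PH: "P n H" and s: "\<sigma> \<in> K" "card \<sigma> = Suc n" for n H \<sigma>
  proof -
    have fin: "finite \<sigma>" "\<sigma> \<noteq> {}" using abstract_complexD(1,2)[OF K s(1)] by auto
    have xK: "x \<in> realization_set K" if "x \<in> geometric_simplex \<sigma>" for x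
      using that s(1) by (auto simp: realization_set_def)
    have H_face: "H (0, x) = p x" "H (1, x) = q x"
      "x \<in> realization_set L \<Longrightarrow> t \<in> {0..1} \<Longrightarrow> H (t, x) = p x"
      if "x \<in> geometric_simplex \<sigma>" "support x \<noteq> \<sigma>" for t x
      using PH xK[OF that(1)] face[OF s(2) that(1) fin(1) that(2)] by (auto simp: P_def)
    show ?thesis
    \<comment> \<open>Over \<open>L\<close> the homotopy is forced to be stationary, which is
      consistent with \<open>H\<close> on the faces. Elsewhere the values on the prism boundary are
      filled in by \<open>prism_extension\<close>.\<close>
    proof (cases "\<sigma> \<in> L")
      case True
      then have sL: "x \<in> realization_set L" if "x \<in> geometric_simplex \<sigma>" for x
        using that by (auto simp: realization_set_def)
      have "continuous_map (top_of_set (prism \<sigma>)) Y (\<lambda>z. p (snd z))"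
        by (rule continuous_map_prism_snd[OF psimplex(1)[OF s(1)]]) (auto simp: prism_def)
      then show ?thesis
        using pq sL H_face(3) by (intro exI[of _ "\<lambda>z. p (snd z)"]) auto
    next
      case False
      define f where "f z = (if fst z = 0 then p (snd z) else if fst z = 1 then q (snd z) else H z)" for z
      \<comment> \<open>Bottom, top and sides of the prism are closed and carry \<open>p\<close>,
        \<open>q\<close> and the previous stage. The sides are prisms over facets, where
        \<open>H\<close> is continuous, and \<open>H_face\<close> makes the three prescriptions
        agree on overlaps.\<close>
      define pieces where "pieces =
          {({0} \<times> geometric_simplex \<sigma>, \<lambda>z. p (snd z)), ({1} \<times> geometric_simplex \<sigma>, \<lambda>z. q (snd z))} \<union>
          (\<lambda>v. (prism (\<sigma> - {v}), H)) ` \<sigma>"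
      have sub: "prism (\<sigma> - {v}) = {z \<in> prism \<sigma>. snd z v = 0}" if "v \<in> \<sigma>" for v
      proof -
        have "x \<in> geometric_simplex (\<sigma> - {v}) \<longleftrightarrow> x \<in> geometric_simplex \<sigma> \<and> x v = 0" for x
          using sum.remove[OF fin(1) that, of x] that by (auto simp: geometric_simplex_def)
        then show ?thesis unfolding prism_def by (simp add: set_eq_iff mem_Times_iff)
      qed
      have pieces_cases: "i = ({0} \<times> geometric_simplex \<sigma>, \<lambda>z. p (snd z)) \<or>
          i = ({1} \<times> geometric_simplex \<sigma>, \<lambda>z. q (snd z)) \<or> (\<exists>v\<in>\<sigma>. i = (prism (\<sigma> - {v}), H))"
        if "i \<in> pieces" for i
        using that by (auto simp: pieces_def)
      have pieces_eq: "snd i z = f z" if i: "i \<in> pieces" and z: "z \<in> fst i" for i z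
      proof -
        consider "fst z = 0" "snd i = (\<lambda>z. p (snd z))" | "fst z = 1" "snd i = (\<lambda>z. q (snd z))"
          | v where "v \<in> \<sigma>" "fst i = prism (\<sigma> - {v})" "snd i = H"
          using pieces_cases[OF i] z by fastforce
        then show ?thesis
        proof cases
          case 3
          then have "z \<in> prism \<sigma>" "snd z v = 0" using z sub by auto
          then have "snd z \<in> geometric_simplex \<sigma>" "support (snd z) \<noteq> \<sigma>"
            using 3(1) by (auto simp: prism_def support_def)
          then show ?thesis using H_face(1,2)[of "snd z"] 3 by (cases z) (auto simp: f_def)
        qed (simp_all add: f_def)
      qed
      have "continuous_map (top_of_set (prism_boundary \<sigma>)) Y f"
      proof (rule pasting_lemma_closed[of pieces _ fst Y snd])
        show "finite pieces" using fin by (simp add: pieces_def)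
        fix i assume i: "i \<in> pieces"
        have sub_i: "fst i \<subseteq> prism_boundary \<sigma>"
          using pieces_cases[OF i] sub by (fastforce simp: prism_boundary_def prism_def)
        have "closed (fst i)"
          using pieces_cases[OF i] fin
          by (auto simp: prism_def intro!: closed_Times closed_geometric_simplex)
        then show "closedin (top_of_set (prism_boundary \<sigma>)) (fst i)"
          using sub_i by (simp add: closed_subset)
        have H_cont: "continuous_map (top_of_set (prism (\<sigma> - {v}))) Y H" if "v \<in> \<sigma>" for v
        \<comment> \<open>A single vertex has no opposite facet, and the corresponding side is
          empty.\<close>
        proof (cases "\<sigma> - {v} = {}")
          case True
          then have "prism (\<sigma> - {v}) = {}" unfolding prism_def by (metis Times_empty geometric_simplex_empty)
          then show ?thesis by simp
        next
          case False
          then have "\<sigma> - {v} \<in> K" by (intro abstract_complexD(3)[OF K s(1)]) auto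
          moreover have "card (\<sigma> - {v}) \<le> n" using s(2) that fin(1) by simp
          ultimately show ?thesis using PH unfolding P_def by blast
        qed
        have "continuous_map (top_of_set (fst i)) Y (snd i)"
          using pieces_cases[OF i] H_cont continuous_map_prism_snd[OF psimplex(1)[OF s(1)], of "fst i"]
            continuous_map_prism_snd[OF psimplex(2)[OF s(1)], of "fst i"]
          by (elim disjE bexE) (simp_all add: Sigma_mono)
        then show "continuous_map (subtopology (top_of_set (prism_boundary \<sigma>)) (fst i)) Y (snd i)"
          using sub_i by (simp add: subtopology_subtopology inf.absorb2)
      next
        fix i j x assume "i \<in> pieces" "j \<in> pieces"
          "x \<in> topspace (top_of_set (prism_boundary \<sigma>)) \<inter> fst i \<inter> fst j"
        then show "snd i x = snd j x" using pieces_eq[of i x] pieces_eq[of j x] by simp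
      next
        fix z assume "z \<in> topspace (top_of_set (prism_boundary \<sigma>))"
        then have z: "z \<in> prism \<sigma>" "fst z = 0 \<or> fst z = 1 \<or> (\<exists>v\<in>\<sigma>. snd z v = 0)"
          by (auto simp: prism_boundary_def)
        from z(2) have "\<exists>i\<in>pieces. z \<in> fst i"
        proof (elim disjE bexE)
          fix v assume v: "v \<in> \<sigma>" "snd z v = 0"
          then have "(prism (\<sigma> - {v}), H) \<in> pieces" "z \<in> prism (\<sigma> - {v})"
            using z(1) sub[OF v(1)] by (auto simp: pieces_def)
          then show ?thesis by force
        qed (use z(1) in \<open>cases z, force simp: pieces_def prism_def\<close>)+
        then show "\<exists>j. j \<in> pieces \<and> z \<in> fst j \<and> f z = snd j z" using pieces_eq[of _ z] by fastforce
      qed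
      then obtain g where g: "continuous_map (top_of_set (prism \<sigma>)) Y g"
        "\<And>z. z \<in> prism_boundary \<sigma> \<Longrightarrow> g z = f z"
        using prism_extension[OF fin Y] by blast
      have "g (t, x) = H (t, x)" if "t \<in> {0..1}" "x \<in> geometric_simplex \<sigma>" "support x \<noteq> \<sigma>" for t x
      proof -
        have "\<exists>v\<in>\<sigma>. x v = 0" using that support_subset[OF that(2)] by (auto simp: support_def)
        then have "g (t, x) = f (t, x)" using that by (intro g) (auto simp: prism_boundary_def prism_def)
        then show ?thesis using H_face(1,2)[OF that(2,3)] by (simp add: f_def)
      qed
      moreover have "g (0, x) = p x \<and> g (1, x) = q x" if "x \<in> geometric_simplex \<sigma>" for x
        using that g(2)[of "(0, x)"] g(2)[of "(1, x)"]
        by (simp add: prism_boundary_def prism_def f_def)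
      ultimately show ?thesis using g(1) False by blast
    qed
  qed
  have "\<exists>Hs. \<forall>n. P n (Hs n) \<and> R n (Hs n) (Hs (Suc n))"
  proof (rule dependent_nat_choice)
    \<comment> \<open>Simplices are non-empty, so stage 0 demands nothing and any function
      serves.\<close>
    have "P 0 (\<lambda>_ _. 0)"
      using abstract_complexD(1,2)[OF K] realization_support(1)[OF K] by (auto simp: P_def card_eq_0_iff)
    then show "\<exists>H. P 0 H" by blast
  next
    fix H n assume PH: "P n H"
    let ?K = "{\<sigma>\<in>K. card \<sigma> = Suc n}"
    obtain g where g: "\<And>\<sigma>. \<sigma> \<in> ?K \<Longrightarrow> continuous_map (top_of_set (prism \<sigma>)) Y (g \<sigma>)"
      "\<And>\<sigma> x. \<sigma> \<in> ?K \<Longrightarrow> x \<in> geometric_simplex \<sigma> \<Longrightarrow> g \<sigma> (0, x) = p x \<and> g \<sigma> (1, x) = q x"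
      "\<And>\<sigma> t x. \<sigma> \<in> ?K \<Longrightarrow> t \<in> {0..1} \<Longrightarrow> x \<in> geometric_simplex \<sigma> \<Longrightarrow> support x \<noteq> \<sigma> \<Longrightarrow>
         g \<sigma> (t, x) = H (t, x)"
      "\<And>\<sigma> z. \<sigma> \<in> ?K \<Longrightarrow> \<sigma> \<in> L \<Longrightarrow> z \<in> prism \<sigma> \<Longrightarrow> g \<sigma> z = p (snd z)"
    proof -
      have "\<forall>\<sigma>\<in>?K. \<exists>g. continuous_map (top_of_set (prism \<sigma>)) Y g \<and>
        (\<forall>x\<in>geometric_simplex \<sigma>. g (0, x) = p x \<and> g (1, x) = q x) \<and>
        (\<forall>t\<in>{0..1}. \<forall>x\<in>geometric_simplex \<sigma>. support x \<noteq> \<sigma> \<longrightarrow> g (t, x) = H (t, x)) \<and>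
        (\<sigma> \<in> L \<longrightarrow> (\<forall>z\<in>prism \<sigma>. g z = p (snd z)))"
        using step[OF PH] by blast
      from bchoice[OF this] obtain g where g: "\<forall>\<sigma>\<in>?K. continuous_map (top_of_set (prism \<sigma>)) Y (g \<sigma>) \<and>
        (\<forall>x\<in>geometric_simplex \<sigma>. g \<sigma> (0, x) = p x \<and> g \<sigma> (1, x) = q x) \<and>
        (\<forall>t\<in>{0..1}. \<forall>x\<in>geometric_simplex \<sigma>. support x \<noteq> \<sigma> \<longrightarrow> g \<sigma> (t, x) = H (t, x)) \<and>
        (\<sigma> \<in> L \<longrightarrow> (\<forall>z\<in>prism \<sigma>. g \<sigma> z = p (snd z)))" ..
      show ?thesis by (rule that[of g]) (use g in blast)+
    qed
    \<comment> \<open>A point is interior to exactly one simplex, its support, so the fillings for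
      different simplices never compete. On the whole closed simplex \<open>H'\<close> is still the
      filling, since that extends \<open>H\<close> from the proper faces.\<close>
    define H' where "H' z = (if card (support (snd z)) = Suc n then g (support (snd z)) z else H z)" for z
    have "R n H H'" by (auto simp: R_def H'_def)
    moreover have "P (Suc n) H'"
      unfolding P_def
    proof (intro conjI ballI impI)
      fix \<sigma> assume s: "\<sigma> \<in> K" "card \<sigma> \<le> Suc n"
      have fin: "finite \<sigma>" by (rule abstract_complexD[OF K s(1)])
      show "continuous_map (top_of_set (prism \<sigma>)) Y H'"
      proof (cases "card \<sigma> = Suc n")
        case True
        have "H' (t, x) = g \<sigma> (t, x)" if "t \<in> {0..1}" "x \<in> geometric_simplex \<sigma>" for t x
          using face[OF True that(2) fin] g(3)[OF _ that] True s
          by (cases "support x = \<sigma>") (auto simp: H'_def)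
        then show ?thesis
          using s True by (intro continuous_map_eq[OF g(1)[of \<sigma>]]) (auto simp: prism_def)
      next
        case False
        then have n: "card \<sigma> \<le> n" using s by simp
        have eq: "H' z = H z" if "z \<in> prism \<sigma>" for z
        proof -
          have "card (support (snd z)) \<le> n"
            using that card_mono[OF fin support_subset, of "snd z"] n by (auto simp: prism_def)
          then show ?thesis by (simp add: H'_def)
        qed
        have "continuous_map (top_of_set (prism \<sigma>)) Y H" using PH s n unfolding P_def by blast
        then show ?thesis by (rule continuous_map_eq) (simp add: eq)
      qed
    next
      fix x assume x: "x \<in> realization_set K" "card (support x) \<le> Suc n"
      note sup = realization_support[OF K x(1)]
      have PHx: "H (0, x) = p x \<and> H (1, x) = q x \<and>
          (x \<in> realization_set L \<longrightarrow> (\<forall>t\<in>{0..1}. H (t, x) = p x))" if "card (support x) \<noteq> Suc n"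
        using PH x that unfolding P_def by simp
      show "H' (0, x) = p x" "H' (1, x) = q x"
        using PHx g(2)[of "support x" x] sup by (auto simp: H'_def)
      fix t :: real assume "x \<in> realization_set L" "t \<in> {0..1}"
      then show "H' (t, x) = p x"
        using PHx g(4)[of "support x" "(t, x)"] sup realization_support(1)[OF L(1)]
        by (simp add: H'_def prism_def)
    qed
    ultimately show "\<exists>H'. P (Suc n) H' \<and> R n H H'" by blast
  qed
  then obtain Hs where Hs: "\<And>n. P n (Hs n)" "\<And>n. R n (Hs n) (Hs (Suc n))" by blast
  have stable: "Hs n (t, x) = Hs (card (support x)) (t, x)" if "card (support x) \<le> n" for n t x
    using that
  proof (induction n rule: dec_induct)
    case (step n)
    then show ?case using Hs(2)[of n] by (simp add: R_def)
  qed simp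
  \<comment> \<open>The limit of the stages. By \<open>stable\<close> it coincides on a simplex with
    \<open>m\<close> vertices with the single map \<open>Hs m\<close>, and is continuous
    there.\<close>
  define H where "H z = Hs (card (support (snd z))) z" for z
  have "continuous_map (prod_topology (top_of_set {0..1}) (geometric_realization K)) Y H"
  proof (rule continuous_map_interval_realization[OF K])
    fix \<sigma> assume s: "\<sigma> \<in> K"
    have "Hs (card \<sigma>) z = H z" if "z \<in> prism \<sigma>" for z
      using that stable[of "snd z" "card \<sigma>" "fst z"]
        card_mono[OF abstract_complexD(1)[OF K s] support_subset, of "snd z"]
      by (cases z) (simp add: H_def prism_def)
    moreover have "continuous_map (top_of_set (prism \<sigma>)) Y (Hs (card \<sigma>))"
      using Hs(1)[of "card \<sigma>"] s by (simp add: P_def)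
    ultimately show "continuous_map (top_of_set ({0..1} \<times> geometric_simplex \<sigma>)) Y H"
      unfolding prism_def[symmetric] by (auto intro: continuous_map_eq)
  qed
  moreover have "H (0, x) = p x" "H (1, x) = q x" if "x \<in> realization_set K" for x
    using Hs(1)[of "card (support x)"] that unfolding P_def by (simp_all add: H_def)
  moreover have "H (t, x) = p x" if "t \<in> {0..1}" "x \<in> realization_set L" for t x
    using Hs(1)[of "card (support x)"] that realization_mono[OF L(2)] unfolding P_def
    by (simp add: H_def subset_iff)
  ultimately show ?thesis using that by blast
qed

section \<open>Unions of complexes\<close>

lemma continuous_map_interval_realizationD:
  assumes K: "abstract_complex K" and s: "\<sigma> \<in> K"
    and H: "continuous_map (prod_topology (top_of_set {0..1::real}) (geometric_realization K)) Y H"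
  shows "continuous_map (top_of_set ({0..1} \<times> geometric_simplex \<sigma>)) Y H"
proof -
  have "top_of_set ({0..1::real} \<times> geometric_simplex \<sigma>) =
      prod_topology (subtopology (top_of_set {0..1}) UNIV)
        (subtopology (geometric_realization K) (geometric_simplex \<sigma>))"
    by (simp add: subtopology_realization_simplex[OF K s] prod_topology_top_of_set)
  also have "\<dots> = subtopology (prod_topology (top_of_set {0..1}) (geometric_realization K))
      (UNIV \<times> geometric_simplex \<sigma>)"
    by (simp only: subtopology_Times)
  finally show ?thesis using continuous_map_from_subtopology[OF H] by simp
qed

text \<open>The null-homotopy of \<open>p \<circ> f\<close> in \<open>X\<close> is carried back by
  \<open>q\<close>. The points of \<open>X\<close> may have another type than those of
  \<open>Y\<close>; this is how the hypotheses on \<open>A\<close> and \<open>B\<close> reach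
  complexes whose vertices are elements of the amalgam.\<close>

lemma compactly_null_of_contractible:
  fixes X :: "'x topology" and Y :: "('v \<Rightarrow> real) topology"
  assumes "contractible_space X" "continuous_map Y X p" "continuous_map X Y q"
    and "\<And>y. y \<in> topspace Y \<Longrightarrow> q (p y) = y"
  shows "compactly_null Y"
  unfolding compactly_null_def
proof (intro allI impI)
  fix Z :: "(real \<times> ('v \<Rightarrow> real)) topology" and f
  assume f: "continuous_map Z Y f"
  obtain c where "homotopic_with (\<lambda>_. True) Z X (p \<circ> f) (\<lambda>_. c)"
    using nullhomotopic_into_contractible_space[OF continuous_map_compose[OF f assms(2)] assms(1)]
    by blast
  then have "homotopic_with (\<lambda>_. True) Z Y (q \<circ> (p \<circ> f)) (q \<circ> (\<lambda>_. c))"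
    by (rule homotopic_with_compose_continuous_map_left[OF _ assms(3)]) simp
  moreover have "f z = (q \<circ> (p \<circ> f)) z" if "z \<in> topspace Z" for z
  proof -
    have "f z \<in> topspace Y" using f that by (auto simp: continuous_map_def)
    then show ?thesis by (simp add: assms(4))
  qed
  ultimately have "homotopic_with (\<lambda>_. True) Z Y f (\<lambda>_. q c)"
    by (rule homotopic_with_eq) auto
  then show "\<exists>c. homotopic_with (\<lambda>_. True) Z Y f (\<lambda>_. c)" by blast
qed

lemma compactly_null_isomorphic_complex:
  fixes f :: "'u \<Rightarrow> 'v"
  assumes K: "abstract_complex K" and K': "abstract_complex K'" "K' = image f ` K"
    and inj: "inj_on f (\<Union>K)" and contr: "contractible_space (geometric_realization K)"
  shows "compactly_null (geometric_realization K')"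
proof -
  let ?V = "\<Union>K"
  \<comment> \<open>\<open>p\<close> pulls coordinates back along \<open>f\<close> and
    \<open>q\<close> pushes them forward. Both are 0 off the vertices of the target complex, as
    membership in a simplex requires.\<close>
  define p where "p \<beta> = (\<lambda>v. if v \<in> ?V then \<beta> (f v) else 0)" for \<beta> :: "'v \<Rightarrow> real"
  define q where "q \<alpha> = (\<lambda>w. if w \<in> f ` ?V then \<alpha> (inv_into ?V f w) else 0)" for \<alpha> :: "'u \<Rightarrow> real"
  have f_mem: "f v \<in> f ` \<sigma> \<longleftrightarrow> v \<in> \<sigma>" if "\<sigma> \<in> K" "v \<in> ?V" for \<sigma> v
    using that inj by (auto simp: inj_on_def)
  have inj\<sigma>: "inj_on f \<sigma>" if "\<sigma> \<in> K" for \<sigma> using inj that by (auto intro: inj_on_subset)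
  have p: "p \<beta> \<in> geometric_simplex \<sigma>" if s: "\<sigma> \<in> K" and b: "\<beta> \<in> geometric_simplex (f ` \<sigma>)" for \<sigma> \<beta>
  proof -
    have "(\<Sum>v\<in>\<sigma>. p \<beta> v) = (\<Sum>v\<in>\<sigma>. \<beta> (f v))" using s by (intro sum.cong) (auto simp: p_def)
    also have "\<dots> = (\<Sum>w\<in>f ` \<sigma>. \<beta> w)" using inj\<sigma>[OF s] by (simp add: sum.reindex)
    finally show ?thesis using b f_mem[OF s] by (simp add: geometric_simplex_def p_def)
  qed
  have q: "q \<alpha> \<in> geometric_simplex (f ` \<sigma>)" if s: "\<sigma> \<in> K" and a: "\<alpha> \<in> geometric_simplex \<sigma>" for \<sigma> \<alpha>
  proof -
    have inv: "inv_into ?V f (f v) = v" if "v \<in> ?V" for v using inv_into_f_f[OF inj that] .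
    have qf: "q \<alpha> (f v) = \<alpha> v" if "v \<in> ?V" for v
      using inv[OF that] imageI[OF that, of f] unfolding q_def by presburger
    have "(\<Sum>w\<in>f ` \<sigma>. q \<alpha> w) = (\<Sum>v\<in>\<sigma>. q \<alpha> (f v))" using inj\<sigma>[OF s] by (simp add: sum.reindex)
    also have "\<dots> = (\<Sum>v\<in>\<sigma>. \<alpha> v)" using s by (intro sum.cong qf) auto
    finally have "(\<Sum>w\<in>f ` \<sigma>. q \<alpha> w) = 1" using a by (simp add: geometric_simplex_def)
    moreover have "q \<alpha> w = 0" if "w \<notin> f ` \<sigma>" for w
    proof (cases "w \<in> f ` ?V")
      case True
      then obtain v where v: "v \<in> ?V" "w = f v" by blast
      then show ?thesis using that a qf[OF v(1)] by (auto simp: geometric_simplex_def)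
    qed (simp add: q_def)
    ultimately show ?thesis using a by (auto simp: geometric_simplex_def q_def)
  qed
  show ?thesis
  proof (rule compactly_null_of_contractible[OF contr, of _ p q])
    have "continuous_on S p" for S
      unfolding p_def
    proof (rule continuous_on_coordinatewise_then_product)
      show "continuous_on S (\<lambda>\<beta>. if v \<in> ?V then \<beta> (f v) else 0)" for v
        by (cases "v \<in> ?V") (simp_all add: continuous_on_coordinate)
    qed
    then show "continuous_map (geometric_realization K') (geometric_realization K) p"
      unfolding continuous_map_realization_iff K'(2) using p continuous_map_into_realization[OF K] by blast
    have "continuous_on S q" for S
      unfolding q_def
    proof (rule continuous_on_coordinatewise_then_product)
      show "continuous_on S (\<lambda>\<alpha>. if w \<in> f ` ?V then \<alpha> (inv_into ?V f w) else 0)" for w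
        by (cases "w \<in> f ` ?V") (simp_all add: continuous_on_coordinate)
    qed
    moreover have "f ` \<sigma> \<in> K'" if "\<sigma> \<in> K" for \<sigma> using that K' by blast
    ultimately show "continuous_map (geometric_realization K) (geometric_realization K') q"
      unfolding continuous_map_realization_iff using q continuous_map_into_realization[OF K'(1)] by blast
    fix \<beta> assume "\<beta> \<in> topspace (geometric_realization K')"
    then obtain \<sigma> where s: "\<sigma> \<in> K" "\<beta> \<in> geometric_simplex (f ` \<sigma>)"
      using K' by (auto simp: realization_set_def)
    show "q (p \<beta>) = \<beta>"
    proof
      fix w
      show "q (p \<beta>) w = \<beta> w"
      proof (cases "w \<in> f ` ?V")
        case True
        then show ?thesis
          using f_inv_into_f[OF True] inv_into_into[OF True] by (simp add: q_def p_def)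
      next
        case False
        then have "w \<notin> f ` \<sigma>" using s by blast
        then show ?thesis using False s by (simp add: q_def geometric_simplex_def)
      qed
    qed
  qed
qed

text \<open>A form of Whitehead's theorem: the identity and a constant map are joined by a homotopy
  built over the skeleta, relative to the empty subcomplex. The empty complex is treated apart
  because it has no point to contract to.\<close>

lemma compactly_null_imp_contractible:
  assumes K: "abstract_complex K" and null: "compactly_null (geometric_realization K)"
  shows "contractible_space (geometric_realization K)"
proof (cases "K = {}")
  case True
  then have "topspace (geometric_realization K) = {}" by (simp add: realization_set_def)
  then show ?thesis by (metis contractible_space_empty null_topspace_iff_trivial)
next
  case False
  then obtain a where a: "a \<in> realization_set K"
  proof -
    from False obtain \<sigma> where s: "\<sigma> \<in> K" by blast
    then obtain v where v: "v \<in> \<sigma>" using abstract_complexD(2)[OF K] by blast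
    have "(\<lambda>u. if u = v then 1 else 0) \<in> geometric_simplex \<sigma>"
      using v abstract_complexD(1)[OF K s] by (simp add: geometric_simplex_def)
    then show ?thesis using that s geometric_simplex_subset_realization_set by blast
  qed
  obtain H where H: "continuous_map (prod_topology (top_of_set {0..1::real}) (geometric_realization K))
      (geometric_realization K) H"
    "\<And>x. x \<in> realization_set K \<Longrightarrow> H (0, x) = id x" "\<And>x. x \<in> realization_set K \<Longrightarrow> H (1, x) = a"
  proof (rule homotopy_rel_subcomplex[OF K _ _ null, where L = "{}" and p = id and q = "\<lambda>_. a"])
    show "abstract_complex {}" by (simp add: abstract_complex_def)
  qed (use a in \<open>auto simp: realization_set_def\<close>)
  have "homotopic_with (\<lambda>_. True) (geometric_realization K) (geometric_realization K) id (\<lambda>_. a)"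
    by (subst homotopic_with) (use H in auto)
  then show ?thesis unfolding contractible_space_def by blast
qed

text \<open>A map into \<open>K\<close> is homotopic along \<open>D\<close> to one with values in
  \<open>L\<close>, where it contracts. Continuity of \<open>D\<close> is asked only on prisms over
  single simplices, which suffices by \<open>continuous_map_interval_realization\<close>.\<close>

lemma compactly_null_deformation:
  fixes D :: "real \<times> ('v \<Rightarrow> real) \<Rightarrow> 'v \<Rightarrow> real"
  assumes K: "abstract_complex K" and L: "abstract_complex L" "L \<subseteq> K"
    and D: "\<And>\<sigma>. \<sigma> \<in> K \<Longrightarrow>
       continuous_map (top_of_set ({0..1} \<times> geometric_simplex \<sigma>)) (geometric_realization K) D"
    and D0: "\<And>x. x \<in> realization_set K \<Longrightarrow> D (0, x) = x"
    and D1: "\<And>x. x \<in> realization_set K \<Longrightarrow> D (1, x) \<in> realization_set L"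
    and null: "compactly_null (geometric_realization L)"
  shows "compactly_null (geometric_realization K)"
  unfolding compactly_null_def
proof (intro allI impI)
  let ?K = "geometric_realization K" and ?L = "geometric_realization L"
  fix Z :: "(real \<times> ('v \<Rightarrow> real)) topology" and f
  assume Z: "compact_space Z" and f: "continuous_map Z ?K f"
  have "homotopic_with (\<lambda>_. True) ?K ?K id (\<lambda>x. D (1, x))"
    by (subst homotopic_with)
      (use continuous_map_interval_realization[OF K D] D0 in \<open>auto intro!: exI[of _ D]\<close>)
  then have 1: "homotopic_with (\<lambda>_. True) Z ?K (id \<circ> f) ((\<lambda>x. D (1, x)) \<circ> f)"
    and "continuous_map ?K ?K (\<lambda>x. D (1, x))"
    by (simp_all only: homotopic_with_compose_continuous_map_right[OF _ f] homotopic_with_imp_continuous_maps)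
  then have "continuous_map ?K ?L (\<lambda>x. D (1, x))"
    using D1 by (auto simp: subtopology_realization[OF K L] continuous_map_in_subtopology)
  then have "continuous_map Z ?L ((\<lambda>x. D (1, x)) \<circ> f)" using f continuous_map_compose by blast
  then obtain c where "homotopic_with (\<lambda>_. True) Z ?L ((\<lambda>x. D (1, x)) \<circ> f) (\<lambda>_. c)"
    using null Z unfolding compactly_null_def by blast
  moreover have "continuous_map ?L ?K id"
    by (simp add: subtopology_realization[OF K L] continuous_map_id_subt)
  ultimately have "homotopic_with (\<lambda>_. True) Z ?K (id \<circ> ((\<lambda>x. D (1, x)) \<circ> f)) (id \<circ> (\<lambda>_. c))"
    by (rule homotopic_with_compose_continuous_map_left) simp
  then have "homotopic_with (\<lambda>_. True) Z ?K f (\<lambda>_. c)"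
    using homotopic_with_trans[OF 1] by simp
  then show "\<exists>c. homotopic_with (\<lambda>_. True) Z ?K f (\<lambda>_. c)" by blast
qed

lemma abstract_complex_Un:
  "abstract_complex K \<Longrightarrow> abstract_complex L \<Longrightarrow> abstract_complex (K \<union> L)"
  unfolding abstract_complex_def by blast

lemma realization_set_Un: "realization_set (K \<union> L) = realization_set K \<union> realization_set L"
  by (auto simp: realization_set_def)

text \<open>The realization of \<open>K2\<close> deforms onto \<open>\<Delta>\<close> relative to \<open>\<Delta>\<close>.  At the end of the
  deformation all vertices outside \<open>\<Delta>\<close> have been sent to a fixed vertex \<open>v0\<close> of \<open>\<Delta>\<close>.\<close>

proposition compactly_null_glue:
  fixes K1 :: "'v set set"
  assumes K1: "abstract_complex K1" and K2: "abstract_complex K2"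
    and \<Delta>: "\<Delta> \<in> K1" "\<Delta> \<in> K2" "K1 \<inter> K2 \<subseteq> Pow \<Delta>"
    and null: "compactly_null (geometric_realization K1)" "compactly_null (geometric_realization K2)"
  shows "compactly_null (geometric_realization (K1 \<union> K2))"
proof -
  have fin: "finite \<Delta>" "\<Delta> \<noteq> {}" using abstract_complexD(1,2)[OF K1 \<Delta>(1)] by auto
  then obtain v0 where v0: "v0 \<in> \<Delta>" by blast
  \<comment> \<open>On each simplex this is affine: the coordinates outside \<open>\<Delta>\<close>
    are dropped and their total is added at \<open>v0\<close>.\<close>
  define \<rho> where "\<rho> \<alpha> = (\<lambda>v. if v \<in> \<Delta> then \<alpha> v + (if v = v0 then 1 - (\<Sum>u\<in>\<Delta>. \<alpha> u) else 0) else 0)"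
    for \<alpha> :: "'v \<Rightarrow> real"
  have \<rho>_mem: "\<rho> \<alpha> \<in> geometric_simplex \<Delta>" if "\<sigma> \<in> K2" "\<alpha> \<in> geometric_simplex \<sigma>" for \<sigma> \<alpha>
  proof -
    have nn: "\<And>v. 0 \<le> \<alpha> v" using that by (auto simp: geometric_simplex_def)
    have fins: "finite \<sigma>" by (rule abstract_complexD(1)[OF K2 that(1)])
    have "(\<Sum>u\<in>\<Delta>. \<alpha> u) = (\<Sum>u\<in>\<Delta> \<inter> \<sigma>. \<alpha> u)"
      using fin that by (intro sum.mono_neutral_right) (auto simp: geometric_simplex_def)
    also have "\<dots> \<le> (\<Sum>u\<in>\<sigma>. \<alpha> u)" using fins nn by (intro sum_mono2) auto
    finally have le: "(\<Sum>u\<in>\<Delta>. \<alpha> u) \<le> 1" using that by (simp add: geometric_simplex_def)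
    have "(\<Sum>v\<in>\<Delta>. \<rho> \<alpha> v) = (\<Sum>v\<in>\<Delta>. \<alpha> v + (if v = v0 then 1 - (\<Sum>u\<in>\<Delta>. \<alpha> u) else 0))"
      by (simp add: \<rho>_def)
    also have "\<dots> = 1" using fin v0 by (simp add: sum.distrib)
    finally show ?thesis using le nn by (simp add: geometric_simplex_def \<rho>_def)
  qed
  have \<rho>_id: "\<rho> \<alpha> = \<alpha>" if "\<alpha> \<in> geometric_simplex \<Delta>" for \<alpha>
    using that by (auto simp: \<rho>_def geometric_simplex_def fun_eq_iff)
  have \<rho>_cont: "continuous_on S \<rho>" for S
    unfolding \<rho>_def
  proof (rule continuous_on_coordinatewise_then_product)
    show "continuous_on S (\<lambda>\<alpha>. if v \<in> \<Delta> then \<alpha> v + (if v = v0 then 1 - (\<Sum>u\<in>\<Delta>. \<alpha> u) else 0) else 0)" for v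
      by (cases "v \<in> \<Delta>"; cases "v = v0") (auto intro!: continuous_intros)
  qed
  define L where "L = {\<tau>. \<tau> \<subseteq> \<Delta> \<and> \<tau> \<noteq> {}}"
  have L: "abstract_complex L" "L \<subseteq> K2"
    using fin abstract_complexD(3)[OF K2 \<Delta>(2)] finite_subset by (auto simp: L_def abstract_complex_def)
  have setL: "realization_set L = geometric_simplex \<Delta>"
    using fin geometric_simplex_mono[OF fin(1)] by (auto simp: realization_set_def L_def)
  obtain H where H: "continuous_map (prod_topology (top_of_set {0..1::real}) (geometric_realization K2))
      (geometric_realization K2) H"
    "\<And>x. x \<in> realization_set K2 \<Longrightarrow> H (0, x) = id x"
    "\<And>x. x \<in> realization_set K2 \<Longrightarrow> H (1, x) = \<rho> x"
    "\<And>t x. t \<in> {0..1} \<Longrightarrow> x \<in> realization_set L \<Longrightarrow> H (t, x) = id x"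
  proof (rule homotopy_rel_subcomplex[OF K2 L null(2), where p = id and q = \<rho>])
    show "continuous_map (geometric_realization K2) (geometric_realization K2) \<rho>"
      unfolding continuous_map_realization_iff
      using continuous_map_into_realization[OF K2 \<Delta>(2) \<rho>_cont] \<rho>_mem by blast
  qed (use setL \<rho>_id in auto)
  \<comment> \<open>The two prescriptions fit: a point of both realizations has its support in
    \<open>K1 \<inter> K2\<close>, hence lies in the simplex of \<open>\<Delta>\<close>, where
    \<open>H\<close> is stationary.\<close>
  define D where "D z = (if snd z \<in> realization_set K1 then snd z else H z)" for z
  let ?K = "K1 \<union> K2"
  have K: "abstract_complex ?K" using K1 K2 by (rule abstract_complex_Un)
  show ?thesis
  proof (rule compactly_null_deformation[OF K K1 Un_upper1 _ _ _ null(1), of D])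
    fix \<sigma> assume s: "\<sigma> \<in> ?K"
    show "continuous_map (top_of_set ({0..1} \<times> geometric_simplex \<sigma>)) (geometric_realization ?K) D"
    proof (cases "\<sigma> \<in> K1")
      case True
      have "continuous_map (top_of_set ({0..1} \<times> geometric_simplex \<sigma>)) (geometric_realization ?K) snd"
        by (rule continuous_map_into_realization[OF K s]) (auto intro: continuous_intros)
      then show ?thesis
        by (rule continuous_map_eq)
          (use True geometric_simplex_subset_realization_set in \<open>force simp: D_def\<close>)
    next
      case False
      then have s2: "\<sigma> \<in> K2" using s by blast
      have eq: "H (t, x) = D (t, x)" if "t \<in> {0..1}" "x \<in> geometric_simplex \<sigma>" for t x
      proof (cases "x \<in> realization_set K1")
        case True
        have x2: "x \<in> realization_set K2" using that s2 by (auto simp: realization_set_def)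
        have "support x \<subseteq> \<Delta>"
          using realization_support(1)[OF K1 True] realization_support(1)[OF K2 x2] \<Delta>(3) by blast
        then have "x \<in> geometric_simplex \<Delta>"
          using geometric_simplex_superset[OF that(2) fin(1)] abstract_complexD(1)[OF K2 s2] by blast
        then show ?thesis using H(4) that(1) True setL by (simp add: D_def)
      qed (simp add: D_def)
      have "continuous_map (top_of_set ({0..1} \<times> geometric_simplex \<sigma>)) (geometric_realization K2) H"
        by (rule continuous_map_interval_realizationD[OF K2 s2 H(1)])
      then have "continuous_map (top_of_set ({0..1} \<times> geometric_simplex \<sigma>)) (geometric_realization K2) D"
        by (rule continuous_map_eq) (use eq in auto)
      then show ?thesis by (rule continuous_map_realization_mono[OF K K2 Un_upper2])
    qed
  next
    fix x assume "x \<in> realization_set ?K"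
    then show "D (0, x) = x" using H(2) by (auto simp: D_def realization_set_Un)
    show "D (1, x) \<in> realization_set K1"
    proof (cases "x \<in> realization_set K1")
      case False
      then have x2: "x \<in> realization_set K2" using \<open>x \<in> realization_set ?K\<close> by (simp add: realization_set_Un)
      then have "\<rho> x \<in> geometric_simplex \<Delta>" using \<rho>_mem by (auto simp: realization_set_def)
      then show ?thesis using H(3)[OF x2] False \<Delta>(1) by (auto simp: D_def realization_set_def)
    qed (simp add: D_def)
  qed
qed

text \<open>The image of a compact space meets finitely many open simplices, whose vertices form a
  finite set \<open>V\<close>. A subcomplex that has all simplices of \<open>K\<close> on
  \<open>V\<close> receives the map and contracts it.\<close>

lemma compactly_null_directed:
  assumes K: "abstract_complex K"
    and L: "\<And>V. finite V \<Longrightarrow> V \<subseteq> \<Union>K \<Longrightarrow>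
      \<exists>L\<subseteq>K. abstract_complex L \<and> compactly_null (geometric_realization L) \<and> {\<sigma>\<in>K. \<sigma> \<subseteq> V} \<subseteq> L"
  shows "compactly_null (geometric_realization K)"
  unfolding compactly_null_def
proof (intro allI impI)
  fix Z :: "(real \<times> ('a \<Rightarrow> real)) topology" and f
  assume Z: "compact_space Z" and f: "continuous_map Z (geometric_realization K) f"
  have "compactin (geometric_realization K) (f ` topspace Z)"
    using Z f image_compactin unfolding compact_space_def by blast
  then obtain F where F: "finite F" "F \<subseteq> K" "f ` topspace Z \<subseteq> realization_set F"
    using compactin_realization_finite[OF K] by metis
  have "finite (\<Union>F)" using F abstract_complexD(1)[OF K] by (intro finite_Union) blast+
  then obtain L where L: "L \<subseteq> K" "abstract_complex L" "compactly_null (geometric_realization L)"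
      "{\<sigma>\<in>K. \<sigma> \<subseteq> \<Union>F} \<subseteq> L"
    using L[of "\<Union>F"] F by blast
  have "F \<subseteq> L" using L(4) F(2) by blast
  then have "f ` topspace Z \<subseteq> realization_set L" using F(3) realization_mono by blast
  then have "continuous_map Z (geometric_realization L) f"
    using f by (simp add: subtopology_realization[OF K L(2,1)] continuous_map_in_subtopology
        image_subset_iff_funcset)
  then obtain c where "homotopic_with (\<lambda>_. True) Z (geometric_realization L) f (\<lambda>_. c)"
    using L(3) Z unfolding compactly_null_def by blast
  moreover have "continuous_map (geometric_realization L) (geometric_realization K) id"
    by (simp add: subtopology_realization[OF K L(2,1)] continuous_map_id_subt)
  ultimately have "homotopic_with (\<lambda>_. True) Z (geometric_realization K) (id \<circ> f) (id \<circ> (\<lambda>_. c))"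
    by (rule homotopic_with_compose_continuous_map_left) simp
  then show "\<exists>c. homotopic_with (\<lambda>_. True) Z (geometric_realization K) f (\<lambda>_. c)"
    by (auto simp: o_def)
qed

section \<open>Rips complexes of unions\<close>

text \<open>Subtracting the same amount from the coordinates on both sides, and collecting the lost mass
  at \<open>k0\<close>, empties one of the two sides.\<close>

lemma compactly_null_collapse:
  fixes K :: "'v set set"
  assumes K: "abstract_complex K" and k0: "k0 \<in> X" "k0 \<in> Y"
    and cover: "\<And>\<sigma>. \<sigma> \<in> K \<Longrightarrow> \<sigma> \<subseteq> X \<union> Y"
    and cone: "\<And>\<sigma>. \<sigma> \<in> K \<Longrightarrow> \<not> \<sigma> \<subseteq> X \<Longrightarrow> \<not> \<sigma> \<subseteq> Y \<Longrightarrow> insert k0 \<sigma> \<in> K"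
    and null: "compactly_null (geometric_realization {\<sigma>\<in>K. \<sigma> \<subseteq> X \<or> \<sigma> \<subseteq> Y})"
  shows "compactly_null (geometric_realization K)"
proof -
  \<comment> \<open>The total mass on a side bounds every coordinate there, so subtracting the
    smaller of the two totals from each coordinate empties that whole side.\<close>
  define \<mu> where "\<mu> \<sigma> \<alpha> = min (\<Sum>v\<in>\<sigma> - Y. \<alpha> v) (\<Sum>v\<in>\<sigma> - X. \<alpha> v)" for \<sigma> and \<alpha> :: "'v \<Rightarrow> real"
  define g where "g \<sigma> z v = (if v \<in> X \<inter> Y then snd z v else max 0 (snd z v - fst z * \<mu> \<sigma> (snd z)))"
    for \<sigma> and z :: "real \<times> ('v \<Rightarrow> real)" and v
  \<comment> \<open>The coordinate at \<open>k0\<close> is the remainder to 1, so it collects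
    exactly what the truncated subtraction removes elsewhere.\<close>
  define D\<sigma> where "D\<sigma> \<sigma> z = (\<lambda>v. if v = k0 then 1 - (\<Sum>u\<in>\<sigma> - {k0}. g \<sigma> z u) else g \<sigma> z v)"
    for \<sigma> and z :: "real \<times> ('v \<Rightarrow> real)"
  \<comment> \<open>One function for all simplices uses the support; for fixed
    \<open>\<sigma>\<close>, continuity is visible from the formula. Both agree on the simplex of
    \<open>\<sigma>\<close>, because the vertices with coordinate 0 contribute nothing.\<close>
  define D where "D z = D\<sigma> (support (snd z)) z" for z :: "real \<times> ('v \<Rightarrow> real)"
  let ?L = "{\<sigma>\<in>K. \<sigma> \<subseteq> X \<or> \<sigma> \<subseteq> Y}"
  have "\<tau> \<in> ?L" if "\<sigma> \<in> ?L" "\<tau> \<subseteq> \<sigma>" "\<tau> \<noteq> {}" for \<sigma> \<tau>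
    using that abstract_complexD(3)[OF K, of \<sigma> \<tau>] by blast
  moreover have "finite \<sigma> \<and> \<sigma> \<noteq> {}" if "\<sigma> \<in> ?L" for \<sigma>
    using that abstract_complexD(1,2)[OF K, of \<sigma>] by blast
  ultimately have L: "abstract_complex ?L" "?L \<subseteq> K" unfolding abstract_complex_def by blast+
  have \<mu>_nonneg: "0 \<le> \<mu> \<sigma> \<alpha>" if "\<alpha> \<in> geometric_simplex \<tau>" for \<sigma> \<tau> \<alpha>
    using that by (auto simp: \<mu>_def geometric_simplex_def intro!: sum_nonneg)
  have \<mu>_support: "\<mu> (support \<alpha>) \<alpha> = \<mu> \<sigma> \<alpha>" if "finite \<sigma>" "\<alpha> \<in> geometric_simplex \<sigma>" for \<sigma> \<alpha>
  proof -
    have "(\<Sum>v\<in>support \<alpha> - Z. \<alpha> v) = (\<Sum>v\<in>\<sigma> - Z. \<alpha> v)" for Z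
      using that support_subset[OF that(2)] by (intro sum.mono_neutral_left) (auto simp: support_def)
    then show ?thesis by (simp add: \<mu>_def)
  qed
  have D_eq: "D (t, \<alpha>) = D\<sigma> \<sigma> (t, \<alpha>)"
    if fin: "finite \<sigma>" and t: "t \<in> {0..1}" and a: "\<alpha> \<in> geometric_simplex \<sigma>" for \<sigma> t \<alpha>
  proof -
    have g: "g (support \<alpha>) (t, \<alpha>) = g \<sigma> (t, \<alpha>)"
      by (simp add: g_def \<mu>_support[OF fin a] fun_eq_iff)
    have "g \<sigma> (t, \<alpha>) u = 0" if "\<alpha> u = 0" for u
      using that t \<mu>_nonneg[OF a, of \<sigma>] by (simp add: g_def)
    then have "(\<Sum>u\<in>support \<alpha> - {k0}. g \<sigma> (t, \<alpha>) u) = (\<Sum>u\<in>\<sigma> - {k0}. g \<sigma> (t, \<alpha>) u)"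
      using fin support_subset[OF a] by (intro sum.mono_neutral_left) (auto simp: support_def)
    then show ?thesis unfolding D_def D\<sigma>_def by (simp only: g snd_conv)
  qed
  have D_mem: "D\<sigma> \<sigma> (t, \<alpha>) \<in> geometric_simplex (insert k0 \<sigma>)"
    if fin: "finite \<sigma>" and t: "t \<in> {0..1}" and a: "\<alpha> \<in> geometric_simplex \<sigma>" for \<sigma> t \<alpha>
  proof -
    have nn: "\<And>v. 0 \<le> \<alpha> v" using a by (simp add: geometric_simplex_def)
    have t\<mu>: "0 \<le> t * \<mu> \<sigma> \<alpha>" using t \<mu>_nonneg[OF a] by simp
    have g: "0 \<le> g \<sigma> (t, \<alpha>) u" "g \<sigma> (t, \<alpha>) u \<le> \<alpha> u" for u
      using nn[of u] t\<mu> by (auto simp: g_def)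
    have "(\<Sum>u\<in>\<sigma> - {k0}. g \<sigma> (t, \<alpha>) u) \<le> (\<Sum>u\<in>\<sigma> - {k0}. \<alpha> u)" by (intro sum_mono g)
    also have "\<dots> \<le> (\<Sum>u\<in>\<sigma>. \<alpha> u)" using fin nn by (intro sum_mono2) auto
    finally have le1: "(\<Sum>u\<in>\<sigma> - {k0}. g \<sigma> (t, \<alpha>) u) \<le> 1" using a by (simp add: geometric_simplex_def)
    have "(\<Sum>v\<in>insert k0 \<sigma>. D\<sigma> \<sigma> (t, \<alpha>) v) =
        D\<sigma> \<sigma> (t, \<alpha>) k0 + (\<Sum>v\<in>\<sigma> - {k0}. D\<sigma> \<sigma> (t, \<alpha>) v)"
      using fin by (simp add: sum.insert_remove)
    also have "(\<Sum>v\<in>\<sigma> - {k0}. D\<sigma> \<sigma> (t, \<alpha>) v) = (\<Sum>v\<in>\<sigma> - {k0}. g \<sigma> (t, \<alpha>) v)"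
      by (intro sum.cong) (auto simp: D\<sigma>_def)
    finally have "(\<Sum>v\<in>insert k0 \<sigma>. D\<sigma> \<sigma> (t, \<alpha>) v) = 1" by (simp add: D\<sigma>_def)
    moreover have "D\<sigma> \<sigma> (t, \<alpha>) v = 0" if "v \<notin> insert k0 \<sigma>" for v
    proof -
      have "\<alpha> v = 0" using that a by (simp add: geometric_simplex_def)
      then show ?thesis using g[of v] that by (simp add: D\<sigma>_def)
    qed
    ultimately show ?thesis using g(1) le1 by (auto simp: geometric_simplex_def D\<sigma>_def)
  qed
  have D_fix: "D\<sigma> \<sigma> (t, \<alpha>) = \<alpha>"
    if fin: "finite \<sigma>" and a: "\<alpha> \<in> geometric_simplex \<sigma>" and 0: "t * \<mu> \<sigma> \<alpha> = 0" for \<sigma> t \<alpha>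
  proof
    fix v
    have g: "g \<sigma> (t, \<alpha>) u = \<alpha> u" for u
      unfolding g_def fst_conv snd_conv 0 using a by (simp add: geometric_simplex_def)
    have "(\<Sum>u\<in>\<sigma> - {k0}. \<alpha> u) = 1 - \<alpha> k0"
      using fin a by (auto simp: sum_diff1 geometric_simplex_def)
    then show "D\<sigma> \<sigma> (t, \<alpha>) v = \<alpha> v" by (simp add: D\<sigma>_def g)
  qed
  have \<mu>_pure: "\<mu> \<sigma> \<alpha> = 0" if "\<alpha> \<in> geometric_simplex \<sigma>" "\<sigma> \<subseteq> X \<or> \<sigma> \<subseteq> Y" for \<sigma> \<alpha>
  proof -
    have "\<sigma> - X = {} \<or> \<sigma> - Y = {}" using that(2) by blast
    then have "\<mu> \<sigma> \<alpha> \<le> 0" unfolding \<mu>_def by (metis min.cobounded1 min.cobounded2 sum.empty)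
    then show ?thesis using \<mu>_nonneg[OF that(1), of \<sigma>] by simp
  qed
  have D_cont: "continuous_on S (D\<sigma> \<sigma>)" for S \<sigma>
  proof -
    have "continuous_on S (\<lambda>z::real \<times> ('v \<Rightarrow> real). \<mu> \<sigma> (snd z))"
      unfolding \<mu>_def by (intro continuous_intros)
    then have g: "continuous_on S (\<lambda>z. g \<sigma> z v)" for v
      unfolding g_def by (cases "v \<in> X \<inter> Y") (auto intro!: continuous_intros)
    show ?thesis
      unfolding D\<sigma>_def
    proof (rule continuous_on_coordinatewise_then_product)
      show "continuous_on S (\<lambda>z. if v = k0 then 1 - (\<Sum>u\<in>\<sigma> - {k0}. g \<sigma> z u) else g \<sigma> z v)" for v
        by (cases "v = k0") (auto intro!: continuous_intros g)
    qed
  qed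
  show ?thesis
  proof (rule compactly_null_deformation[OF K L _ _ _ null, of D])
    fix \<sigma> assume s: "\<sigma> \<in> K"
    have fin: "finite \<sigma>" by (rule abstract_complexD(1)[OF K s])
    \<comment> \<open>A simplex on one side has \<open>\<mu> = 0\<close> and is fixed pointwise. A
      mixed simplex acquires the vertex \<open>k0\<close>, and then \<open>cone\<close>
      applies.\<close>
    have "D\<sigma> \<sigma> \<in> {0..1} \<times> geometric_simplex \<sigma> \<rightarrow> geometric_simplex (if \<sigma> \<in> ?L then \<sigma> else insert k0 \<sigma>)"
      using D_mem[OF fin] D_fix[OF fin] \<mu>_pure by auto
    moreover have "(if \<sigma> \<in> ?L then \<sigma> else insert k0 \<sigma>) \<in> K" using cone[OF s] s by auto
    ultimately have "continuous_map (top_of_set ({0..1} \<times> geometric_simplex \<sigma>)) (geometric_realization K) (D\<sigma> \<sigma>)"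
      using continuous_map_into_realization[OF K _ D_cont] by blast
    then show "continuous_map (top_of_set ({0..1} \<times> geometric_simplex \<sigma>)) (geometric_realization K) D"
      by (rule continuous_map_eq) (use D_eq[OF fin] in auto)
  next
    fix \<alpha> assume "\<alpha> \<in> realization_set K"
    then obtain \<sigma> where s: "\<sigma> \<in> K" and a: "\<alpha> \<in> geometric_simplex \<sigma>" by (auto simp: realization_set_def)
    have fin: "finite \<sigma>" by (rule abstract_complexD(1)[OF K s])
    show "D (0, \<alpha>) = \<alpha>" using D_eq[OF fin _ a, of 0] D_fix[OF fin a, of 0] by simp
    have D1: "D (1, \<alpha>) = D\<sigma> \<sigma> (1, \<alpha>)" using D_eq[OF fin _ a, of 1] by simp
    show "D (1, \<alpha>) \<in> realization_set ?L"
    proof (cases "\<sigma> \<in> ?L")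
      case True
      then have "D (1, \<alpha>) = \<alpha>" using D1 D_fix[OF fin a, of 1] \<mu>_pure[OF a] by simp
      then show ?thesis using True a by (auto simp: realization_set_def)
    next
      case False
      let ?s = "support (D (1, \<alpha>))"
      have mem: "D (1, \<alpha>) \<in> geometric_simplex (insert k0 \<sigma>)" using D_mem[OF fin _ a, of 1] D1 by simp
      have le: "\<alpha> v \<le> (\<Sum>v\<in>\<sigma> - Z. \<alpha> v)" if "v \<in> \<sigma> - Z" for v Z
        using that fin a by (intro member_le_sum) (auto simp: geometric_simplex_def)
      have zero: "D (1, \<alpha>) v = 0" if "v \<in> \<sigma>" "v \<notin> X \<inter> Y" "\<alpha> v \<le> \<mu> \<sigma> \<alpha>" for v
        using that k0 by (auto simp: D1 D\<sigma>_def g_def)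
      have "?s \<subseteq> insert k0 \<sigma>" using support_subset[OF mem] .
      \<comment> \<open>As \<open>k0\<close> lies in both \<open>X\<close> and \<open>Y\<close>,
        only the vertices of \<open>\<sigma>\<close> matter for the choice of a side.\<close>
      moreover have "?s \<inter> \<sigma> \<subseteq> X \<or> ?s \<inter> \<sigma> \<subseteq> Y"
      proof (cases "(\<Sum>v\<in>\<sigma> - Y. \<alpha> v) \<le> (\<Sum>v\<in>\<sigma> - X. \<alpha> v)")
        case True
        then have "\<mu> \<sigma> \<alpha> = (\<Sum>v\<in>\<sigma> - Y. \<alpha> v)" by (simp add: \<mu>_def)
        then have "D (1, \<alpha>) v = 0" if "v \<in> \<sigma> - Y" for v using zero[of v] le[OF that] that by auto
        then show ?thesis by (auto simp: support_def)
      next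
        case False
        then have "\<mu> \<sigma> \<alpha> = (\<Sum>v\<in>\<sigma> - X. \<alpha> v)" by (simp add: \<mu>_def)
        then have "D (1, \<alpha>) v = 0" if "v \<in> \<sigma> - X" for v using zero[of v] le[OF that] that by auto
        then show ?thesis by (auto simp: support_def)
      qed
      moreover have K0: "insert k0 \<sigma> \<in> K" using False s cone by blast
      ultimately have "?s \<in> ?L"
        using abstract_complexD(3)[OF K K0, of ?s] support_nonempty[OF mem] k0 by auto
      moreover have "D (1, \<alpha>) \<in> geometric_simplex ?s"
        using geometric_simplex_superset[OF mem, of ?s] fin \<open>?s \<subseteq> insert k0 \<sigma>\<close> finite_subset by blast
      ultimately show ?thesis by (auto simp: realization_set_def)
    qed
  qed
qed

lemma abstract_complex_rips: "abstract_complex (rips_complex X d r)"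
  unfolding abstract_complex_def
proof (intro conjI ballI allI impI)
  fix \<sigma> \<tau> assume "\<sigma> \<in> rips_complex X d r" "\<tau> \<subseteq> \<sigma>" "\<tau> \<noteq> {}"
  then show "\<tau> \<in> rips_complex X d r" unfolding rips_complex_iff using finite_subset by blast
qed (auto simp: rips_complex_iff)

text \<open>A point of \<open>X\<close> outside \<open>Y\<close> and a point of \<open>Y\<close> outside \<open>X\<close> at distance at most \<open>r\<close> are both
  at distance at most \<open>r\<close> from every point of the intersection, since its diameter does not exceed
  the distance of either point from it.\<close>

proposition compactly_null_rips_glue:
  fixes d :: "'v \<Rightarrow> 'v \<Rightarrow> real"
  assumes fin: "finite (X \<inter> Y)" and k0: "k0 \<in> X \<inter> Y" and r: "1 \<le> r"
    and clique: "\<And>k l. k \<in> X \<inter> Y \<Longrightarrow> l \<in> X \<inter> Y \<Longrightarrow> d k l \<le> 1"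
    and sym: "\<And>x y. x \<in> X \<union> Y \<Longrightarrow> y \<in> X \<union> Y \<Longrightarrow> d x y = d y x"
    and tri: "\<And>x y z. x \<in> X \<union> Y \<Longrightarrow> y \<in> X \<union> Y \<Longrightarrow> z \<in> X \<union> Y \<Longrightarrow> d x z \<le> d x y + d y z"
    and sep: "\<And>x y. x \<in> X \<union> Y \<Longrightarrow> y \<in> X \<union> Y \<Longrightarrow> x \<noteq> y \<Longrightarrow> 1 \<le> d x y"
    and between: "\<And>x y. x \<in> X \<Longrightarrow> y \<in> Y \<Longrightarrow> \<exists>k\<in>X \<inter> Y. d x k + d k y \<le> d x y"
    and null: "compactly_null (geometric_realization (rips_complex X d r))"
      "compactly_null (geometric_realization (rips_complex Y d r))"
  shows "compactly_null (geometric_realization (rips_complex (X \<union> Y) d r))"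
proof (rule compactly_null_collapse[OF abstract_complex_rips, of k0 X Y])
  let ?R = "\<lambda>Z. rips_complex Z d r"
  show "\<sigma> \<subseteq> X \<union> Y" if "\<sigma> \<in> ?R (X \<union> Y)" for \<sigma> using that by (simp add: rips_complex_iff)
  have near: "d x k0 \<le> d x y \<and> d y k0 \<le> d x y" if x: "x \<in> X - Y" and y: "y \<in> Y - X" for x y
  proof -
    obtain k where k: "k \<in> X \<inter> Y" "d x k + d k y \<le> d x y" using between x y by blast
    have "d x k0 \<le> d x k + d k k0" "d y k0 \<le> d y k + d k k0" using tri k k0 x y by auto
    moreover have "d k k0 \<le> 1" using clique k k0 by blast
    \<comment> \<open>Both points lie outside the intersection and hence differ from
      \<open>k\<close>. The unit spent on going from \<open>k\<close> to \<open>k0\<close> is saved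
      on the other part of the path.\<close>
    moreover have "1 \<le> d x k" "1 \<le> d k y" using sep k x y by blast+
    moreover have "d y k = d k y" using sym k y by blast
    ultimately show ?thesis using k(2) by linarith
  qed
  show "insert k0 \<sigma> \<in> ?R (X \<union> Y)"
    if s: "\<sigma> \<in> ?R (X \<union> Y)" and mixed: "\<not> \<sigma> \<subseteq> X" "\<not> \<sigma> \<subseteq> Y" for \<sigma>
  proof -
    have sX: "\<sigma> \<subseteq> X \<union> Y" and diam: "\<And>x y. x \<in> \<sigma> \<Longrightarrow> y \<in> \<sigma> \<Longrightarrow> d x y \<le> r"
      using s by (auto simp: rips_complex_iff)
    obtain x y where xy: "x \<in> \<sigma>" "x \<in> X - Y" "y \<in> \<sigma>" "y \<in> Y - X" using mixed sX by blast
    have to_k0: "d z k0 \<le> r" if z: "z \<in> \<sigma>" for z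
    proof -
      consider "z \<in> X \<inter> Y" | "z \<in> X - Y" | "z \<in> Y - X" using z sX by blast
      then show ?thesis
      proof cases
        case 1
        then show ?thesis using clique[of z k0] k0 r by linarith
      next
        case 2
        then show ?thesis using near[OF 2 xy(4)] diam[OF z xy(3)] by linarith
      next
        case 3
        then show ?thesis using near[OF xy(2) 3] diam[OF xy(1) z] by linarith
      qed
    qed
    moreover have "d k0 z \<le> r" if "z \<in> \<sigma>" for z
      using to_k0[OF that] sym[of k0 z] that sX k0 by auto
    moreover have "d k0 k0 \<le> r" using clique[OF k0 k0] r by linarith
    ultimately show ?thesis using s k0 by (auto simp: rips_complex_iff)
  qed
  have union: "{\<sigma>\<in>?R (X \<union> Y). \<sigma> \<subseteq> X \<or> \<sigma> \<subseteq> Y} = ?R X \<union> ?R Y" by (auto simp: rips_complex_iff)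
  \<comment> \<open>By \<open>r \<ge> 1\<close> the whole intersection is a simplex of both
    complexes; it plays the role of \<open>\<Delta>\<close> in
    \<open>compactly_null_glue\<close>.\<close>
  have "X \<inter> Y \<in> ?R X" "X \<inter> Y \<in> ?R Y"
    using fin k0 clique r by (auto simp: rips_complex_iff intro: order_trans)
  moreover have "?R X \<inter> ?R Y \<subseteq> Pow (X \<inter> Y)" by (auto simp: rips_complex_iff)
  ultimately show "compactly_null (geometric_realization {\<sigma>\<in>?R (X \<union> Y). \<sigma> \<subseteq> X \<or> \<sigma> \<subseteq> Y})"
    unfolding union using null abstract_complex_rips by (intro compactly_null_glue)
qed (use k0 in auto)

section \<open>Word metrics and alternating products\<close>

text \<open>The Cayley graph as a relation. Its powers are walks, so distances can be studied by
  following the vertices through cosets instead of manipulating words.\<close>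

definition word_step :: "('a, 'm) monoid_scheme \<Rightarrow> 'a set \<Rightarrow> ('a \<times> 'a) set" where
  "word_step G S = {(x, x \<otimes>\<^bsub>G\<^esub> s) | x s. x \<in> carrier G \<and> s \<in> S \<union> (\<lambda>s. inv\<^bsub>G\<^esub> s) ` S}"

lemma word_step_iff:
  "(x, y) \<in> word_step G S \<longleftrightarrow>
     x \<in> carrier G \<and> (\<exists>s\<in>S \<union> (\<lambda>s. inv\<^bsub>G\<^esub> s) ` S. y = x \<otimes>\<^bsub>G\<^esub> s)"
  by (auto simp: word_step_def)

context group
begin

lemma word_step_relpow_iff:
  assumes S: "S \<subseteq> carrier G" and g: "g \<in> carrier G" "h \<in> carrier G"
  shows "(g, h) \<in> word_step G S ^^ n \<longleftrightarrow>
    (\<exists>ws. length ws = n \<and> set ws \<subseteq> S \<union> (\<lambda>s. inv s) ` S \<and>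
       inv g \<otimes> h = foldr (\<lambda>x y. x \<otimes> y) ws \<one>)"
  using g(1)
proof (induction n arbitrary: g)
  case 0
  have "inv g \<otimes> h = \<one> \<longleftrightarrow> g = h"
    using 0 g(2) by (metis inv_closed inv_equality inv_inv l_inv)
  then show ?case by auto
next
  case (Suc n)
  let ?T = "S \<union> (\<lambda>s. inv s) ` S"
  have T: "?T \<subseteq> carrier G" using S by auto
  have "(g, h) \<in> word_step G S ^^ Suc n \<longleftrightarrow> (\<exists>s\<in>?T. (g \<otimes> s, h) \<in> word_step G S ^^ n)"
  proof -
    have "(g, h) \<in> word_step G S ^^ Suc n \<longleftrightarrow>
        (\<exists>y. (g, y) \<in> word_step G S \<and> (y, h) \<in> word_step G S ^^ n)"
      by (meson relpow_Suc_D2 relpow_Suc_I2)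
    then show ?thesis using Suc.prems by (auto simp: word_step_iff)
  qed
  also have "\<dots> \<longleftrightarrow> (\<exists>s\<in>?T. \<exists>ws. length ws = n \<and> set ws \<subseteq> ?T \<and>
       inv (g \<otimes> s) \<otimes> h = foldr (\<lambda>x y. x \<otimes> y) ws \<one>)"
    using Suc T by (intro bex_cong refl Suc.IH) auto
  also have "\<dots> \<longleftrightarrow> (\<exists>s\<in>?T. \<exists>ws. length ws = n \<and> set ws \<subseteq> ?T \<and>
       inv g \<otimes> h = foldr (\<lambda>x y. x \<otimes> y) (s # ws) \<one>)"
  proof (intro bex_cong refl ex_cong1 conj_cong)
    fix s ws assume s: "s \<in> ?T" and ws: "set ws \<subseteq> ?T"
    let ?f = "foldr (\<lambda>x y. x \<otimes> y) ws \<one>"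
    have f: "?f \<in> carrier G" using ws T by (induction ws) auto
    have sc: "s \<in> carrier G" using s T by blast
    have "inv (g \<otimes> s) \<otimes> h = inv s \<otimes> (inv g \<otimes> h)"
      using sc Suc.prems g(2) by (simp add: inv_mult_group m_assoc)
    then have "inv (g \<otimes> s) \<otimes> h = ?f \<longleftrightarrow> ?f = inv s \<otimes> (inv g \<otimes> h)" by metis
    also have "\<dots> \<longleftrightarrow> inv g \<otimes> h = s \<otimes> ?f"
      using f sc Suc.prems g(2) by (intro inv_solve_left) auto
    finally show "inv (g \<otimes> s) \<otimes> h = ?f \<longleftrightarrow> inv g \<otimes> h = foldr (\<lambda>x y. x \<otimes> y) (s # ws) \<one>"
      by simp
  qed simp_all
  also have "\<dots> \<longleftrightarrow> (\<exists>ws. length ws = Suc n \<and> set ws \<subseteq> ?T \<and>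
       inv g \<otimes> h = foldr (\<lambda>x y. x \<otimes> y) ws \<one>)" (is "?l \<longleftrightarrow> ?r")
  proof
    assume ?l
    then obtain s ws where "s \<in> ?T" "length ws = n" "set ws \<subseteq> ?T"
        "inv g \<otimes> h = foldr (\<lambda>x y. x \<otimes> y) (s # ws) \<one>" by blast
    then show ?r by (intro exI[of _ "s # ws"]) simp
  next
    assume ?r
    then obtain ws where ws: "length ws = Suc n" "set ws \<subseteq> ?T"
        "inv g \<otimes> h = foldr (\<lambda>x y. x \<otimes> y) ws \<one>" by blast
    then show ?l
    proof (cases ws)
      case (Cons s ws')
      then show ?thesis using ws by (intro bexI[of _ s] exI[of _ ws']) simp_all
    qed simp
  qed
  finally show ?case .
qed

text \<open>A walk of length 0 joins \<open>g\<close> to itself, so the minimum absorbs the separate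
  case \<open>g = h\<close> of \<open>word_metric\<close>.\<close>

lemma word_metric_Least:
  assumes "S \<subseteq> carrier G" "g \<in> carrier G" "h \<in> carrier G"
  shows "word_metric G S g h = real (LEAST n. (g, h) \<in> word_step G S ^^ n)"
proof (cases "g = h")
  case True
  then have "(LEAST n. (g, h) \<in> word_step G S ^^ n) = 0" by (intro Least_eq_0) simp
  then show ?thesis using True by (simp add: word_metric_def)
next
  case False
  then show ?thesis using word_step_relpow_iff[OF assms] by (simp add: word_metric_def)
qed

lemma word_metric_translate:
  assumes "k \<in> carrier G" "g \<in> carrier G" "h \<in> carrier G"
  shows "word_metric G S (k \<otimes> g) (k \<otimes> h) = word_metric G S g h"
proof -
  have "inv (k \<otimes> g) \<otimes> (k \<otimes> h) = inv g \<otimes> (inv k \<otimes> (k \<otimes> h))"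
    using assms by (simp add: inv_mult_group m_assoc)
  also have "\<dots> = inv g \<otimes> h" using assms by (simp flip: m_assoc)
  finally show ?thesis using assms by (simp add: word_metric_def)
qed

lemma word_step_connected:
  assumes S: "S \<subseteq> carrier G" "generate G S = carrier G" and g: "g \<in> carrier G" "h \<in> carrier G"
  shows "\<exists>n. (g, h) \<in> word_step G S ^^ n"
proof -
  \<comment> \<open>The start varies, because the second factor of a product is walked from the end
    of the first.\<close>
  have "\<exists>n. (g, g \<otimes> x) \<in> word_step G S ^^ n" if "x \<in> generate G S" "g \<in> carrier G" for x g
    using that
  proof (induction arbitrary: g)
    case one
    then show ?case by (auto intro: exI[of _ 0])
  next
    case (incl s)
    then have "(g, g \<otimes> s) \<in> word_step G S ^^ 1" by (auto simp: word_step_def)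
    then show ?case by blast
  next
    case (inv s)
    then have "(g, g \<otimes> inv s) \<in> word_step G S ^^ 1" by (auto simp: word_step_def)
    then show ?case by blast
  next
    case (eng x y)
    have xy: "x \<in> carrier G" "y \<in> carrier G" using eng.hyps S by auto
    obtain m n where "(g, g \<otimes> x) \<in> word_step G S ^^ m" "(g \<otimes> x, g \<otimes> x \<otimes> y) \<in> word_step G S ^^ n"
      using eng xy by (metis m_closed)
    then have "(g, g \<otimes> (x \<otimes> y)) \<in> word_step G S ^^ (m + n)"
      using eng.prems xy by (auto simp: relpow_add m_assoc)
    then show ?case by blast
  qed
  from this[of "inv g \<otimes> h" g] show ?thesis using S g by (simp flip: m_assoc)
qed

lemma word_step_sym:
  assumes "S \<subseteq> carrier G" shows "sym (word_step G S)"
proof (rule symI)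
  fix x y assume "(x, y) \<in> word_step G S"
  then obtain s where s: "x \<in> carrier G" "s \<in> S \<union> (\<lambda>s. inv s) ` S" "y = x \<otimes> s"
    by (auto simp: word_step_def)
  then have c: "s \<in> carrier G" and i: "inv s \<in> S \<union> (\<lambda>s. inv s) ` S" using assms by auto
  have "x = y \<otimes> inv s" using s c by (simp add: m_assoc)
  moreover have "y \<in> carrier G" using s c by simp
  ultimately show "(y, x) \<in> word_step G S" using i by (auto simp: word_step_def)
qed

lemma word_step_relpow_sym:
  assumes "S \<subseteq> carrier G" "(x, y) \<in> word_step G S ^^ n" shows "(y, x) \<in> word_step G S ^^ n"
  using assms(2)
proof (induction n arbitrary: x y)
  case (Suc n)
  then obtain z where "(x, z) \<in> word_step G S ^^ n" "(z, y) \<in> word_step G S" by auto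
  then show ?case using Suc.IH word_step_sym[OF assms(1)] by (meson relpow_Suc_I2 symD)
qed simp

context
  fixes S assumes S: "S \<subseteq> carrier G" and gen: "generate G S = carrier G"
begin

lemma word_metric_le:
  assumes "g \<in> carrier G" "h \<in> carrier G" "(g, h) \<in> word_step G S ^^ n"
  shows "word_metric G S g h \<le> real n"
  using assms by (simp add: word_metric_Least[OF S] Least_le)

lemma word_metric_attained:
  assumes "g \<in> carrier G" "h \<in> carrier G"
  obtains n where "word_metric G S g h = real n" "(g, h) \<in> word_step G S ^^ n"
  using LeastI_ex[OF word_step_connected[OF S gen assms]] word_metric_Least[OF S assms] that by blast

lemma word_metric_sym:
  assumes "g \<in> carrier G" "h \<in> carrier G"
  shows "word_metric G S g h = word_metric G S h g"
proof -
  have "(g, h) \<in> word_step G S ^^ n \<longleftrightarrow> (h, g) \<in> word_step G S ^^ n" for n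
    using word_step_relpow_sym[OF S] by blast
  then show ?thesis using assms by (simp add: word_metric_Least[OF S])
qed

lemma word_metric_triangle:
  assumes "g \<in> carrier G" "h \<in> carrier G" "k \<in> carrier G"
  shows "word_metric G S g k \<le> word_metric G S g h + word_metric G S h k"
proof -
  obtain m where m: "word_metric G S g h = real m" "(g, h) \<in> word_step G S ^^ m"
    using word_metric_attained assms by blast
  obtain n where n: "word_metric G S h k = real n" "(h, k) \<in> word_step G S ^^ n"
    using word_metric_attained assms by blast
  have "(g, k) \<in> word_step G S ^^ (m + n)" using m n by (auto simp: relpow_add)
  then show ?thesis using word_metric_le[of g k "m + n"] assms m n by simp
qed

lemma word_metric_ge_1:
  assumes "g \<in> carrier G" "h \<in> carrier G" "g \<noteq> h" shows "1 \<le> word_metric G S g h"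
proof -
  obtain n where n: "word_metric G S g h = real n" "(g, h) \<in> word_step G S ^^ n"
    using word_metric_attained assms by blast
  then have "n \<noteq> 0" using assms(3) by (metis relpow_0_E)
  then show ?thesis using n by simp
qed

end

end

text \<open>Words over \<open>S\<close> correspond to words over its image. Only generators coming
  from \<open>H\<close> are allowed in \<open>G\<close> here; \<open>word_metric_A\<close> compares
  this with the full generating set.\<close>

lemma word_metric_hom:
  assumes "group H" "group G" and h: "h \<in> hom H G" "inj_on h (carrier H)" and S: "S \<subseteq> carrier H"
    and a: "a \<in> carrier H" "b \<in> carrier H"
  shows "word_metric G (h ` S) (h a) (h b) = word_metric H S a b"
proof -
  interpret H: group H by fact
  interpret G: group G by fact
  interpret h: group_hom H G h by unfold_locales (rule h)
  let ?T = "S \<union> (\<lambda>s. inv\<^bsub>H\<^esub> s) ` S" and ?T' = "h ` S \<union> (\<lambda>s. inv\<^bsub>G\<^esub> s) ` h ` S"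
  have T: "?T \<subseteq> carrier H" using S by auto
  have T': "?T' = h ` ?T" using S by (auto simp: image_Un image_image subset_iff)
  have fold: "h (foldr (\<lambda>x y. x \<otimes>\<^bsub>H\<^esub> y) ws \<one>\<^bsub>H\<^esub>) = foldr (\<lambda>x y. x \<otimes>\<^bsub>G\<^esub> y) (map h ws) \<one>\<^bsub>G\<^esub> \<and>
      foldr (\<lambda>x y. x \<otimes>\<^bsub>H\<^esub> y) ws \<one>\<^bsub>H\<^esub> \<in> carrier H" if "set ws \<subseteq> ?T" for ws
    using that T by (induction ws) auto
  have "(\<exists>ws'. length ws' = k \<and> set ws' \<subseteq> ?T' \<and>
          inv\<^bsub>G\<^esub> (h a) \<otimes>\<^bsub>G\<^esub> h b = foldr (\<lambda>x y. x \<otimes>\<^bsub>G\<^esub> y) ws' \<one>\<^bsub>G\<^esub>) \<longleftrightarrow>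
        (\<exists>ws. length ws = k \<and> set ws \<subseteq> ?T \<and>
          inv\<^bsub>H\<^esub> a \<otimes>\<^bsub>H\<^esub> b = foldr (\<lambda>x y. x \<otimes>\<^bsub>H\<^esub> y) ws \<one>\<^bsub>H\<^esub>)" for k
  proof -
    have ab: "inv\<^bsub>G\<^esub> (h a) \<otimes>\<^bsub>G\<^esub> h b = h (inv\<^bsub>H\<^esub> a \<otimes>\<^bsub>H\<^esub> b)" using a by simp
    have iff: "inv\<^bsub>G\<^esub> (h a) \<otimes>\<^bsub>G\<^esub> h b = foldr (\<lambda>x y. x \<otimes>\<^bsub>G\<^esub> y) (map h ws) \<one>\<^bsub>G\<^esub> \<longleftrightarrow>
        inv\<^bsub>H\<^esub> a \<otimes>\<^bsub>H\<^esub> b = foldr (\<lambda>x y. x \<otimes>\<^bsub>H\<^esub> y) ws \<one>\<^bsub>H\<^esub>" if "set ws \<subseteq> ?T" for ws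
      unfolding ab using fold[OF that] a inj_on_eq_iff[OF h(2)] by (metis H.inv_closed H.m_closed)
    show ?thesis
    proof
      assume "\<exists>ws'. length ws' = k \<and> set ws' \<subseteq> ?T' \<and>
          inv\<^bsub>G\<^esub> (h a) \<otimes>\<^bsub>G\<^esub> h b = foldr (\<lambda>x y. x \<otimes>\<^bsub>G\<^esub> y) ws' \<one>\<^bsub>G\<^esub>"
      then obtain ws' where ws': "length ws' = k" "set ws' \<subseteq> h ` ?T"
          "inv\<^bsub>G\<^esub> (h a) \<otimes>\<^bsub>G\<^esub> h b = foldr (\<lambda>x y. x \<otimes>\<^bsub>G\<^esub> y) ws' \<one>\<^bsub>G\<^esub>"
        unfolding T' by blast
      then have "ws' \<in> lists (h ` ?T)" by auto
      then have "ws' \<in> map h ` lists ?T" unfolding lists_image .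
      then obtain ws where "set ws \<subseteq> ?T" "ws' = map h ws" by auto
      then show "\<exists>ws. length ws = k \<and> set ws \<subseteq> ?T \<and>
          inv\<^bsub>H\<^esub> a \<otimes>\<^bsub>H\<^esub> b = foldr (\<lambda>x y. x \<otimes>\<^bsub>H\<^esub> y) ws \<one>\<^bsub>H\<^esub>"
        using iff ws' by (intro exI[of _ ws]) auto
    next
      assume "\<exists>ws. length ws = k \<and> set ws \<subseteq> ?T \<and>
          inv\<^bsub>H\<^esub> a \<otimes>\<^bsub>H\<^esub> b = foldr (\<lambda>x y. x \<otimes>\<^bsub>H\<^esub> y) ws \<one>\<^bsub>H\<^esub>"
      then obtain ws where ws: "length ws = k" "set ws \<subseteq> ?T"
          "inv\<^bsub>H\<^esub> a \<otimes>\<^bsub>H\<^esub> b = foldr (\<lambda>x y. x \<otimes>\<^bsub>H\<^esub> y) ws \<one>\<^bsub>H\<^esub>" by blast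
      then have "set (map h ws) \<subseteq> ?T'" unfolding T' by auto
      then show "\<exists>ws'. length ws' = k \<and> set ws' \<subseteq> ?T' \<and>
          inv\<^bsub>G\<^esub> (h a) \<otimes>\<^bsub>G\<^esub> h b = foldr (\<lambda>x y. x \<otimes>\<^bsub>G\<^esub> y) ws' \<one>\<^bsub>G\<^esub>"
        using iff[OF ws(2)] ws by (intro exI[of _ "map h ws"]) auto
    qed
  qed
  moreover have "h a = h b \<longleftrightarrow> a = b" using inj_on_eq_iff[OF h(2)] a by blast
  ultimately show ?thesis by (simp add: word_metric_def)
qed

section \<open>Alternating products in a group generated by two subgroups\<close>

inductive altern :: "('a, 'm) monoid_scheme \<Rightarrow> 'a set \<Rightarrow> 'a set \<Rightarrow> 'a \<Rightarrow> bool" for G where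
  single: "a \<in> A - B \<Longrightarrow> altern G A B a"
| step: "a \<in> A - B \<Longrightarrow> altern G B A u \<Longrightarrow> altern G A B (a \<otimes>\<^bsub>G\<^esub> u)"

text \<open>In the Bass--Serre tree the edge \<open>A \<inter> B\<close> separates the other edges
  \<open>x (A \<inter> B)\<close> into those on the side of the vertex \<open>A\<close> and those on
  the side of \<open>B\<close>. These are the elements of the first kind, with the separating edge
  counted on both sides.\<close>

definition half :: "('a, 'm) monoid_scheme \<Rightarrow> 'a set \<Rightarrow> 'a set \<Rightarrow> 'a set" where
  "half G A B = {x. altern G A B x} \<union> A \<inter> B"

text \<open>The sets \<open>VA\<close> and \<open>VB\<close> certify that no alternating product is trivial.\<close>

locale ping_pong = group G for G (structure) +
  fixes A B VA VB :: "'a set"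
  assumes A: "subgroup A G" and B: "subgroup B G"
    and gen: "generate G (A \<union> B) = carrier G"
    and V_disjoint: "VA \<inter> VB = {}" "A \<inter> B \<inter> VA = {}" "A \<inter> B \<inter> VB = {}"
    and V_A: "A - B \<subseteq> VA" "\<And>a v. a \<in> A - B \<Longrightarrow> v \<in> VB \<Longrightarrow> a \<otimes> v \<in> VA"
    and V_B: "B - A \<subseteq> VB" "\<And>b v. b \<in> B - A \<Longrightarrow> v \<in> VA \<Longrightarrow> b \<otimes> v \<in> VB"

lemma (in ping_pong) swap: "ping_pong G B A VB VA"
  by (intro ping_pong.intro is_group ping_pong_axioms.intro A B V_A V_B)
    (use gen V_disjoint in \<open>simp_all add: Un_commute Int_commute\<close>)

context group
begin

lemma subgroup_mult_notin:
  assumes "subgroup A G" "subgroup B G" "a \<in> A - B" "c \<in> A \<inter> B"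
  shows "a \<otimes> c \<in> A - B" "c \<otimes> a \<in> A - B"
proof -
  interpret A: subgroup A G by fact
  interpret B: subgroup B G by fact
  have car: "a \<in> carrier G" "c \<in> carrier G" using assms A.subset by auto
  have "a = (a \<otimes> c) \<otimes> inv c" "a = inv c \<otimes> (c \<otimes> a)"
    using car by (simp_all add: m_assoc) (simp flip: m_assoc)
  then have "a \<otimes> c \<notin> B" "c \<otimes> a \<notin> B" using assms(3,4) by (metis B.m_closed B.m_inv_closed DiffD2 IntD2)+
  then show "a \<otimes> c \<in> A - B" "c \<otimes> a \<in> A - B" using assms by auto
qed

lemma altern_closed:
  assumes "altern G A B u" "subgroup A G" "subgroup B G" shows "u \<in> carrier G"
  using assms by induction (auto dest: subgroup.mem_carrier)

text \<open>The factor \<open>s\<close> affects only the last letter: it is absorbed there or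
  appended. A product of one letter can fall into \<open>A \<inter> B\<close> in this way, which is
  why the conclusion is about \<open>half\<close>.\<close>

lemma altern_mult_right:
  assumes "altern G A B u" "subgroup A G" "subgroup B G" "s \<in> A \<union> B"
  shows "u \<otimes> s \<in> half G A B"
  using assms
proof induction
  case (single a A B)
  show ?case
  proof (cases "s \<in> A")
    case True
    then have "a \<otimes> s \<in> A" using single by (auto intro: subgroup.m_closed)
    then show ?thesis by (auto simp: half_def intro: altern.single)
  next
    case False
    then have "altern G B A s" using single by (intro altern.single) auto
    then show ?thesis using single by (auto simp: half_def intro: altern.step)
  qed
next
  case (step a A B u)
  have car: "a \<in> carrier G" "u \<in> carrier G" "s \<in> carrier G"
    using step altern_closed[OF step(2)] by (auto dest: subgroup.mem_carrier)
  have "u \<otimes> s \<in> half G B A" using step by blast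
  then consider "altern G B A (u \<otimes> s)" | "u \<otimes> s \<in> A \<inter> B" by (auto simp: half_def)
  then have "altern G A B (a \<otimes> (u \<otimes> s))"
  proof cases
    case 1
    then show ?thesis using step(1) by (rule altern.step[rotated])
  next
    case 2
    \<comment> \<open>The tail has collapsed into the intersection, and \<open>a\<close> absorbs it
      without entering \<open>B\<close>.\<close>
    then show ?thesis using subgroup_mult_notin[OF step(4,5,1)] by (intro altern.single) auto
  qed
  then show ?case using car by (simp add: half_def m_assoc)
qed

text \<open>The last hypothesis concerns only \<open>u\<close> in \<open>A \<inter> B\<close>: from
  there, and from nowhere else, a factor in \<open>B - A\<close> leads to the other side.\<close>

lemma half_mult_right:
  assumes "subgroup A G" "subgroup B G" "u \<in> half G A B" "s \<in> A \<union> B" "u \<in> A \<Longrightarrow> u \<in> B \<Longrightarrow> s \<in> A"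
  shows "u \<otimes> s \<in> half G A B"
proof (cases "altern G A B u")
  case True
  then show ?thesis using altern_mult_right assms by blast
next
  case False
  then have "u \<in> A \<inter> B" "s \<in> A" using assms by (auto simp: half_def)
  then have "u \<otimes> s \<in> A" using assms(1) by (auto intro: subgroup.m_closed)
  then show ?thesis by (auto simp: half_def intro: altern.single)
qed

end

text \<open>A further letter interchanges the two subgroups and with them \<open>VA\<close> and
  \<open>VB\<close>, which therefore vary in the induction.\<close>

lemma altern_in_V:
  assumes "altern G A B u" "ping_pong G A B VA VB" shows "u \<in> VA"
  using assms
proof (induction arbitrary: VA VB)
  case (single a A B)
  then show ?case using ping_pong.V_A(1) by blast
next
  case (step a A B u)
  then show ?case using ping_pong.V_A(2) ping_pong.swap by metis
qed

context ping_pong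
begin

lemma A_subset: "A \<subseteq> carrier G" and B_subset: "B \<subseteq> carrier G"
  using A B by (auto dest: subgroup.mem_carrier)

text \<open>The first letter decides between the disjoint sets \<open>VA\<close> and
  \<open>VB\<close>. For the last claim, an element of \<open>B\<close> is in
  \<open>A \<inter> B\<close> or is itself a product of one letter from
  \<open>B - A\<close>.\<close>

lemma altern_disjoint:
  "altern G A B u \<Longrightarrow> \<not> altern G B A u" "altern G A B u \<Longrightarrow> u \<notin> A \<inter> B" "altern G A B u \<Longrightarrow> u \<notin> B"
proof -
  have pp: "ping_pong G A B VA VB" by unfold_locales
  show 1: "\<not> altern G B A u" if "altern G A B u"
    using altern_in_V[OF that pp] altern_in_V[OF _ swap] V_disjoint by blast
  show 2: "u \<notin> A \<inter> B" if "altern G A B u"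
    using altern_in_V[OF that pp] V_disjoint by blast
  show "u \<notin> B" if "altern G A B u" using 1 2 that altern.single[of u B A] by blast
qed

lemma half_Int: "half G A B \<inter> half G B A = A \<inter> B"
  using altern_disjoint ping_pong.altern_disjoint[OF swap] by (auto simp: half_def)

lemma A_subset_half: "A \<subseteq> half G A B"
  by (auto simp: half_def intro: altern.single)

lemma half_swap_Int_A: "half G B A \<inter> A = A \<inter> B"
  using ping_pong.altern_disjoint(3)[OF swap] by (auto simp: half_def)

lemma mult_half_swap:
  assumes "a \<in> A - B" "u \<in> half G B A" shows "altern G A B (a \<otimes> u)"
proof (cases "altern G B A u")
  case True
  then show ?thesis using assms by (intro altern.step)
next
  case False
  then show ?thesis using assms subgroup_mult_notin(1)[OF A B assms(1)] by (auto simp: half_def intro: altern.single)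
qed

end

section \<open>Unions of cosets\<close>

lemma relpow_subset:
  fixes R R' :: "('a \<times> 'a) set"
  assumes "R \<subseteq> R'" shows "R ^^ n \<subseteq> R' ^^ n"
  using assms by (induction n) auto

text \<open>The situation of the theorem inside one group. The assumptions are symmetric, so
  \<open>swap_splitting\<close> turns statements about \<open>A\<close> into statements about
  \<open>B\<close>.\<close>

locale amalgam_splitting = ping_pong +
  fixes SA SB :: "'a set"
  assumes SA: "SA \<subseteq> A" "A \<inter> B - {\<one>} \<subseteq> SA" and SB: "SB \<subseteq> B" "A \<inter> B - {\<one>} \<subseteq> SB"
    and finite_C: "finite (A \<inter> B)"
    and gen_S: "generate G (SA \<union> SB) = carrier G"

lemma (in amalgam_splitting) swap_splitting: "amalgam_splitting G B A VB VA SB SA"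
  by (intro amalgam_splitting.intro swap amalgam_splitting_axioms.intro)
    (use SA SB finite_C gen_S in \<open>simp_all add: Un_commute Int_commute\<close>)

text \<open>\<open>X\<close> is the union of the cosets in a subtree of the Bass--Serre tree.  For the edge \<open>g (A \<inter> B)\<close>
  at a point \<open>g\<close> of \<open>X\<close>, either both of its ends belong to the subtree, or \<open>X\<close> lies on one side.\<close>

definition tree_like :: "('a, 'm) monoid_scheme \<Rightarrow> 'a set \<Rightarrow> 'a set \<Rightarrow> 'a set \<Rightarrow> bool" where
  "tree_like G A B X \<longleftrightarrow> X \<subseteq> carrier G \<and> (\<forall>g\<in>X. \<forall>c\<in>A \<inter> B. g \<otimes>\<^bsub>G\<^esub> c \<in> X) \<and>
     (\<forall>g\<in>X. (\<forall>a\<in>A. g \<otimes>\<^bsub>G\<^esub> a \<in> X) \<or> (\<forall>x\<in>X. inv\<^bsub>G\<^esub> g \<otimes>\<^bsub>G\<^esub> x \<in> half G B A)) \<and>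
     (\<forall>g\<in>X. (\<forall>b\<in>B. g \<otimes>\<^bsub>G\<^esub> b \<in> X) \<or> (\<forall>x\<in>X. inv\<^bsub>G\<^esub> g \<otimes>\<^bsub>G\<^esub> x \<in> half G A B))"

lemma tree_likeD:
  assumes "tree_like G A B X"
  shows "X \<subseteq> carrier G" and "\<And>h c. h \<in> X \<Longrightarrow> c \<in> A \<inter> B \<Longrightarrow> h \<otimes>\<^bsub>G\<^esub> c \<in> X"
    and "\<And>h. h \<in> X \<Longrightarrow>
      (\<forall>a\<in>A. h \<otimes>\<^bsub>G\<^esub> a \<in> X) \<or> (\<forall>x\<in>X. inv\<^bsub>G\<^esub> h \<otimes>\<^bsub>G\<^esub> x \<in> half G B A)"
    and "\<And>h. h \<in> X \<Longrightarrow>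
      (\<forall>b\<in>B. h \<otimes>\<^bsub>G\<^esub> b \<in> X) \<or> (\<forall>x\<in>X. inv\<^bsub>G\<^esub> h \<otimes>\<^bsub>G\<^esub> x \<in> half G A B)"
  using assms unfolding tree_like_def by (elim conjE; metis)+

lemma tree_like_swap: "tree_like G A B X \<Longrightarrow> tree_like G B A X"
  unfolding tree_like_def by (simp add: Int_commute)

context ping_pong
begin

lemma tree_like_A: "tree_like G A B A"
proof -
  have "g \<otimes> a \<in> A" "inv g \<otimes> a \<in> A" if "g \<in> A" "a \<in> A" for g a
    using A that by (auto intro: subgroup.m_closed subgroup.m_inv_closed)
  moreover from this have "inv g \<otimes> a \<in> half G A B" if "g \<in> A" "a \<in> A" for g a
    using A_subset_half that by blast
  ultimately show ?thesis unfolding tree_like_def using A_subset by blast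
qed

lemma inv_mult_cancel:
  assumes "g \<in> carrier G" "h \<in> carrier G" "x \<in> carrier G"
  shows "inv h \<otimes> x = (inv h \<otimes> g) \<otimes> (inv g \<otimes> x)" "inv g \<otimes> (g \<otimes> x) = x" "g \<otimes> (inv g \<otimes> x) = x"
proof -
  show 1: "g \<otimes> (inv g \<otimes> x) = x" using assms by (simp flip: m_assoc)
  show "inv h \<otimes> x = (inv h \<otimes> g) \<otimes> (inv g \<otimes> x)" using assms 1 by (simp add: m_assoc)
  show "inv g \<otimes> (g \<otimes> x) = x" using assms by (simp flip: m_assoc)
qed

text \<open>If \<open>g A\<close> is new, then \<open>X\<close> lies on the \<open>B\<close> side of
  the edge at \<open>g\<close>. An old edge outside \<open>g A\<close> that had \<open>X\<close> on
  one side has the new coset on the same side as \<open>g\<close>. A new edge \<open>g a\<close> has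
  everything on its \<open>A\<close> side.\<close>

lemma tree_like_extend:
  assumes X: "tree_like G A B X" and g: "g \<in> X"
  shows "tree_like G A B (X \<union> (\<otimes>) g ` A)"
proof (cases "\<forall>a\<in>A. g \<otimes> a \<in> X")
  case True
  then have "X \<union> (\<otimes>) g ` A = X" by auto
  then show ?thesis using X by simp
next
  case False
  note Xc = tree_likeD(1)[OF X] and XC = tree_likeD(2)[OF X]
    and XA = tree_likeD(3)[OF X] and XB = tree_likeD(4)[OF X]
  have gc: "g \<in> carrier G" using g Xc by blast
  have g_half: "inv g \<otimes> x \<in> half G B A" if "x \<in> X" for x using XA[OF g] False that by blast
  let ?X = "X \<union> (\<otimes>) g ` A"
  have A_closed: "\<And>a b. a \<in> A \<Longrightarrow> b \<in> A \<Longrightarrow> a \<otimes> b \<in> A" "\<And>a. a \<in> A \<Longrightarrow> inv a \<in> A"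
    using A by (auto intro: subgroup.m_closed subgroup.m_inv_closed)
  have coset: "g \<otimes> a \<otimes> a' \<in> ?X" if "a \<in> A" "a' \<in> A" for a a'
    using that A_closed A_subset gc by (auto simp: m_assoc subset_iff)
  show ?thesis
    unfolding tree_like_def
  proof (intro conjI ballI)
    show "?X \<subseteq> carrier G" using Xc A_subset gc by auto
    fix h assume h: "h \<in> ?X"
    then have hc: "h \<in> carrier G" using Xc A_subset gc by auto
    show "h \<otimes> c \<in> ?X" if "c \<in> A \<inter> B" for c using h XC that coset by auto
    \<comment> \<open>A factor from \<open>A\<close> could lead out of \<open>half G B A\<close>
      only if \<open>inv h \<otimes> g\<close> were in \<open>A\<close>, that is, if
      \<open>h\<close> were in the new coset.\<close>
    have outside: "inv h \<otimes> g \<notin> A" if "h \<notin> (\<otimes>) g ` A"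
    proof
      assume "inv h \<otimes> g \<in> A"
      then have "inv (inv h \<otimes> g) \<in> A" by (rule A_closed)
      then have "inv g \<otimes> h \<in> A" using hc gc by (simp add: inv_mult_group)
      then have "g \<otimes> (inv g \<otimes> h) \<in> (\<otimes>) g ` A" by blast
      then show False using that inv_mult_cancel(3)[OF gc hc hc] by simp
    qed
    show "(\<forall>a\<in>A. h \<otimes> a \<in> ?X) \<or> (\<forall>x\<in>?X. inv h \<otimes> x \<in> half G B A)"
    proof (cases "h \<in> (\<otimes>) g ` A")
      case True
      then show ?thesis using coset by blast
    next
      case nin: False
      then have hX: "h \<in> X" using h by blast
      show ?thesis
      proof (cases "\<forall>a\<in>A. h \<otimes> a \<in> X")
        case False
        then have hh: "inv h \<otimes> x \<in> half G B A" if "x \<in> X" for x using XA[OF hX] that by blast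
        have "inv h \<otimes> (g \<otimes> a) \<in> half G B A" if "a \<in> A" for a
        proof -
          have "inv h \<otimes> g \<otimes> a \<in> half G B A"
            using half_mult_right[OF B A hh[OF g]] that outside[OF nin] by blast
          then show ?thesis using hc gc that A_subset by (auto simp: m_assoc)
        qed
        then show ?thesis using hh by blast
      qed blast
    qed
    show "(\<forall>b\<in>B. h \<otimes> b \<in> ?X) \<or> (\<forall>x\<in>?X. inv h \<otimes> x \<in> half G A B)"
    proof (cases "h \<in> X")
      case hX: True
      show ?thesis
      proof (cases "\<forall>b\<in>B. h \<otimes> b \<in> X")
        case False
        then have hh: "inv h \<otimes> x \<in> half G A B" if "x \<in> X" for x using XB[OF hX] that by blast
        have "inv h \<otimes> (g \<otimes> a) \<in> half G A B" if "a \<in> A" for a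
        proof -
          have "inv h \<otimes> g \<otimes> a \<in> half G A B"
            using half_mult_right[OF A B hh[OF g]] that by blast
          then show ?thesis using hc gc that A_subset by (auto simp: m_assoc)
        qed
        then show ?thesis using hh by blast
      qed blast
    next
      case False
      then obtain a where a: "a \<in> A" "h = g \<otimes> a" using h by blast
      have ac: "a \<in> carrier G" using a A_subset by blast
      have "a \<notin> B" using False XC[OF g] a by blast
      then have ia: "inv a \<in> A - B"
        using a A_closed B ac by (metis DiffI inv_inv subgroup.m_inv_closed)
      have ih: "inv h = inv a \<otimes> inv g" using a ac gc by (simp add: inv_mult_group)
      have "inv h \<otimes> x \<in> half G A B" if x: "x \<in> ?X" for x
      proof (cases "x \<in> X")
        case True
        \<comment> \<open>The way from \<open>h\<close> into \<open>X\<close> starts with the letter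
          \<open>inv a\<close> from \<open>A - B\<close> and continues on the \<open>B\<close> side
          of the edge at \<open>g\<close>.\<close>
        then have "altern G A B (inv a \<otimes> (inv g \<otimes> x))" using mult_half_swap[OF ia g_half] by blast
        then show ?thesis using ih ac gc True Xc by (auto simp: half_def m_assoc)
      next
        case False
        then obtain a' where a': "a' \<in> A" "x = g \<otimes> a'" using x by blast
        then have "inv h \<otimes> x = inv a \<otimes> a'"
          using ih ac gc A_subset inv_mult_cancel(2)[OF gc gc, of a'] by (auto simp: m_assoc)
        then show ?thesis using a a' A_closed A_subset_half by auto
      qed
      then show ?thesis by blast
    qed
  qed
qed

end

section \<open>Walks through cosets and distances in the whole group\<close>

context amalgam_splitting
begin

abbreviation "S \<equiv> SA \<union> SB"
abbreviation "wdist \<equiv> word_metric G S"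

lemma S_subset: "S \<subseteq> carrier G"
proof -
  have "SA \<subseteq> carrier G" using SA(1) A_subset by (rule order_trans)
  moreover have "SB \<subseteq> carrier G" using SB(1) B_subset by (rule order_trans)
  ultimately show ?thesis by (rule Un_least)
qed

lemma generator_cases:
  assumes "s \<in> S \<union> (\<lambda>s. inv s) ` S" shows "s \<in> A \<union> B"
proof -
  have "s \<in> A \<union> B" if "s \<in> S" for s using that SA(1) SB(1) by blast
  moreover have "inv s \<in> A \<union> B" if "s \<in> A \<union> B" for s
    using that subgroup.m_inv_closed[OF A] subgroup.m_inv_closed[OF B] by blast
  ultimately show ?thesis using assms by blast
qed

text \<open>Right multiplication by a generator leaves \<open>half G B A\<close> only from \<open>A \<inter> B\<close>.\<close>

lemma crossing:
  assumes g: "g \<in> carrier G" and "(x, y) \<in> word_step G S ^^ n" "x \<in> carrier G"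
    and "inv g \<otimes> x \<in> half G B A" "inv g \<otimes> y \<in> half G A B"
  shows "\<exists>k\<in>carrier G. inv g \<otimes> k \<in> A \<inter> B \<and>
    (\<exists>i j. i + j = n \<and> (x, k) \<in> word_step G S ^^ i \<and> (k, y) \<in> word_step G S ^^ j)"
  using assms(2-)
proof (induction n arbitrary: x)
  case 0
  then have "inv g \<otimes> x \<in> A \<inter> B" using half_Int by auto
  then show ?case using 0 by auto
next
  case (Suc n)
  show ?case
  proof (cases "inv g \<otimes> x \<in> A \<inter> B")
    case True
    then show ?thesis
      using Suc.prems by (intro bexI[of _ x] conjI exI[of _ 0] exI[of _ "Suc n"]) simp_all
  next
    case False
    obtain x' where x': "(x, x') \<in> word_step G S" "(x', y) \<in> word_step G S ^^ n"
      using Suc.prems(1) by (meson relpow_Suc_D2)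
    then obtain s where s: "s \<in> S \<union> (\<lambda>s. inv s) ` S" "x' = x \<otimes> s" by (auto simp: word_step_iff)
    have sAB: "s \<in> A \<union> B" using s generator_cases by blast
    have sc: "s \<in> carrier G" using sAB A_subset B_subset by blast
    have "inv g \<otimes> x \<otimes> s \<in> half G B A"
      using half_mult_right[OF B A Suc.prems(3)] sAB False by blast
    then have "inv g \<otimes> x' \<in> half G B A" using s sc g Suc.prems by (simp add: m_assoc)
    moreover have "x' \<in> carrier G" using s sc Suc.prems by simp
    ultimately obtain k i j where k: "k \<in> carrier G" "inv g \<otimes> k \<in> A \<inter> B" "i + j = n"
        "(x', k) \<in> word_step G S ^^ i" "(k, y) \<in> word_step G S ^^ j"
      using Suc.IH[OF x'(2)] Suc.prems(4) by blast
    have "(x, k) \<in> word_step G S ^^ Suc i" using x'(1) k(4) by (rule relpow_Suc_I2)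
    then show ?thesis using k by (intro bexI[of _ k] conjI exI[of _ "Suc i"] exI[of _ j]) auto
  qed
qed

text \<open>Here the metric estimates use that the generating sets contain every non-trivial element
  of \<open>A \<inter> B\<close>: moving inside a coset of this subgroup takes one step.\<close>

lemma step_C:
  assumes "x \<in> carrier G" "c \<in> A \<inter> B" "c \<noteq> \<one>"
  shows "(x, x \<otimes> c) \<in> word_step G SA" "(x, x \<otimes> c) \<in> word_step G S"
proof -
  have "c \<in> SA" using assms(2,3) SA(2) by blast
  then show "(x, x \<otimes> c) \<in> word_step G SA" "(x, x \<otimes> c) \<in> word_step G S"
    using assms(1) unfolding word_step_iff by blast+
qed

text \<open>A path between two elements of \<open>A\<close> that leaves \<open>A\<close> returns to the coset of \<open>A \<inter> B\<close> in which
  it left, so the excursion can be replaced by at most one step.\<close>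

lemma shortcut:
  assumes "(z, y) \<in> word_step G S ^^ n" "y \<in> A"
  shows "(z \<in> A \<longrightarrow> (\<exists>m\<le>n. (z, y) \<in> word_step G SA ^^ m)) \<and>
    (\<forall>a u c. a \<in> A \<longrightarrow> altern G B A u \<longrightarrow> z = a \<otimes> u \<longrightarrow> c \<in> A \<inter> B \<longrightarrow>
       (\<exists>m\<le>n. (a \<otimes> c, y) \<in> word_step G SA ^^ m))"
  using assms(1)
proof (induction n arbitrary: z)
  case 0
  \<comment> \<open>In the second clause the walk is on an excursion that left \<open>A\<close> in
    the coset of \<open>a\<close>. It cannot be at \<open>y\<close> yet, as
    \<open>a \<otimes> u\<close> in \<open>A\<close> would put \<open>u\<close> in
    \<open>A\<close>.\<close>
  have "False" if "a \<in> A" "altern G B A u" "a \<otimes> u \<in> A" for a u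
  proof -
    have "u \<in> carrier G" using altern_closed[OF that(2) B A] .
    then have "inv a \<otimes> (a \<otimes> u) = u" using that A_subset by (intro inv_mult_cancel(2)) auto
    moreover have "inv a \<otimes> (a \<otimes> u) \<in> A"
      using that A by (auto intro: subgroup.m_closed subgroup.m_inv_closed)
    ultimately show False using ping_pong.altern_disjoint(3)[OF swap that(2)] by simp
  qed
  then show ?case using 0 assms(2) by auto
next
  case (Suc n)
  obtain z' where z': "(z, z') \<in> word_step G S" "(z', y) \<in> word_step G S ^^ n"
    using Suc.prems(1) by (meson relpow_Suc_D2)
  then obtain s where s: "s \<in> S \<union> (\<lambda>s. inv s) ` S" "z' = z \<otimes> s" and zc: "z \<in> carrier G"
    by (auto simp: word_step_iff)
  have sAB: "s \<in> A \<union> B" using s generator_cases by blast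
  have sc: "s \<in> carrier G" using sAB A_subset B_subset by blast
  note IH = Suc.IH[OF z'(2)]
  have A_closed: "\<And>a b. a \<in> A \<Longrightarrow> b \<in> A \<Longrightarrow> a \<otimes> b \<in> A" "\<And>a. a \<in> A \<Longrightarrow> inv a \<in> A"
    using A by (auto intro: subgroup.m_closed subgroup.m_inv_closed)
  have C_closed: "\<And>c c'. c \<in> A \<inter> B \<Longrightarrow> c' \<in> A \<inter> B \<Longrightarrow> inv c \<otimes> c' \<in> A \<inter> B"
    using A B by (auto intro: subgroup.m_closed subgroup.m_inv_closed)
  show ?case
  proof (intro conjI impI allI)
    assume zA: "z \<in> A"
    show "\<exists>m\<le>Suc n. (z, y) \<in> word_step G SA ^^ m"
    proof (cases "s \<in> A")
      case True
      then have "z' \<in> A" using zA s A_closed by blast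
      then obtain m where m: "m \<le> n" "(z', y) \<in> word_step G SA ^^ m" using IH by blast
      have "(z, z') \<in> word_step G SA" if "s \<noteq> \<one>"
      proof (cases "s \<in> B")
        case True
        then show ?thesis using step_C(1)[OF zc, of s] \<open>s \<in> A\<close> that s by blast
      next
        case False
        have "s \<notin> SB \<union> (\<lambda>s. inv s) ` SB" using False SB B by (auto intro: subgroup.m_inv_closed)
        then have "s \<in> SA \<union> (\<lambda>s. inv s) ` SA" using s by blast
        then show ?thesis using zc s by (auto simp: word_step_iff)
      qed
      then have "s \<noteq> \<one> \<Longrightarrow> (z, y) \<in> word_step G SA ^^ Suc m" using m relpow_Suc_I2 by metis
      \<comment> \<open>A trivial letter may come from \<open>SB\<close> alone; such a step is
        dropped.\<close>
      moreover have "s = \<one> \<Longrightarrow> z' = z" using s zc by simp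
      ultimately show ?thesis using m by (cases "s = \<one>") (blast intro: le_SucI Suc_le_mono[THEN iffD2])+
    next
      case False
      \<comment> \<open>An excursion begins: its exit point is \<open>z\<close>, its first letter is
        \<open>s\<close>, and the second clause is used with \<open>c = \<one>\<close>.\<close>
      then have "altern G B A s" using sAB by (intro altern.single) auto
      moreover have "\<one> \<in> A \<inter> B" using A B by (auto intro: subgroup.one_closed)
      ultimately obtain m where "m \<le> n" "(z \<otimes> \<one>, y) \<in> word_step G SA ^^ m" using IH zA s by blast
      then show ?thesis using zc by (auto intro: le_SucI)
    qed
  next
    fix a u c assume a: "a \<in> A" and u: "altern G B A u" and z: "z = a \<otimes> u" and c: "c \<in> A \<inter> B"
    have uc: "u \<in> carrier G" using altern_closed[OF u B A] .
    have ac: "a \<in> carrier G" "c \<in> carrier G" using a c A_subset by auto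
    have z'au: "z' = a \<otimes> (u \<otimes> s)" using s z ac uc sc by (simp add: m_assoc)
    have "u \<otimes> s \<in> half G B A" using altern_mult_right[OF u B A] sAB by blast
    then consider "altern G B A (u \<otimes> s)" | "u \<otimes> s \<in> A \<inter> B" by (auto simp: half_def)
    then show "\<exists>m\<le>Suc n. (a \<otimes> c, y) \<in> word_step G SA ^^ m"
    proof cases
      case 1
      then obtain m where "m \<le> n" "(a \<otimes> c, y) \<in> word_step G SA ^^ m" using IH a c z'au by blast
      then show ?thesis by (blast intro: le_SucI)
    next
      case 2
      then have "z' \<in> A" using z'au a A_closed by auto
      then obtain m where m: "m \<le> n" "(z', y) \<in> word_step G SA ^^ m" using IH by blast
      \<comment> \<open>The walk is back in the coset \<open>a (A \<inter> B)\<close>. The return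
        point is at most one generator away from \<open>a \<otimes> c\<close>, which is paid for by
        the step just taken.\<close>
      let ?c = "inv c \<otimes> (u \<otimes> s)"
      have "z' = a \<otimes> c \<otimes> ?c"
        unfolding z'au using ac uc sc inv_mult_cancel(3)[of c c "u \<otimes> s"] by (simp add: m_assoc)
      moreover have "?c \<in> A \<inter> B" using C_closed c 2 by blast
      ultimately have "z' = a \<otimes> c \<or> (a \<otimes> c, z') \<in> word_step G SA"
        using step_C(1)[of "a \<otimes> c" ?c] ac by (cases "?c = \<one>") auto
      then show ?thesis using m relpow_Suc_I2 by (metis Suc_le_mono le_SucI)
    qed
  qed
qed

text \<open>One inequality holds because \<open>SA\<close> is part of the generating set; the other
  applies \<open>shortcut\<close> to a shortest walk.\<close>

lemma word_metric_A:
  assumes "x \<in> A" "y \<in> A" shows "wdist x y = word_metric G SA x y"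
proof -
  have c: "x \<in> carrier G" "y \<in> carrier G" using assms A_subset by auto
  obtain n where n: "wdist x y = real n" "(x, y) \<in> word_step G S ^^ n"
    using word_metric_attained[OF S_subset gen_S c] .
  have SAc: "SA \<subseteq> carrier G" using S_subset by blast
  obtain m where m: "m \<le> n" "(x, y) \<in> word_step G SA ^^ m" using shortcut[OF n(2) assms(2)] assms by blast
  let ?l = "LEAST k. (x, y) \<in> word_step G SA ^^ k"
  have l: "?l \<le> n" using m Least_le[of "\<lambda>k. (x, y) \<in> word_step G SA ^^ k" m] by simp
  have "(x, y) \<in> word_step G SA ^^ ?l" using m(2) by (rule LeastI)
  moreover have "word_step G SA \<subseteq> word_step G S" by (auto simp: word_step_def)
  ultimately have "(x, y) \<in> word_step G S ^^ ?l" using relpow_subset by blast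
  then have "wdist x y \<le> real ?l" by (rule word_metric_le[OF S_subset gen_S c])
  then show ?thesis using l n word_metric_Least[OF SAc c] by simp
qed

text \<open>If the coset is new, \<open>X\<close> and \<open>g A\<close> lie on different sides of
  the edge at \<open>g\<close>. They meet exactly in \<open>g (A \<inter> B)\<close>, and by
  \<open>crossing\<close> a shortest walk between them passes through it, as
  \<open>compactly_null_rips_glue\<close> requires.\<close>

lemma compactly_null_extend:
  assumes X: "tree_like G A B X" and g: "g \<in> X" and r: "1 \<le> r"
    and null: "compactly_null (geometric_realization (rips_complex X wdist r))"
      "compactly_null (geometric_realization (rips_complex ((\<otimes>) g ` A) wdist r))"
  shows "compactly_null (geometric_realization (rips_complex (X \<union> (\<otimes>) g ` A) wdist r))"
proof (cases "\<forall>a\<in>A. g \<otimes> a \<in> X")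
  case True
  then have "X \<union> (\<otimes>) g ` A = X" by auto
  then show ?thesis using null by simp
next
  case False
  note Xc = tree_likeD(1)[OF X] and XC = tree_likeD(2)[OF X]
  have g_half: "inv g \<otimes> x \<in> half G B A" if "x \<in> X" for x
    using tree_likeD(3)[OF X g] False that by blast
  have gc: "g \<in> carrier G" using g Xc by blast
  let ?Y = "(\<otimes>) g ` A"
  have Yc: "X \<union> ?Y \<subseteq> carrier G" using Xc gc A_subset by auto
  have inY: "inv g \<otimes> y \<in> A" if "y \<in> ?Y" for y
    using that gc A_subset inv_mult_cancel(2)[OF gc gc] by auto
  have XY: "X \<inter> ?Y = (\<otimes>) g ` (A \<inter> B)"
  proof
    show "X \<inter> ?Y \<subseteq> (\<otimes>) g ` (A \<inter> B)"
    proof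
      fix x assume x: "x \<in> X \<inter> ?Y"
      then have "inv g \<otimes> x \<in> A \<inter> B" using g_half inY half_swap_Int_A by blast
      moreover have "x = g \<otimes> (inv g \<otimes> x)" using x Xc inv_mult_cancel(3)[OF gc gc, of x] by auto
      ultimately show "x \<in> (\<otimes>) g ` (A \<inter> B)" by blast
    qed
    show "(\<otimes>) g ` (A \<inter> B) \<subseteq> X \<inter> ?Y" using XC[OF g] by auto
  qed
  show ?thesis
  proof (rule compactly_null_rips_glue[OF _ _ r _ _ _ _ _ null])
    show "finite (X \<inter> ?Y)" unfolding XY using finite_C by simp
    have "\<one> \<in> A \<inter> B" using A B by (auto intro: subgroup.one_closed)
    then have "g \<otimes> \<one> \<in> X \<inter> ?Y" unfolding XY by blast
    then show "g \<in> X \<inter> ?Y" using gc by simp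
  next
    fix k l assume k: "k \<in> X \<inter> ?Y" and l: "l \<in> X \<inter> ?Y"
    then obtain c c' where c: "c \<in> A \<inter> B" "c' \<in> A \<inter> B" "k = g \<otimes> c" "l = g \<otimes> c'"
      unfolding XY by blast
    have cc: "c \<in> carrier G" "c' \<in> carrier G" using c A_subset by auto
    have C: "inv c \<otimes> c' \<in> A \<inter> B"
      using c A B by (auto intro: subgroup.m_closed subgroup.m_inv_closed)
    have kl: "k \<in> carrier G" "l \<in> carrier G" using k l Xc by auto
    have l_eq: "l = k \<otimes> (inv c \<otimes> c')"
      using c cc gc inv_mult_cancel(3)[of c c c'] by (simp add: m_assoc)
    have "\<exists>n\<le>1. (k, l) \<in> word_step G S ^^ n"
    proof (cases "inv c \<otimes> c' = \<one>")
      case True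
      then show ?thesis using l_eq kl by (intro exI[of _ 0]) simp
    next
      case False
      then have "(k, l) \<in> word_step G S ^^ 1" using step_C(2)[OF kl(1) C] l_eq by simp
      then show ?thesis by blast
    qed
    then show "wdist k l \<le> 1" using word_metric_le[OF S_subset gen_S kl] by fastforce
  next
    fix x y assume x: "x \<in> X" and y: "y \<in> ?Y"
    have c: "x \<in> carrier G" "y \<in> carrier G" using x y Yc by auto
    obtain n where n: "wdist x y = real n" "(x, y) \<in> word_step G S ^^ n"
      using word_metric_attained[OF S_subset gen_S c] .
    have "inv g \<otimes> y \<in> half G A B" using inY[OF y] A_subset_half by blast
    then obtain k i j where k: "k \<in> carrier G" "inv g \<otimes> k \<in> A \<inter> B" "i + j = n"
        "(x, k) \<in> word_step G S ^^ i" "(k, y) \<in> word_step G S ^^ j"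
      using crossing[OF gc n(2) c(1) g_half[OF x]] by blast
    have "k = g \<otimes> (inv g \<otimes> k)" using inv_mult_cancel(3)[OF gc gc k(1)] by simp
    then have "k \<in> X \<inter> ?Y" unfolding XY using k(2) by blast
    moreover have "wdist x k \<le> real i" "wdist k y \<le> real j"
      using word_metric_le[OF S_subset gen_S] c k by auto
    ultimately show "\<exists>k\<in>X \<inter> ?Y. wdist x k + wdist k y \<le> wdist x y" using n k(3) by force
  next
    fix x y assume "x \<in> X \<union> ?Y" "y \<in> X \<union> ?Y"
    then have c: "x \<in> carrier G" "y \<in> carrier G" using Yc by auto
    show "wdist x y = wdist y x" by (rule word_metric_sym[OF S_subset gen_S c])
    show "1 \<le> wdist x y" if "x \<noteq> y" by (rule word_metric_ge_1[OF S_subset gen_S c that])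
    fix z assume "z \<in> X \<union> ?Y"
    then have "z \<in> carrier G" using Yc by auto
    then show "wdist x z \<le> wdist x y + wdist y z"
      by (rule word_metric_triangle[OF S_subset gen_S c])
  qed
qed

end

text \<open>Finite subtrees containing the vertex \<open>A\<close>, each given by the union of its
  cosets. Attaching a coset that is already present changes nothing, so the rules do not ask for a
  new one.\<close>

inductive coset_tree :: "('a, 'm) monoid_scheme \<Rightarrow> 'a set \<Rightarrow> 'a set \<Rightarrow> 'a set \<Rightarrow> bool"
  for G (structure) and A B where
  base: "coset_tree G A B A"
| left: "coset_tree G A B X \<Longrightarrow> g \<in> X \<Longrightarrow> coset_tree G A B (X \<union> (\<otimes>) g ` A)"
| right: "coset_tree G A B X \<Longrightarrow> g \<in> X \<Longrightarrow> coset_tree G A B (X \<union> (\<otimes>) g ` B)"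

context amalgam_splitting
begin

text \<open>Spelling out \<open>x\<close> from \<open>g\<close>, the coset of \<open>A\<close> or
  \<open>B\<close> through the current point is attached at every letter. Tree and start vary so
  that the two parts of a product can be chained.\<close>

lemma coset_tree_reach:
  assumes "x \<in> generate G (A \<union> B)" "coset_tree G A B X" "g \<in> X"
  shows "\<exists>X'. coset_tree G A B X' \<and> X \<subseteq> X' \<and> g \<otimes> x \<in> X'"
  using assms
proof (induction arbitrary: X g)
  have extend: "\<exists>X'. coset_tree G A B X' \<and> X \<subseteq> X' \<and> g \<otimes> s \<in> X'"
    if "coset_tree G A B X" "g \<in> X" "s \<in> A \<union> B" for X g s
    using that coset_tree.left[OF that(1,2)] coset_tree.right[OF that(1,2)] by blast
  {
    case one
    have "\<one> \<in> A \<union> B" using A by (auto intro: subgroup.one_closed)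
    then show ?case using extend one by blast
  next
    case (incl s)
    then show ?case using extend by blast
  next
    case (inv s)
    then have "inv s \<in> A \<union> B" using A B by (auto intro: subgroup.m_inv_closed)
    then show ?case using extend inv by blast
  next
    case (eng x y)
    obtain X' where X': "coset_tree G A B X'" "X \<subseteq> X'" "g \<otimes> x \<in> X'" using eng by blast
    obtain X'' where X'': "coset_tree G A B X''" "X' \<subseteq> X''" "g \<otimes> x \<otimes> y \<in> X''"
      using eng.IH(2)[OF X'(1,3)] by blast
    have "Z \<subseteq> carrier G" if "coset_tree G A B Z" for Z
      using that A_subset B_subset by induction auto
    then have "g \<in> carrier G" using eng.prems by blast
    moreover have "x \<in> carrier G" "y \<in> carrier G" using eng.hyps gen by auto
    ultimately show ?case using X' X'' by (auto simp: m_assoc)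
  }
qed

text \<open>Membership of \<open>\<one>\<close> is carried along as the point from which the next
  element of \<open>V\<close> is reached.\<close>

lemma coset_tree_finite:
  assumes "finite V" "V \<subseteq> carrier G"
  shows "\<exists>X. coset_tree G A B X \<and> V \<subseteq> X \<and> \<one> \<in> X"
  using assms
proof induction
  case empty
  then show ?case using coset_tree.base[of G A B] A by (auto intro: subgroup.one_closed)
next
  case (insert v V)
  then obtain X where X: "coset_tree G A B X" "V \<subseteq> X" "\<one> \<in> X" by blast
  obtain X' where "coset_tree G A B X'" "X \<subseteq> X'" "\<one> \<otimes> v \<in> X'"
    using coset_tree_reach[OF _ X(1,3), of v] insert.prems gen by auto
  then show ?case using X insert.prems by auto
qed

lemma tree_like_coset_tree:
  assumes "coset_tree G A B X" shows "tree_like G A B X"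
  using assms
proof induction
  case base
  then show ?case by (rule tree_like_A)
next
  case (left X g)
  then show ?case by (intro tree_like_extend)
next
  case (right X g)
  then show ?case
    using ping_pong.tree_like_extend[OF swap] tree_like_swap by metis
qed

text \<open>Attaching one coset at a time keeps the Rips complex of a coset tree \<open>X\<close>
  compactly null. Finite sets of vertices lie in such an \<open>X\<close>, and simplices on them
  belong to its Rips complex, so the coset trees are the stages for
  \<open>compactly_null_directed\<close>.\<close>

theorem contractible_rips:
  assumes r: "1 \<le> r"
    and null: "\<And>g. g \<in> carrier G \<Longrightarrow> compactly_null (geometric_realization (rips_complex ((\<otimes>) g ` A) wdist r))"
      "\<And>g. g \<in> carrier G \<Longrightarrow> compactly_null (geometric_realization (rips_complex ((\<otimes>) g ` B) wdist r))"
  shows "contractible_space (geometric_realization (rips_complex (carrier G) wdist r))"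
proof (rule compactly_null_imp_contractible[OF abstract_complex_rips],
    rule compactly_null_directed[OF abstract_complex_rips])
  have trees: "compactly_null (geometric_realization (rips_complex X wdist r))"
    if "coset_tree G A B X" for X
    using that
  proof induction
    case base
    have "(\<otimes>) \<one> ` A = A" using A_subset by force
    then show ?case using null(1)[of \<one>] by simp
  next
    case (left X g)
    note T = tree_like_coset_tree[OF left(1)]
    then have "g \<in> carrier G" using left(2) by (auto simp: tree_like_def)
    then show ?case using compactly_null_extend[OF T left(2) r left(3)] null by blast
  next
    case (right X g)
    note T = tree_like_coset_tree[OF right(1)]
    then have "g \<in> carrier G" using right(2) by (auto simp: tree_like_def)
    then show ?case
      using amalgam_splitting.compactly_null_extend[OF swap_splitting tree_like_swap[OF T] right(2) r]
        right(3) null by (simp add: Un_commute)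
  qed
  fix V assume V: "finite V" "V \<subseteq> \<Union> (rips_complex (carrier G) wdist r)"
  have "\<Union> (rips_complex (carrier G) wdist r) \<subseteq> carrier G" by (auto simp: rips_complex_iff)
  then have "V \<subseteq> carrier G" using V(2) by (rule order_trans[rotated])
  then obtain X where X: "coset_tree G A B X" "V \<subseteq> X" using coset_tree_finite V(1) by blast
  have "X \<subseteq> carrier G" using tree_like_coset_tree[OF X(1)] by (simp add: tree_like_def)
  then have "rips_complex X wdist r \<subseteq> rips_complex (carrier G) wdist r"
    unfolding subset_iff rips_complex_iff by blast
  moreover have "{\<sigma> \<in> rips_complex (carrier G) wdist r. \<sigma> \<subseteq> V} \<subseteq> rips_complex X wdist r"
    using X(2) unfolding subset_iff mem_Collect_eq rips_complex_iff by blast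
  ultimately show "\<exists>L\<subseteq>rips_complex (carrier G) wdist r. abstract_complex L \<and>
      compactly_null (geometric_realization L) \<and> {\<sigma> \<in> rips_complex (carrier G) wdist r. \<sigma> \<subseteq> V} \<subseteq> L"
    using trees[OF X(1)] abstract_complex_rips by blast
qed

end

section \<open>Normal forms in the amalgamated product\<close>

text \<open>The choice depends on the coset only as a set, so all elements of a right coset of the
  image of \<open>C\<close> share one representative. The image itself gets \<open>\<one>\<close>,
  so that a trivial representative detects \<open>C\<close>.\<close>

definition coset_rep :: "('a, 'm) monoid_scheme \<Rightarrow> ('c, 'k) monoid_scheme \<Rightarrow> ('c \<Rightarrow> 'a) \<Rightarrow> 'a \<Rightarrow> 'a" where
  "coset_rep A C \<phi> a = (if a \<in> \<phi> ` carrier C then \<one>\<^bsub>A\<^esub>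
     else SOME t. t \<in> (\<lambda>c. \<phi> c \<otimes>\<^bsub>A\<^esub> a) ` carrier C)"

text \<open>A pair of \<open>c\<close> in \<open>C\<close> and an alternating list of coset representatives stands for the normal
  form of the corresponding product in the amalgam, which starts with \<open>c\<close>.  One factor \<open>A\<close> acts on
  these pairs by left multiplication, once the leading representative, if it belongs to \<open>A\<close>, has been
  merged with \<open>c\<close>.  The parameter \<open>tag\<close> marks the letters from \<open>A\<close>.\<close>

locale coset_side = A: group A + C: group C
  for A :: "('a, 'm) monoid_scheme" and C :: "('c, 'k) monoid_scheme" +
  fixes \<phi> :: "'c \<Rightarrow> 'a" and tag :: "'a \<Rightarrow> 'l" and NF :: "'l list \<Rightarrow> bool"
  assumes hom: "\<phi> \<in> hom C A" and inj: "inj_on \<phi> (carrier C)" and tag: "inj tag"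
    and NF_tag: "\<And>t s. NF (tag t # s) \<longleftrightarrow> t \<in> carrier A \<and> coset_rep A C \<phi> t = t \<and> t \<noteq> \<one>\<^bsub>A\<^esub> \<and>
           NF s \<and> \<not> (s \<noteq> [] \<and> hd s \<in> range tag)"
begin

sublocale h: group_hom C A \<phi> by unfold_locales (rule hom)

abbreviation "rep \<equiv> coset_rep A C \<phi>"

definition headed :: "'l list \<Rightarrow> bool" where
  "headed s \<longleftrightarrow> s \<noteq> [] \<and> hd s \<in> range tag"

definition coef :: "'a \<Rightarrow> 'c" where
  "coef a = (SOME c. c \<in> carrier C \<and> a = \<phi> c \<otimes>\<^bsub>A\<^esub> rep a)"

definition \<Omega> :: "('c \<times> 'l list) set" where
  "\<Omega> = {(c, s). c \<in> carrier C \<and> NF s}"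

text \<open>On \<open>\<Omega>\<close>, \<open>peel\<close> splits off a factor from
  \<open>A\<close> such that the remaining list does not begin with a letter from \<open>A\<close>,
  and \<open>push\<close> undoes this. In these coordinates the action is left multiplication on the
  first component, whence \<open>act_mult\<close>, \<open>act_one\<close> and
  \<open>act_inj\<close>.\<close>

definition peel :: "'c \<times> 'l list \<Rightarrow> 'a \<times> 'l list" where
  "peel w = (if headed (snd w) then (\<phi> (fst w) \<otimes>\<^bsub>A\<^esub> the_inv tag (hd (snd w)), tl (snd w))
     else (\<phi> (fst w), snd w))"

definition push :: "'a \<Rightarrow> 'l list \<Rightarrow> 'c \<times> 'l list" where
  "push a s = (coef a, if rep a = \<one>\<^bsub>A\<^esub> then s else tag (rep a) # s)"

definition act :: "'a \<Rightarrow> 'c \<times> 'l list \<Rightarrow> 'c \<times> 'l list" where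
  "act a w = push (a \<otimes>\<^bsub>A\<^esub> fst (peel w)) (snd (peel w))"

lemma headed_simps [simp]: "\<not> headed []" "headed (x # s) \<longleftrightarrow> x \<in> range tag"
  by (auto simp: headed_def)

lemma NF_tagged: "NF (tag t # s) \<longleftrightarrow> t \<in> carrier A \<and> rep t = t \<and> t \<noteq> \<one>\<^bsub>A\<^esub> \<and> NF s \<and> \<not> headed s"
  by (simp add: NF_tag headed_def)

lemma image_C_mult:
  assumes "c \<in> carrier C" "a \<in> carrier A"
  shows "\<phi> c \<otimes>\<^bsub>A\<^esub> a \<in> \<phi> ` carrier C \<longleftrightarrow> a \<in> \<phi> ` carrier C"
    and "a \<otimes>\<^bsub>A\<^esub> \<phi> c \<in> \<phi> ` carrier C \<longleftrightarrow> a \<in> \<phi> ` carrier C"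
proof -
  have sub: "subgroup (\<phi> ` carrier C) A" by (rule h.img_is_subgroup)
  have c: "\<phi> c \<in> \<phi> ` carrier C" using assms by blast
  show "\<phi> c \<otimes>\<^bsub>A\<^esub> a \<in> \<phi> ` carrier C \<longleftrightarrow> a \<in> \<phi> ` carrier C"
  proof
    assume "\<phi> c \<otimes>\<^bsub>A\<^esub> a \<in> \<phi> ` carrier C"
    then have "inv\<^bsub>A\<^esub> (\<phi> c) \<otimes>\<^bsub>A\<^esub> (\<phi> c \<otimes>\<^bsub>A\<^esub> a) \<in> \<phi> ` carrier C"
      using sub c by (auto intro: subgroup.m_closed subgroup.m_inv_closed)
    then show "a \<in> \<phi> ` carrier C" using assms by (simp flip: A.m_assoc)
  qed (use sub c in \<open>auto intro: subgroup.m_closed\<close>)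
  show "a \<otimes>\<^bsub>A\<^esub> \<phi> c \<in> \<phi> ` carrier C \<longleftrightarrow> a \<in> \<phi> ` carrier C"
  proof
    assume "a \<otimes>\<^bsub>A\<^esub> \<phi> c \<in> \<phi> ` carrier C"
    then have "(a \<otimes>\<^bsub>A\<^esub> \<phi> c) \<otimes>\<^bsub>A\<^esub> inv\<^bsub>A\<^esub> (\<phi> c) \<in> \<phi> ` carrier C"
      using sub c by (auto intro: subgroup.m_closed subgroup.m_inv_closed)
    then show "a \<in> \<phi> ` carrier C" using assms by (simp add: A.m_assoc)
  qed (use sub c in \<open>auto intro: subgroup.m_closed\<close>)
qed

lemma coset_image:
  assumes "c \<in> carrier C" "a \<in> carrier A"
  shows "(\<lambda>d. \<phi> d \<otimes>\<^bsub>A\<^esub> (\<phi> c \<otimes>\<^bsub>A\<^esub> a)) ` carrier C = (\<lambda>d. \<phi> d \<otimes>\<^bsub>A\<^esub> a) ` carrier C"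
proof
  show "(\<lambda>d. \<phi> d \<otimes>\<^bsub>A\<^esub> (\<phi> c \<otimes>\<^bsub>A\<^esub> a)) ` carrier C \<subseteq> (\<lambda>d. \<phi> d \<otimes>\<^bsub>A\<^esub> a) ` carrier C"
  proof
    fix x assume "x \<in> (\<lambda>d. \<phi> d \<otimes>\<^bsub>A\<^esub> (\<phi> c \<otimes>\<^bsub>A\<^esub> a)) ` carrier C"
    then obtain d where d: "d \<in> carrier C" "x = \<phi> d \<otimes>\<^bsub>A\<^esub> (\<phi> c \<otimes>\<^bsub>A\<^esub> a)" by blast
    then have "x = \<phi> (d \<otimes>\<^bsub>C\<^esub> c) \<otimes>\<^bsub>A\<^esub> a" using assms by (simp add: A.m_assoc)
    then show "x \<in> (\<lambda>d. \<phi> d \<otimes>\<^bsub>A\<^esub> a) ` carrier C" using d assms by blast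
  qed
  show "(\<lambda>d. \<phi> d \<otimes>\<^bsub>A\<^esub> a) ` carrier C \<subseteq> (\<lambda>d. \<phi> d \<otimes>\<^bsub>A\<^esub> (\<phi> c \<otimes>\<^bsub>A\<^esub> a)) ` carrier C"
  proof
    fix x assume "x \<in> (\<lambda>d. \<phi> d \<otimes>\<^bsub>A\<^esub> a) ` carrier C"
    then obtain d where d: "d \<in> carrier C" "x = \<phi> d \<otimes>\<^bsub>A\<^esub> a" by blast
    let ?e = "d \<otimes>\<^bsub>C\<^esub> inv\<^bsub>C\<^esub> c"
    have e: "?e \<in> carrier C" "?e \<otimes>\<^bsub>C\<^esub> c = d" using d assms by (simp_all add: C.m_assoc)
    have "\<phi> ?e \<otimes>\<^bsub>A\<^esub> (\<phi> c \<otimes>\<^bsub>A\<^esub> a) = \<phi> (?e \<otimes>\<^bsub>C\<^esub> c) \<otimes>\<^bsub>A\<^esub> a"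
      using e(1) assms by (simp only: h.hom_mult A.m_assoc h.hom_closed)
    also have "\<dots> = x" using e d by simp
    finally show "x \<in> (\<lambda>d. \<phi> d \<otimes>\<^bsub>A\<^esub> (\<phi> c \<otimes>\<^bsub>A\<^esub> a)) ` carrier C"
      using d assms by (metis C.inv_closed C.m_closed imageI)
  qed
qed

lemma rep_coset: "c \<in> carrier C \<Longrightarrow> a \<in> carrier A \<Longrightarrow> rep (\<phi> c \<otimes>\<^bsub>A\<^esub> a) = rep a"
  unfolding coset_rep_def using image_C_mult(1) coset_image by simp

lemma rep_mem:
  assumes a: "a \<in> carrier A"
  shows "\<exists>c\<in>carrier C. a = \<phi> c \<otimes>\<^bsub>A\<^esub> rep a" and "rep a \<in> carrier A"
proof -
  have "\<exists>c\<in>carrier C. rep a = \<phi> c \<otimes>\<^bsub>A\<^esub> a"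
  proof (cases "a \<in> \<phi> ` carrier C")
    case True
    then obtain c where c: "c \<in> carrier C" "a = \<phi> c" by blast
    then have "rep a = \<phi> (inv\<^bsub>C\<^esub> c) \<otimes>\<^bsub>A\<^esub> a" using True by (simp add: coset_rep_def)
    then show ?thesis using c by blast
  next
    case False
    have "(SOME t. t \<in> (\<lambda>c. \<phi> c \<otimes>\<^bsub>A\<^esub> a) ` carrier C) \<in> (\<lambda>c. \<phi> c \<otimes>\<^bsub>A\<^esub> a) ` carrier C"
      by (rule someI_ex) (use C.one_closed in blast)
    then show ?thesis using False by (auto simp: coset_rep_def)
  qed
  then obtain c where c: "c \<in> carrier C" "rep a = \<phi> c \<otimes>\<^bsub>A\<^esub> a" by blast
  then have "a = \<phi> (inv\<^bsub>C\<^esub> c) \<otimes>\<^bsub>A\<^esub> rep a" using a by (simp flip: A.m_assoc)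
  then show "\<exists>c\<in>carrier C. a = \<phi> c \<otimes>\<^bsub>A\<^esub> rep a" using c by blast
  show "rep a \<in> carrier A" using c a by simp
qed

lemma rep_rep: "a \<in> carrier A \<Longrightarrow> rep (rep a) = rep a"
  by (metis rep_mem rep_coset)

lemma rep_eq_one_iff:
  assumes "a \<in> carrier A" shows "rep a = \<one>\<^bsub>A\<^esub> \<longleftrightarrow> a \<in> \<phi> ` carrier C"
  using rep_mem(1)[OF assms] by (auto simp: coset_rep_def[of _ _ _ a])

lemma coef:
  assumes a: "a \<in> carrier A" shows "coef a \<in> carrier C" "a = \<phi> (coef a) \<otimes>\<^bsub>A\<^esub> rep a"
proof -
  have "\<exists>c. c \<in> carrier C \<and> a = \<phi> c \<otimes>\<^bsub>A\<^esub> rep a" using rep_mem(1)[OF a] by blast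
  from someI_ex[OF this] show "coef a \<in> carrier C" "a = \<phi> (coef a) \<otimes>\<^bsub>A\<^esub> rep a"
    by (auto simp: coef_def)
qed

text \<open>Injectivity of \<open>\<phi>\<close> makes the coefficient in \<open>C\<close> unique,
  which is what allows \<open>push\<close> to restore a peeled normal form.\<close>

lemma coef_mult:
  assumes "c \<in> carrier C" "t \<in> carrier A" "rep t = t"
  shows "coef (\<phi> c \<otimes>\<^bsub>A\<^esub> t) = c"
proof -
  have "\<phi> c \<otimes>\<^bsub>A\<^esub> t = \<phi> (coef (\<phi> c \<otimes>\<^bsub>A\<^esub> t)) \<otimes>\<^bsub>A\<^esub> t" "coef (\<phi> c \<otimes>\<^bsub>A\<^esub> t) \<in> carrier C"
    using coef[of "\<phi> c \<otimes>\<^bsub>A\<^esub> t"] rep_coset[OF assms(1,2)] assms by auto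
  then show ?thesis using assms inj by (auto simp: inj_on_def)
qed

lemma the_inv_tag [simp]: "the_inv tag (tag t) = t"
  by (rule the_inv_f_f[OF tag])

lemma peel_mem:
  assumes "w \<in> \<Omega>"
  shows "fst (peel w) \<in> carrier A" "NF (snd (peel w))" "\<not> headed (snd (peel w))"
proof -
  obtain c s where w: "w = (c, s)" "c \<in> carrier C" "NF s" using assms by (auto simp: \<Omega>_def)
  have "fst (peel w) \<in> carrier A \<and> NF (snd (peel w)) \<and> \<not> headed (snd (peel w))"
  proof (cases "headed s")
    case True
    then obtain t s' where "s = tag t # s'" by (cases s) auto
    then show ?thesis using w by (simp add: peel_def NF_tagged)
  qed (use w in \<open>simp add: peel_def\<close>)
  then show "fst (peel w) \<in> carrier A" "NF (snd (peel w))" "\<not> headed (snd (peel w))" by blast+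
qed

lemma push_mem:
  assumes "a \<in> carrier A" "NF s" "\<not> headed s"
  shows "push a s \<in> \<Omega>"
  using assms coef[OF assms(1)] rep_mem[OF assms(1)] rep_rep[OF assms(1)]
  by (simp add: push_def \<Omega>_def NF_tagged)

lemma peel_push:
  assumes "a \<in> carrier A" "\<not> headed s"
  shows "peel (push a s) = (a, s)"
  using assms coef[OF assms(1)] by (cases "rep a = \<one>\<^bsub>A\<^esub>") (auto simp: push_def peel_def)

lemma push_peel:
  assumes "w \<in> \<Omega>" shows "push (fst (peel w)) (snd (peel w)) = w"
proof -
  obtain c s where w: "w = (c, s)" "c \<in> carrier C" "NF s" using assms by (auto simp: \<Omega>_def)
  show ?thesis
  proof (cases "headed s")
    case True
    then obtain t s' where s: "s = tag t # s'" by (cases s) auto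
    then have t: "t \<in> carrier A" "rep t = t" "t \<noteq> \<one>\<^bsub>A\<^esub>" using w by (auto simp: NF_tagged)
    then show ?thesis using w s coef_mult[OF w(2) t(1,2)] rep_coset[OF w(2) t(1)]
      by (simp add: peel_def push_def)
  next
    case False
    have 1: "rep (\<phi> c) = \<one>\<^bsub>A\<^esub>" "rep \<one>\<^bsub>A\<^esub> = \<one>\<^bsub>A\<^esub>"
      using w h.hom_one C.one_closed by (auto simp: coset_rep_def intro: rev_image_eqI)
    then have "coef (\<phi> c) = c" using coef_mult[OF w(2) A.one_closed] w by simp
    then show ?thesis using w False 1 by (simp add: peel_def push_def)
  qed
qed

lemma act_mem: "a \<in> carrier A \<Longrightarrow> w \<in> \<Omega> \<Longrightarrow> act a w \<in> \<Omega>"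
  unfolding act_def using peel_mem[of w] by (intro push_mem) auto

lemma act_mult:
  assumes "a \<in> carrier A" "b \<in> carrier A" "w \<in> \<Omega>"
  shows "act a (act b w) = act (a \<otimes>\<^bsub>A\<^esub> b) w"
  using assms peel_mem[OF assms(3)] peel_push[of "b \<otimes>\<^bsub>A\<^esub> fst (peel w)" "snd (peel w)"]
  by (simp add: act_def A.m_assoc)

lemma act_one: "w \<in> \<Omega> \<Longrightarrow> act \<one>\<^bsub>A\<^esub> w = w"
  using peel_mem[of w] push_peel[of w] by (simp add: act_def)

text \<open>Through either factor an element of \<open>C\<close> changes only the leading
  coefficient, by a formula in which the factor does not occur. Hence the two actions respect the
  gluing relation.\<close>

lemma act_C:
  assumes c: "c \<in> carrier C" and w: "w \<in> \<Omega>"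
  shows "act (\<phi> c) w = (c \<otimes>\<^bsub>C\<^esub> fst w, snd w)"
proof -
  have fst_w: "fst w \<in> carrier C" using w by (auto simp: \<Omega>_def)
  let ?w = "(c \<otimes>\<^bsub>C\<^esub> fst w, snd w)"
  have "?w \<in> \<Omega>" using w c by (auto simp: \<Omega>_def)
  moreover have "peel ?w = (\<phi> c \<otimes>\<^bsub>A\<^esub> fst (peel w), snd (peel w))"
  proof (cases "headed (snd w)")
    case True
    then obtain t s' where "snd w = tag t # s'" by (cases "snd w") auto
    moreover from this have "t \<in> carrier A" using w by (auto simp: \<Omega>_def NF_tagged)
    ultimately show ?thesis using c fst_w by (simp add: peel_def A.m_assoc)
  qed (use c fst_w in \<open>simp add: peel_def\<close>)
  ultimately show ?thesis using push_peel[of ?w] by (simp add: act_def)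
qed

lemma act_inj:
  assumes "a \<in> carrier A" "b \<in> carrier A" "w \<in> \<Omega>" "act a w = act b w" shows "a = b"
proof -
  have "peel (act a w) = (a \<otimes>\<^bsub>A\<^esub> fst (peel w), snd (peel w))" if "a \<in> carrier A" for a
    unfolding act_def using peel_push peel_mem[OF assms(3)] that by simp
  then have "a \<otimes>\<^bsub>A\<^esub> fst (peel w) = b \<otimes>\<^bsub>A\<^esub> fst (peel w)" using assms by (metis fst_conv)
  then show ?thesis using assms peel_mem(1)[OF assms(3)] by simp
qed

text \<open>An element outside the image of \<open>C\<close> stays outside when multiplied by one
  inside, so a non-trivial representative comes to the front.\<close>

lemma act_headed:
  assumes "a \<in> carrier A" "a \<notin> \<phi> ` carrier C" "w \<in> \<Omega>" "\<not> headed (snd w)"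
  shows "headed (snd (act a w))"
proof -
  have c: "fst w \<in> carrier C" using assms by (auto simp: \<Omega>_def)
  then have "rep (a \<otimes>\<^bsub>A\<^esub> \<phi> (fst w)) \<noteq> \<one>\<^bsub>A\<^esub>"
    using rep_eq_one_iff image_C_mult(2) assms(1,2) by simp
  then show ?thesis using assms by (simp add: act_def push_def peel_def)
qed

lemma act_Nil: "snd (act a (c, [])) = [] \<or> headed (snd (act a (c, [])))"
  by (simp add: act_def push_def peel_def)

end

section \<open>The action of the amalgam on normal forms\<close>

primrec normal_form :: "('a, 'm) monoid_scheme \<Rightarrow> ('b, 'n) monoid_scheme \<Rightarrow> ('c, 'k) monoid_scheme \<Rightarrow>
    ('c \<Rightarrow> 'a) \<Rightarrow> ('c \<Rightarrow> 'b) \<Rightarrow> ('a + 'b) list \<Rightarrow> bool" where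
  "normal_form A B C \<phi> \<psi> [] \<longleftrightarrow> True"
| "normal_form A B C \<phi> \<psi> (x # s) \<longleftrightarrow> normal_form A B C \<phi> \<psi> s \<and>
     (case x of
       Inl t \<Rightarrow> t \<in> carrier A \<and> coset_rep A C \<phi> t = t \<and> t \<noteq> \<one>\<^bsub>A\<^esub> \<and> \<not> (s \<noteq> [] \<and> hd s \<in> range Inl)
     | Inr t \<Rightarrow> t \<in> carrier B \<and> coset_rep B C \<psi> t = t \<and> t \<noteq> \<one>\<^bsub>B\<^esub> \<and> \<not> (s \<noteq> [] \<and> hd s \<in> range Inr))"

locale amalgam_embedding = amalgam_data A B C \<phi> \<psi>
  for A :: "('a, 'm) monoid_scheme" and B :: "('b, 'n) monoid_scheme"
    and C :: "('c, 'k) monoid_scheme" and \<phi> :: "'c \<Rightarrow> 'a" and \<psi> :: "'c \<Rightarrow> 'b" +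
  assumes phi_inj: "inj_on \<phi> (carrier C)" and psi_inj: "inj_on \<psi> (carrier C)"
begin

interpretation L: coset_side A C \<phi> Inl "normal_form A B C \<phi> \<psi>"
  by unfold_locales (auto simp: phi_hom phi_inj)

interpretation R: coset_side B C \<psi> Inr "normal_form A B C \<phi> \<psi>"
  by unfold_locales (auto simp: psi_hom psi_inj)

text \<open>Van der Waerden's method. Both factors act on the same set, since
  \<open>\<Omega>\<close> depends only on \<open>C\<close> and on the common predicate
  \<open>normal_form\<close>.\<close>

definition word_act :: "('a + 'b) list \<Rightarrow> 'c \<times> ('a + 'b) list \<Rightarrow> 'c \<times> ('a + 'b) list" where
  "word_act u w = foldr (\<lambda>x w. case x of Inl a \<Rightarrow> L.act a w | Inr b \<Rightarrow> R.act b w) u w"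

lemma word_act_simps [simp]: "word_act [] w = w" "word_act (Inl a # u) w = L.act a (word_act u w)"
  "word_act (Inr b # u) w = R.act b (word_act u w)" "word_act (u @ v) w = word_act u (word_act v w)"
  by (simp_all add: word_act_def)

lemma word_act_mem:
  assumes "u \<in> W" "w \<in> L.\<Omega>" shows "word_act u w \<in> L.\<Omega>"
  using assms(1)
proof (induction u)
  case (Cons x u)
  from Cons.prems show ?case
    by (cases rule: words_cases) (simp_all add: Cons.IH L.act_mem R.act_mem)
qed (use assms(2) in simp)

text \<open>The action respects each defining relation and so descends to classes of words; applied
  to \<open>w0\<close> it reads off a normal form of the class.\<close>

lemma word_act_eq:
  assumes "weq u v" "w \<in> L.\<Omega>" shows "word_act u w = word_act v w"
  using assms
proof (induction arbitrary: w)
  case (append u v u' v')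
  have "v' \<in> W" using eq_words[OF append.hyps(2)] by blast
  then have "word_act v' w \<in> L.\<Omega>" using append.prems by (rule word_act_mem)
  then show ?case using append.IH append.prems by simp
next
  case (mult_left a a')
  then show ?case by (simp add: L.act_mult)
next
  case (mult_right b b')
  then show ?case by (simp add: R.act_mult)
next
  case (glue c)
  then show ?case by (simp add: L.act_C R.act_C)
qed (simp_all add: L.act_one R.act_one)

abbreviation "w0 \<equiv> (\<one>\<^bsub>C\<^esub>, [] :: ('a + 'b) list)"

lemma w0: "w0 \<in> L.\<Omega>"
  by (simp add: L.\<Omega>_def)

lemma left_inj: "inj_on \<iota>A (carrier A)"
proof (rule inj_onI)
  fix a b assume ab: "a \<in> carrier A" "b \<in> carrier A" "\<iota>A a = \<iota>A b"
  then have "weq [Inl a] [Inl b]" by (simp add: amalgam_left_def cl_eq)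
  from word_act_eq[OF this w0] show "a = b" using L.act_inj[OF ab(1,2) w0] by simp
qed

lemma right_inj: "inj_on \<iota>B (carrier B)"
proof (rule inj_onI)
  fix a b assume ab: "a \<in> carrier B" "b \<in> carrier B" "\<iota>B a = \<iota>B b"
  then have "weq [Inr a] [Inr b]" by (simp add: amalgam_right_def cl_eq)
  from word_act_eq[OF this w0] show "a = b" using R.act_inj[OF ab(1,2) w0] by simp
qed

text \<open>Applied to \<open>w0\<close>, an element of \<open>A\<close> outside the image of
  \<open>C\<close> produces a leading letter from \<open>A\<close>, whereas elements of
  \<open>B\<close> produce the empty list or a leading letter from \<open>B\<close>.\<close>

lemma left_right_eq:
  assumes "a \<in> carrier A" "b \<in> carrier B" "\<iota>A a = \<iota>B b"
  shows "a \<in> \<phi> ` carrier C" "b \<in> \<psi> ` carrier C"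
proof -
  have eq: "L.act a w0 = R.act b w0"
    using assms word_act_eq[OF _ w0, of "[Inl a]" "[Inr b]"]
    by (simp add: amalgam_left_def amalgam_right_def cl_eq)
  show "a \<in> \<phi> ` carrier C"
  proof (rule ccontr)
    assume "a \<notin> \<phi> ` carrier C"
    then have "L.headed (snd (L.act a w0))" using L.act_headed[OF assms(1) _ w0] by simp
    then show False using R.act_Nil[of b "\<one>\<^bsub>C\<^esub>"] eq by (auto simp: L.headed_def R.headed_def)
  qed
  show "b \<in> \<psi> ` carrier C"
  proof (rule ccontr)
    assume "b \<notin> \<psi> ` carrier C"
    then have "R.headed (snd (R.act b w0))" using R.act_headed[OF assms(2) _ w0] by simp
    then show False using L.act_Nil[of a "\<one>\<^bsub>C\<^esub>"] eq by (auto simp: L.headed_def R.headed_def)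
  qed
qed

lemma left_Int_right: "\<iota>A ` carrier A \<inter> \<iota>B ` carrier B = \<iota>A ` \<phi> ` carrier C"
proof
  show "\<iota>A ` carrier A \<inter> \<iota>B ` carrier B \<subseteq> \<iota>A ` \<phi> ` carrier C"
    using left_right_eq(1) by blast
  show "\<iota>A ` \<phi> ` carrier C \<subseteq> \<iota>A ` carrier A \<inter> \<iota>B ` carrier B"
    using left_right_glue hom_in_carrier[OF phi_hom] hom_in_carrier[OF psi_hom] by force
qed

text \<open>These are the ping-pong sets: classes sorted by the factor of the first letter. Elements
  of \<open>C\<close> have no letter and lie in neither set.\<close>

definition starts_left :: "('a + 'b) list set set" where
  "starts_left = {cl u |u. u \<in> W \<and> L.headed (snd (word_act u w0))}"

definition starts_right :: "('a + 'b) list set set" where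
  "starts_right = {cl u |u. u \<in> W \<and> R.headed (snd (word_act u w0))}"

lemma starts_left_iff: "u \<in> W \<Longrightarrow> cl u \<in> starts_left \<longleftrightarrow> L.headed (snd (word_act u w0))"
  unfolding starts_left_def using word_act_eq[OF _ w0, of u] cl_eq[of u] by auto

lemma starts_right_iff: "u \<in> W \<Longrightarrow> cl u \<in> starts_right \<longleftrightarrow> R.headed (snd (word_act u w0))"
  unfolding starts_right_def using word_act_eq[OF _ w0, of u] cl_eq[of u] by auto

lemma not_both_headed: "L.headed s \<Longrightarrow> \<not> R.headed s"
  by (auto simp: L.headed_def R.headed_def)

text \<open>The ping-pong condition is \<open>act_headed\<close>: a letter outside \<open>C\<close>,
  put before a normal form that starts in the other factor, becomes the new first letter.\<close>

lemma ping_pong_amalgam: "ping_pong P (\<iota>A ` carrier A) (\<iota>B ` carrier B) starts_left starts_right"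
proof -
  interpret P: group P by (rule group_amalgam)
  interpret hA: group_hom A P \<iota>A by unfold_locales (rule left_hom)
  interpret hB: group_hom B P \<iota>B by unfold_locales (rule right_hom)
  have gen: "generate P (\<iota>A ` carrier A \<union> \<iota>B ` carrier B) = carrier P"
  proof (rule amalgam_generated)
    show "generate A (carrier A) = carrier A"
      using A.generate_incl[of "carrier A"] generate.incl[of _ "carrier A" A] by blast
    show "generate B (carrier B) = carrier B"
      using B.generate_incl[of "carrier B"] generate.incl[of _ "carrier B" B] by blast
  qed simp_all
  have C: "x \<notin> starts_left \<and> x \<notin> starts_right" if x: "x \<in> \<iota>A ` carrier A \<inter> \<iota>B ` carrier B" for x
  proof -
    obtain c where c: "c \<in> carrier C" "x = cl [Inl (\<phi> c)]"
      using x unfolding left_Int_right by (auto simp: amalgam_left_def)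
    then show ?thesis
      using hom_in_carrier[OF phi_hom c(1)] L.act_C[OF c(1) w0]
      by (simp add: starts_left_iff starts_right_iff)
  qed
  have not_C: "a \<in> carrier A \<Longrightarrow> \<iota>A a \<notin> \<iota>B ` carrier B \<Longrightarrow> a \<notin> \<phi> ` carrier C"
    "b \<in> carrier B \<Longrightarrow> \<iota>B b \<notin> \<iota>A ` carrier A \<Longrightarrow> b \<notin> \<psi> ` carrier C" for a b
    using left_right_glue hom_in_carrier[OF phi_hom] hom_in_carrier[OF psi_hom] by force+
  show ?thesis
  proof (intro ping_pong.intro P.is_group ping_pong_axioms.intro)
    show "subgroup (\<iota>A ` carrier A) P" by (rule hA.img_is_subgroup)
    show "subgroup (\<iota>B ` carrier B) P" by (rule hB.img_is_subgroup)
    show "starts_left \<inter> starts_right = {}"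
      using not_both_headed starts_right_iff by (auto simp: starts_left_def)
    show "\<iota>A ` carrier A \<inter> \<iota>B ` carrier B \<inter> starts_left = {}"
      "\<iota>A ` carrier A \<inter> \<iota>B ` carrier B \<inter> starts_right = {}" using C by blast+
    show "\<iota>A ` carrier A - \<iota>B ` carrier B \<subseteq> starts_left"
    proof
      fix x assume "x \<in> \<iota>A ` carrier A - \<iota>B ` carrier B"
      then obtain a where a: "a \<in> carrier A" "x = \<iota>A a" "a \<notin> \<phi> ` carrier C" using not_C(1) by blast
      then show "x \<in> starts_left"
        using L.act_headed[OF a(1,3) w0] by (simp add: amalgam_left_def starts_left_iff)
    qed
    show "\<iota>B ` carrier B - \<iota>A ` carrier A \<subseteq> starts_right"
    proof
      fix x assume "x \<in> \<iota>B ` carrier B - \<iota>A ` carrier A"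
      then obtain b where b: "b \<in> carrier B" "x = \<iota>B b" "b \<notin> \<psi> ` carrier C" using not_C(2) by blast
      then show "x \<in> starts_right"
        using R.act_headed[OF b(1,3) w0] by (simp add: amalgam_right_def starts_right_iff)
    qed
    show "x \<otimes>\<^bsub>P\<^esub> v \<in> starts_left"
      if x: "x \<in> \<iota>A ` carrier A - \<iota>B ` carrier B" and v: "v \<in> starts_right" for x v
    proof -
      obtain a where a: "a \<in> carrier A" "x = \<iota>A a" "a \<notin> \<phi> ` carrier C" using not_C(1) x by blast
      obtain u where u: "u \<in> W" "v = cl u" "R.headed (snd (word_act u w0))"
        using v by (auto simp: starts_right_def)
      have "x \<otimes>\<^bsub>P\<^esub> v = cl (Inl a # u)" using a u by (simp add: amalgam_left_def cl_mult)
      then show ?thesis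
        using a u L.act_headed[OF a(1,3) word_act_mem[OF u(1) w0]] not_both_headed
        by (auto simp: starts_left_iff)
    qed
    show "x \<otimes>\<^bsub>P\<^esub> v \<in> starts_right"
      if x: "x \<in> \<iota>B ` carrier B - \<iota>A ` carrier A" and v: "v \<in> starts_left" for x v
    proof -
      obtain b where b: "b \<in> carrier B" "x = \<iota>B b" "b \<notin> \<psi> ` carrier C" using not_C(2) x by blast
      obtain u where u: "u \<in> W" "v = cl u" "L.headed (snd (word_act u w0))"
        using v by (auto simp: starts_left_def)
      have "x \<otimes>\<^bsub>P\<^esub> v = cl (Inr b # u)" using b u by (simp add: amalgam_right_def cl_mult)
      then show ?thesis
        using b u R.act_headed[OF b(1,3) word_act_mem[OF u(1) w0]] not_both_headed
        by (auto simp: starts_right_iff)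
    qed
  qed (rule gen)
qed

end

section \<open>Transfer to the cosets in the amalgam, and conclusion\<close>

lemma rips_complex_isometry:
  assumes "\<And>x y. x \<in> X \<Longrightarrow> y \<in> X \<Longrightarrow> d' (f x) (f y) = d x y"
  shows "rips_complex (f ` X) d' r = image f ` rips_complex X d r"
proof
  show "image f ` rips_complex X d r \<subseteq> rips_complex (f ` X) d' r"
    using assms by (auto simp: rips_complex_iff subset_iff)
  show "rips_complex (f ` X) d' r \<subseteq> image f ` rips_complex X d r"
  proof
    fix \<sigma> assume s: "\<sigma> \<in> rips_complex (f ` X) d' r"
    then obtain \<tau> where t: "\<tau> \<subseteq> X" "finite \<tau>" "\<sigma> = f ` \<tau>"
      by (meson rips_complex_iff finite_subset_image)
    then have "\<tau> \<in> rips_complex X d r"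
      using s assms by (fastforce simp: rips_complex_iff subset_iff)
    then show "\<sigma> \<in> image f ` rips_complex X d r" using t by blast
  qed
qed

text \<open>Left translation preserves the word metric, and \<open>metric\<close> reduces distances
  in the image of \<open>h\<close> to the generators of \<open>H\<close>. The Rips complexes of
  \<open>H\<close> and of the coset then differ by a relabelling of vertices.\<close>

lemma compactly_null_coset:
  assumes H: "group H" and G: "group G" and h: "h \<in> hom H G" "inj_on h (carrier H)"
    and S: "S \<subseteq> carrier H" and g: "g \<in> carrier G"
    and metric: "\<And>x y. x \<in> h ` carrier H \<Longrightarrow> y \<in> h ` carrier H \<Longrightarrow>
      word_metric G T x y = word_metric G (h ` S) x y"
    and contr: "contractible_space (geometric_realization (rips_complex (carrier H) (word_metric H S) r))"
  shows "compactly_null (geometric_realization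
    (rips_complex ((\<lambda>x. g \<otimes>\<^bsub>G\<^esub> x) ` h ` carrier H) (word_metric G T) r))"
proof (rule compactly_null_isomorphic_complex[OF abstract_complex_rips abstract_complex_rips _ _ contr,
      where f = "\<lambda>a. g \<otimes>\<^bsub>G\<^esub> h a"])
  interpret G: group G by (rule G)
  have hc: "h a \<in> carrier G" if "a \<in> carrier H" for a using hom_in_carrier[OF h(1) that] .
  have "word_metric G T (g \<otimes>\<^bsub>G\<^esub> h a) (g \<otimes>\<^bsub>G\<^esub> h b) = word_metric H S a b"
    if "a \<in> carrier H" "b \<in> carrier H" for a b
    using that hc g metric word_metric_hom[OF H G h S] by (simp add: G.word_metric_translate)
  from rips_complex_isometry[of "carrier H" "word_metric G T" "\<lambda>a. g \<otimes>\<^bsub>G\<^esub> h a", OF this]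
  show "rips_complex ((\<lambda>x. g \<otimes>\<^bsub>G\<^esub> x) ` h ` carrier H) (word_metric G T) r =
      image (\<lambda>a. g \<otimes>\<^bsub>G\<^esub> h a) ` rips_complex (carrier H) (word_metric H S) r"
    by (simp add: image_image)
  have "inj_on (\<lambda>a. g \<otimes>\<^bsub>G\<^esub> h a) (carrier H)"
    using g hc inj_on_eq_iff[OF h(2)] by (intro inj_onI) simp
  then show "inj_on (\<lambda>a. g \<otimes>\<^bsub>G\<^esub> h a) (\<Union> (rips_complex (carrier H) (word_metric H S) r))"
    by (rule inj_on_subset) (auto simp: rips_complex_iff)
qed

theorem theorem1p3:
  fixes A :: "('a, 'm) monoid_scheme" and B :: "('b, 'n) monoid_scheme"
    and C :: "('c, 'k) monoid_scheme"
    and \<phi> :: "'c \<Rightarrow> 'a" and \<psi> :: "'c \<Rightarrow> 'b"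
    and S\<^sub>A :: "'a set" and S\<^sub>B :: "'b set"
  assumes "group A" and "group B" and "group C" and "finite (carrier C)"
    and "\<phi> \<in> mon C A" and "\<psi> \<in> mon C B"
    and "marked_group A S\<^sub>A" and "marked_group B S\<^sub>B"
    and "\<phi> ` (carrier C - {\<one>\<^bsub>C\<^esub>}) \<subseteq> S\<^sub>A" and "\<psi> ` (carrier C - {\<one>\<^bsub>C\<^esub>}) \<subseteq> S\<^sub>B"
    and "type_R A S\<^sub>A" and "type_R B S\<^sub>B"
  shows "type_R (amalgam A B C \<phi> \<psi>)
           (amalgam_left A B C \<phi> \<psi> ` S\<^sub>A \<union> amalgam_right A B C \<phi> \<psi> ` S\<^sub>B)"
proof -
  interpret amalgam_embedding A B C \<phi> \<psi>
    using assms(1-6) by (intro amalgam_embedding.intro amalgam_data.intro amalgam_data_axioms.intro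
        amalgam_embedding_axioms.intro) (auto simp: mon_def)
  interpret P: group P by (rule group_amalgam)
  interpret hA: group_hom A P \<iota>A by unfold_locales (rule left_hom)
  interpret hB: group_hom B P \<iota>B by unfold_locales (rule right_hom)
  let ?PA = "\<iota>A ` carrier A" and ?PB = "\<iota>B ` carrier B"
  have SA: "finite S\<^sub>A" "S\<^sub>A \<subseteq> carrier A" "generate A S\<^sub>A = carrier A"
    and SB: "finite S\<^sub>B" "S\<^sub>B \<subseteq> carrier B" "generate B S\<^sub>B = carrier B"
    using assms(7,8) by (auto simp: marked_group_def)
  \<comment> \<open>The intersection of the embedded factors is the image of \<open>C\<close>, so
    the assumptions on \<open>\<phi>\<close> and \<open>\<psi>\<close> put its non-trivial elements
    into both generating sets.\<close>
  have C_gen: "x \<in> \<iota>A ` S\<^sub>A \<and> x \<in> \<iota>B ` S\<^sub>B" if x: "x \<in> ?PA \<inter> ?PB" "x \<noteq> \<one>\<^bsub>P\<^esub>" for x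
  proof -
    obtain c where c: "c \<in> carrier C" "x = \<iota>A (\<phi> c)" using x(1) unfolding left_Int_right by blast
    then have "x = \<iota>B (\<psi> c)" using left_right_glue by simp
    moreover have "c \<noteq> \<one>\<^bsub>C\<^esub>" using x(2) c hom_one[OF phi_hom C.is_group A.is_group] by auto
    ultimately show ?thesis using c assms(9,10) by blast
  qed
  have gen: "generate P (\<iota>A ` S\<^sub>A \<union> \<iota>B ` S\<^sub>B) = carrier P"
    using SA SB by (intro amalgam_generated) auto
  have split: "amalgam_splitting P ?PA ?PB starts_left starts_right (\<iota>A ` S\<^sub>A) (\<iota>B ` S\<^sub>B)"
  proof (intro amalgam_splitting.intro ping_pong_amalgam amalgam_splitting_axioms.intro gen)
    show "finite (?PA \<inter> ?PB)" unfolding left_Int_right using assms(4) by simp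
  qed (use SA SB C_gen in blast)+
  interpret split: amalgam_splitting P ?PA ?PB starts_left starts_right "\<iota>A ` S\<^sub>A" "\<iota>B ` S\<^sub>B"
    by (rule split)
  obtain rA where rA: "\<And>r. rA \<le> r \<Longrightarrow> contractible_space
      (geometric_realization (rips_complex (carrier A) (word_metric A S\<^sub>A) r))"
    using assms(11) by (auto simp: type_R_def)
  obtain rB where rB: "\<And>r. rB \<le> r \<Longrightarrow> contractible_space
      (geometric_realization (rips_complex (carrier B) (word_metric B S\<^sub>B) r))"
    using assms(12) by (auto simp: type_R_def)
  \<comment> \<open>From 1 on the cosets of \<open>C\<close> span simplices; from \<open>rA\<close>
    and \<open>rB\<close> on the Rips complexes of the factors are contractible.\<close>
  have "contractible_space (geometric_realization (rips_complex (carrier P) split.wdist r))"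
    if r: "max 1 (max rA rB) \<le> r" for r
  proof (rule split.contractible_rips)
    show "1 \<le> r" using r by simp
    fix g assume g: "g \<in> carrier P"
    show "compactly_null (geometric_realization (rips_complex ((\<lambda>x. g \<otimes>\<^bsub>P\<^esub> x) ` ?PA) split.wdist r))"
      using r by (intro compactly_null_coset[OF A.is_group P.is_group left_hom left_inj SA(2) g]
          split.word_metric_A rA) auto
    show "compactly_null (geometric_realization (rips_complex ((\<lambda>x. g \<otimes>\<^bsub>P\<^esub> x) ` ?PB) split.wdist r))"
      using r amalgam_splitting.word_metric_A[OF split.swap_splitting]
      by (intro compactly_null_coset[OF B.is_group P.is_group right_hom right_inj SB(2) g] rB)
        (auto simp: Un_commute)
  qed
  moreover have "marked_group P (\<iota>A ` S\<^sub>A \<union> \<iota>B ` S\<^sub>B)"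
    unfolding marked_group_def using SA SB gen by auto
  ultimately show ?thesis
    unfolding type_R_def by (intro conjI exI[of _ "max 1 (max rA rB)"]) auto
qed

end
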